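(* Consider a purely kinetic Chaplygin system $(L=\frac12 g,\mathcal D)$ with symmetry group $G$ and bundle $\pi:Q\to Q/G$, and suppose that it is $\varphi$-simple for a function $\varphi\in C^\infty(Q/G)$. Then the couple $(\overline g_{ai}=-G_{ai},F=\varphi\circ\pi)$ satisfies both conditions (for all $c$, all $i$ and all values of $(v^a)$, with $\theta_k=\overline g_{ak}v^a$) $$(A')\quad g_{bd}\left(\delta_a^dX_c(F)-\delta_c^dX_a(F)\right)v^av^b+\theta_kR^k_{ac}v^a=0,$$ $$(B')\quad \Gamma^{nh}(\theta_i)+\lambda_i+\theta_k\left(R^k_{ia}+\delta^k_iX_a(F)\right)v^a-g_{ab}X_i(F)v^av^b=0,$$ i.e. it is a $(V\pi,\mathcal D)$-orthogonal projective geodesic extension.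
   Context: Setting: $Q$ is an $n$-dimensional manifold with Riemannian metric $g$, $\mathcal D\subset TQ$ is a distribution of rank $m$, $L(v)=\frac12g(v,v)$. The system is a (purely kinetic) Chaplygin system: a Lie group $G$ acts freely and properly on $Q$, $\pi:Q\to Q/G$ is the principal bundle, $g$ and $\mathcal D$ are $G$-invariant, and $\mathcal D$ is the horizontal distribution of a principal connection on $\pi$ (so $TQ=\mathcal D\oplus V\pi$, with $V\pi=\ker T\pi$, and $\dim Q/G=m$). Indices $a,b,c,d=1,\dots,m$; $i,j,k=1,\dots,n-m$. Summation convention is used. Frames: $V_i$ are the infinitesimal generators of a basis of the Lie algebra of $G$; $X_a$ are the horizontal lifts of the coordinate fields $\partial/\partial q^a$ on $Q/G$. Set $G_{ab}=g(X_a,X_b)$ (inverse $G^{ab}$), $G_{ai}=g(X_a,V_i)$, $K^b_i=-G^{ab}G_{ai}$, $X_i=V_i+K^b_iX_b$. Then $\{X_a,X_i\}$ is a local frame with $X_a$ spanning $\mathcal D$ and $X_i$ spanning its $g$-orthogonal complement. Write $[X_\alpha,X_\beta]=R^\gamma_{\alpha\beta}X_\gamma$ in this frame, $g_{ab}=G_{ab}$, $g_{ij}=g(X_i,X_j)$, $\overline g_{ai}=\overline g(X_a,X_i)$; $v^a,v^i$ are the components of tangent vectors in this frame ($\mathcal D$ is $v^i=0$). With $\nabla$ the Levi-Civita connection of $g$, $\nabla_{X_a}X_b=\Gamma^c_{ab}X_c+\Gamma^i_{ab}X_i$. $\varphi$-simplicity: the gyroscopic tensor $\mathcal T$ is the $(1,2)$-tensor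 field on $Q/G$ with $\mathcal T(\partial/\partial q^a,\partial/\partial q^b)=R^d_{ab}\,\partial/\partial q^d$ (the functions $R^d_{ab}$ are $G$-invariant). The system is $\varphi$-simple if $\mathcal T(\tilde X,\tilde Y)=-d\varphi(\tilde X)\tilde Y+d\varphi(\tilde Y)\tilde X$, i.e. $R^d_{ab}=-\frac{\partial\varphi}{\partial q^a}\delta^d_b+\frac{\partial\varphi}{\partial q^b}\delta^d_a$. Here $\overline g$ is a $\mathcal D$-preserving modification of $g$, i.e. a symmetric $(0,2)$-tensor field with $\overline g|_{\mathcal D\times\mathcal D}=g|_{\mathcal D\times\mathcal D}$. A couple $(\overline g_{ai},F)$ is called a projective geodesic extension when it satisfies $(A')$ and $(B')$; it is $(V\pi,\mathcal D)$-orthogonal when $\overline g|_{V\pi\times\mathcal D}=0$, equivalently $\overline g_{ai}=-G_{ai}$. The nonholonomic vector field $\Gamma^{nh}$ is the vector field on the manifold $\mathcal D$ whose integral curves satisfy $\dot q=v^aX_a(q)$, $\dot v^d=-\Gamma^d_{ab}v^av^b$; so $\Gamma^{nh}(\theta_bv^b)=(X_a(\theta_b)-\theta_d\Gamma^d_{ab})v^av^b$ for functions $\theta_b$ on $Q$. The Lagrange multipliers are $\lambda_i=g_{ki}\Gamma^k_{ab}v^av^b$. *)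

theory Defs
  imports "HOL-Analysis.Analysis"
begin

section \<open>Smooth manifolds\<close>

text \<open>Only meaningful for open sets \<open>S\<close> of a finite-dimensional domain.\<close>

primrec Ck_on :: "nat \<Rightarrow> ('a::real_normed_vector \<Rightarrow> 'b::real_normed_vector) \<Rightarrow> 'a set \<Rightarrow> bool" where
  "Ck_on 0 f S = continuous_on S f"
| "Ck_on (Suc k) f S = ((\<forall>x\<in>S. f differentiable (at x)) \<and>
     (\<forall>w. Ck_on k (\<lambda>x. frechet_derivative f (at x) w) S))"

definition smooth_on :: "'a::real_normed_vector set \<Rightarrow> ('a \<Rightarrow> 'b::real_normed_vector) \<Rightarrow> bool" where
  "smooth_on S f \<longleftrightarrow> (\<forall>k. Ck_on k f S)"

text \<open>A manifold is a whole type together with a smooth atlas. A chart is a pair of a domain and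
  a coordinate map.\<close>

type_synonym ('p, 'e) chart = "'p set \<times> ('p \<Rightarrow> 'e)"

definition chart_inv :: "('p, 'e) chart \<Rightarrow> 'e \<Rightarrow> 'p" where
  "chart_inv c = inv_into (fst c) (snd c)"

definition is_chart :: "('p::topological_space, 'e::euclidean_space) chart \<Rightarrow> bool" where
  "is_chart c \<longleftrightarrow> open (fst c) \<and> open (snd c ` fst c) \<and>
     homeomorphism (fst c) (snd c ` fst c) (snd c) (chart_inv c)"

definition compatible ::
  "('p::topological_space, 'e::euclidean_space) chart \<Rightarrow> ('p, 'e) chart \<Rightarrow> bool" where
  "compatible c d \<longleftrightarrow>
     smooth_on (snd c ` (fst c \<inter> fst d)) (snd d \<circ> chart_inv c) \<and>
     smooth_on (snd d ` (fst c \<inter> fst d)) (snd c \<circ> chart_inv d)"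

definition smooth_manifold ::
  "('p::{t2_space, second_countable_topology}, 'e::euclidean_space) chart set \<Rightarrow> bool" where
  "smooth_manifold A \<longleftrightarrow>
     (\<forall>c\<in>A. is_chart c) \<and> (\<Union>c\<in>A. fst c) = UNIV \<and> (\<forall>c\<in>A. \<forall>d\<in>A. compatible c d)"

text \<open>The charts of the maximal atlas.\<close>

definition charts ::
  "('p::topological_space, 'e::euclidean_space) chart set \<Rightarrow> ('p, 'e) chart set" where
  "charts A = {c. is_chart c \<and> (\<forall>d\<in>A. compatible c d)}"

definition prod_atlas :: "('p, 'e) chart set \<Rightarrow> ('r, 'f) chart set \<Rightarrow> ('p \<times> 'r, 'e \<times> 'f) chart set" where
  "prod_atlas A B = {(fst c \<times> fst d, map_prod (snd c) (snd d)) | c d. c \<in> A \<and> d \<in> B}"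

text \<open>In the next two definitions the set \<open>W\<close> is meant to be open.\<close>

definition smooth_fun ::
  "('p::topological_space, 'e::euclidean_space) chart set \<Rightarrow> 'p set \<Rightarrow> ('p \<Rightarrow> real) \<Rightarrow> bool" where
  "smooth_fun A W f \<longleftrightarrow> (\<forall>c\<in>A. smooth_on (snd c ` (fst c \<inter> W)) (f \<circ> chart_inv c))"

definition smooth_map_on ::
  "('p::topological_space, 'e::euclidean_space) chart set \<Rightarrow>
   ('r::topological_space, 'f::euclidean_space) chart set \<Rightarrow> 'p set \<Rightarrow> ('p \<Rightarrow> 'r) \<Rightarrow> bool" where
  "smooth_map_on A B W f \<longleftrightarrow> continuous_on W f \<and>
     (\<forall>c\<in>A. \<forall>d\<in>B. smooth_on (snd c ` (fst c \<inter> W \<inter> f -` fst d)) (snd d \<circ> f \<circ> chart_inv c))"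

definition smooth_near ::
  "('p::topological_space, 'e::euclidean_space) chart set \<Rightarrow> ('p \<Rightarrow> real) \<Rightarrow> 'p \<Rightarrow> bool" where
  "smooth_near A f q \<longleftrightarrow> (\<exists>W. open W \<and> q \<in> W \<and> smooth_fun A W f)"

section \<open>Tangent vectors and tensors\<close>

text \<open>A tangent vector at \<open>q\<close> is a directional derivative at \<open>q\<close>, acting on the functions that
  are smooth near \<open>q\<close>. It is extended by 0 to all other functions, so that tangent vectors agreeing on
  smooth functions are equal.\<close>

type_synonym 'p tvec = "('p \<Rightarrow> real) \<Rightarrow> real"

definition dirderiv ::
  "('p::topological_space, 'e::euclidean_space) chart set \<Rightarrow> ('p, 'e) chart \<Rightarrow> 'p \<Rightarrow> 'e \<Rightarrow> 'p tvec" where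
  "dirderiv A c q w = (\<lambda>f. if smooth_near A f q
     then frechet_derivative (f \<circ> chart_inv c) (at (snd c q)) w else 0)"

definition tspace ::
  "('p::topological_space, 'e::euclidean_space) chart set \<Rightarrow> 'p \<Rightarrow> 'p tvec set" where
  "tspace A q = {dirderiv A c q w | c w. c \<in> charts A \<and> q \<in> fst c}"

definition lincomb :: "('i::finite \<Rightarrow> 'p tvec) \<Rightarrow> ('i \<Rightarrow> real) \<Rightarrow> 'p tvec" where
  "lincomb e r = (\<lambda>f. \<Sum>i\<in>UNIV. r i * e i f)"

definition is_basis :: "'p tvec set \<Rightarrow> ('i::finite \<Rightarrow> 'p tvec) \<Rightarrow> bool" where
  "is_basis T e \<longleftrightarrow> bij_betw (lincomb e) UNIV T"

definition component :: "('i::finite \<Rightarrow> 'p tvec) \<Rightarrow> 'p tvec \<Rightarrow> 'i \<Rightarrow> real" where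
  "component e u = (THE r. lincomb e r = u)"

text \<open>The tangent map of \<open>f\<close> at \<open>q\<close>; the atlas is that of the codomain of \<open>f\<close>.\<close>

definition tangent_map ::
  "('r::topological_space, 'f::euclidean_space) chart set \<Rightarrow> ('p \<Rightarrow> 'r) \<Rightarrow> 'p \<Rightarrow> 'p tvec \<Rightarrow> 'r tvec" where
  "tangent_map B f q u = (\<lambda>h. if smooth_near B h (f q) then u (h \<circ> f) else 0)"

definition vector_field ::
  "('p::topological_space, 'e::euclidean_space) chart set \<Rightarrow> 'p set \<Rightarrow> ('p \<Rightarrow> 'p tvec) \<Rightarrow> bool" where
  "vector_field A U X \<longleftrightarrow> (\<forall>q\<in>U. X q \<in> tspace A q) \<and>
     (\<forall>W f. open W \<and> W \<subseteq> U \<and> smooth_fun A W f \<longrightarrow> smooth_fun A W (\<lambda>q. X q f))"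

definition bracket ::
  "('p::topological_space, 'e::euclidean_space) chart set \<Rightarrow>
   ('p \<Rightarrow> 'p tvec) \<Rightarrow> ('p \<Rightarrow> 'p tvec) \<Rightarrow> 'p \<Rightarrow> 'p tvec" where
  "bracket A X Y q = (\<lambda>f. if smooth_near A f q
     then X q (\<lambda>p. Y p f) - Y q (\<lambda>p. X p f) else 0)"

definition symmetric_tensor ::
  "('p::topological_space, 'e::euclidean_space) chart set \<Rightarrow>
   ('p \<Rightarrow> 'p tvec \<Rightarrow> 'p tvec \<Rightarrow> real) \<Rightarrow> bool" where
  "symmetric_tensor A h \<longleftrightarrow>
     (\<forall>q. \<forall>u\<in>tspace A q. \<forall>w\<in>tspace A q. h q u w = h q w u) \<and>
     (\<forall>q. \<forall>u\<in>tspace A q. \<forall>v\<in>tspace A q. \<forall>w\<in>tspace A q. \<forall>s t.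
        h q (\<lambda>f. s * u f + t * v f) w = s * h q u w + t * h q v w) \<and>
     (\<forall>U X Y. open U \<and> vector_field A U X \<and> vector_field A U Y \<longrightarrow>
        smooth_fun A U (\<lambda>q. h q (X q) (Y q)))"

definition riemannian_metric ::
  "('p::topological_space, 'e::euclidean_space) chart set \<Rightarrow>
   ('p \<Rightarrow> 'p tvec \<Rightarrow> 'p tvec \<Rightarrow> real) \<Rightarrow> bool" where
  "riemannian_metric A g \<longleftrightarrow> symmetric_tensor A g \<and>
     (\<forall>q. \<forall>u\<in>tspace A q. u \<noteq> (\<lambda>_. 0) \<longrightarrow> g q u u > 0)"

text \<open>The connection acts on vector fields defined on arbitrary open sets, as it has to be applied to
  local frames.\<close>

definition levi_civita ::
  "('p::topological_space, 'e::euclidean_space) chart set \<Rightarrow>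
   ('p \<Rightarrow> 'p tvec \<Rightarrow> 'p tvec \<Rightarrow> real) \<Rightarrow>
   (('p \<Rightarrow> 'p tvec) \<Rightarrow> ('p \<Rightarrow> 'p tvec) \<Rightarrow> 'p \<Rightarrow> 'p tvec) \<Rightarrow> bool" where
  "levi_civita A g nabla \<longleftrightarrow>
     (\<forall>U X Y Z f. open U \<and> vector_field A U X \<and> vector_field A U Y \<and> vector_field A U Z \<and>
        smooth_fun A U f \<longrightarrow>
        vector_field A U (nabla X Y) \<and>
        (\<forall>q\<in>U.
           nabla (\<lambda>p h. X p h + Y p h) Z q = (\<lambda>h. nabla X Z q h + nabla Y Z q h) \<and>
           nabla X (\<lambda>p h. Y p h + Z p h) q = (\<lambda>h. nabla X Y q h + nabla X Z q h) \<and>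
           nabla (\<lambda>p h. f p * X p h) Y q = (\<lambda>h. f q * nabla X Y q h) \<and>
           nabla X (\<lambda>p h. f p * Y p h) q = (\<lambda>h. X q f * Y q h + f q * nabla X Y q h) \<and>
           (\<lambda>h. nabla X Y q h - nabla Y X q h) = bracket A X Y q \<and>
           X q (\<lambda>p. g p (Y p) (Z p)) = g q (nabla X Y q) (Z q) + g q (Y q) (nabla X Z q)))"

definition tensor_field_12 ::
  "('x::topological_space, 'e::euclidean_space) chart set \<Rightarrow>
   ('x \<Rightarrow> 'x tvec \<Rightarrow> 'x tvec \<Rightarrow> 'x tvec) \<Rightarrow> bool" where
  "tensor_field_12 B T \<longleftrightarrow>
     (\<forall>x. \<forall>u\<in>tspace B x. \<forall>v\<in>tspace B x. \<forall>w\<in>tspace B x. \<forall>s t.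
        T x (\<lambda>f. s * u f + t * v f) w = (\<lambda>f. s * T x u w f + t * T x v w f) \<and>
        T x w (\<lambda>f. s * u f + t * v f) = (\<lambda>f. s * T x w u f + t * T x w v f)) \<and>
     (\<forall>U X Y. open U \<and> vector_field B U X \<and> vector_field B U Y \<longrightarrow>
        vector_field B U (\<lambda>x. T x (X x) (Y x)))"

section \<open>Chaplygin systems\<close>

text \<open>The manifold \<open>Q\<close> of dimension \<open>n\<close> is the type \<open>'q\<close>, the quotient \<open>Q/G\<close> of dimension \<open>m\<close> is
  \<open>'x\<close> and the Lie group \<open>G\<close> is \<open>'g\<close>. The index type \<open>'k\<close> has \<open>n - m\<close> elements; this relation is
  forced by the local trivializations of the bundle.\<close>

record ('q, 'x, 'g, 'n, 'm, 'k) chaplygin_data =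
  atlQ :: "('q, real^'n) chart set"
  atlB :: "('x, real^'m) chart set"
  atlG :: "('g, real^'k) chart set"
  gmul :: "'g \<Rightarrow> 'g \<Rightarrow> 'g"
  gone :: 'g
  ginv :: "'g \<Rightarrow> 'g"
  act :: "'g \<Rightarrow> 'q \<Rightarrow> 'q"
  proj :: "'q \<Rightarrow> 'x"
  gmetric :: "'q \<Rightarrow> 'q tvec \<Rightarrow> 'q tvec \<Rightarrow> real"
  distr :: "'q \<Rightarrow> 'q tvec set"

definition lie_group ::
  "('g::{t2_space, second_countable_topology}, 'e::euclidean_space) chart set \<Rightarrow>
   ('g \<Rightarrow> 'g \<Rightarrow> 'g) \<Rightarrow> 'g \<Rightarrow> ('g \<Rightarrow> 'g) \<Rightarrow> bool" where
  "lie_group A mul e iv \<longleftrightarrow> smooth_manifold A \<and> Groups.group mul e iv \<and>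
     smooth_map_on (prod_atlas A A) A UNIV (\<lambda>(a, b). mul a b) \<and> smooth_map_on A A UNIV iv"

text \<open>A smooth distribution whose rank is the number of elements of the index type \<open>'m\<close>.\<close>

definition distribution ::
  "('q::topological_space, 'e::euclidean_space) chart set \<Rightarrow> 'm::finite itself \<Rightarrow>
   ('q \<Rightarrow> 'q tvec set) \<Rightarrow> bool" where
  "distribution A m D \<longleftrightarrow> (\<forall>q. D q \<subseteq> tspace A q) \<and>
     (\<forall>q. \<exists>U (Y :: 'm \<Rightarrow> 'q \<Rightarrow> 'q tvec). open U \<and> q \<in> U \<and> (\<forall>a. vector_field A U (Y a)) \<and>
        (\<forall>p\<in>U. is_basis (D p) (\<lambda>a. Y a p)))"

context
  fixes S :: "('q::{t2_space, second_countable_topology}, 'x::{t2_space, second_countable_topology},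
      'g::{t2_space, second_countable_topology}, 'n::finite, 'm::finite, 'k::finite) chaplygin_data"
begin

definition smooth_action :: bool where
  "smooth_action \<longleftrightarrow>
     smooth_map_on (prod_atlas (atlG S) (atlQ S)) (atlQ S) UNIV (\<lambda>(h, q). act S h q) \<and>
     (\<forall>q. act S (gone S) q = q) \<and>
     (\<forall>h h' q. act S (gmul S h h') q = act S h (act S h' q))"

definition free_action :: bool where
  "free_action \<longleftrightarrow> (\<forall>h q. act S h q = q \<longrightarrow> h = gone S)"

definition proper_action :: bool where
  "proper_action \<longleftrightarrow> proper_map euclidean euclidean (\<lambda>(h, q). (act S h q, q))"

text \<open>The trivialization over \<open>U\<close> is \<open>q \<mapsto> (proj q, \<kappa> q)\<close>, with inverse \<open>\<tau>\<close>.\<close>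

definition principal_bundle :: bool where
  "principal_bundle \<longleftrightarrow>
     smooth_map_on (atlQ S) (atlB S) UNIV (proj S) \<and> surj (proj S) \<and>
     (\<forall>q q'. proj S q = proj S q' \<longleftrightarrow> (\<exists>h. q' = act S h q)) \<and>
     (\<forall>x. \<exists>U \<kappa> \<tau>. open U \<and> x \<in> U \<and>
        smooth_map_on (atlQ S) (atlG S) (proj S -` U) \<kappa> \<and>
        smooth_map_on (prod_atlas (atlB S) (atlG S)) (atlQ S) (U \<times> UNIV) \<tau> \<and>
        (\<forall>q\<in>proj S -` U. \<tau> (proj S q, \<kappa> q) = q) \<and>
        (\<forall>y\<in>U. \<forall>h. proj S (\<tau> (y, h)) = y \<and> \<kappa> (\<tau> (y, h)) = h) \<and>
        (\<forall>q\<in>proj S -` U. \<forall>h. \<kappa> (act S h q) = gmul S h (\<kappa> q)))"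

definition vertical :: "'q \<Rightarrow> 'q tvec set" where
  "vertical q = {u \<in> tspace (atlQ S) q. tangent_map (atlB S) (proj S) q u = (\<lambda>_. 0)}"

definition principal_connection :: bool where
  "principal_connection \<longleftrightarrow>
     distribution (atlQ S) TYPE('m) (distr S) \<and>
     (\<forall>q. distr S q \<inter> vertical q = {\<lambda>_. 0}) \<and>
     (\<forall>q. \<forall>u\<in>tspace (atlQ S) q. \<exists>v\<in>distr S q. \<exists>w\<in>vertical q. u = (\<lambda>f. v f + w f)) \<and>
     (\<forall>h q. tangent_map (atlQ S) (act S h) q ` distr S q = distr S (act S h q))"

definition invariant_metric :: bool where
  "invariant_metric \<longleftrightarrow>
     (\<forall>h q. \<forall>u\<in>tspace (atlQ S) q. \<forall>w\<in>tspace (atlQ S) q.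
        gmetric S (act S h q) (tangent_map (atlQ S) (act S h) q u) (tangent_map (atlQ S) (act S h) q w)
        = gmetric S q u w)"

definition chaplygin_system :: bool where
  "chaplygin_system \<longleftrightarrow>
     smooth_manifold (atlQ S) \<and> smooth_manifold (atlB S) \<and>
     lie_group (atlG S) (gmul S) (gone S) (ginv S) \<and>
     smooth_action \<and> free_action \<and> proper_action \<and> principal_bundle \<and>
     riemannian_metric (atlQ S) (gmetric S) \<and> invariant_metric \<and> principal_connection"

end

definition delta :: "'i \<Rightarrow> 'i \<Rightarrow> real" where
  "delta i j = (if i = j then 1 else 0)"

section \<open>The adapted frame\<close>

text \<open>Throughout, \<open>c\<close> is a chart of \<open>Q/G\<close> and \<open>\<xi>\<close> a basis of the Lie algebra, that is, of the
  tangent space of \<open>G\<close> at the identity. Everything below that depends on \<open>c\<close> is meaningful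
  over the domain of \<open>c\<close> only.\<close>

context
  fixes S :: "('q::{t2_space, second_countable_topology}, 'x::{t2_space, second_countable_topology},
      'g::{t2_space, second_countable_topology}, 'n::finite, 'm::finite, 'k::finite) chaplygin_data"
    and \<xi> :: "'k \<Rightarrow> 'g tvec"
    and nabla :: "('q \<Rightarrow> 'q tvec) \<Rightarrow> ('q \<Rightarrow> 'q tvec) \<Rightarrow> 'q \<Rightarrow> 'q tvec"
begin

definition lie_algebra_basis :: bool where
  "lie_algebra_basis \<longleftrightarrow> is_basis (tspace (atlG S) (gone S)) \<xi>"

definition coord_field :: "('x, real^'m) chart \<Rightarrow> 'm \<Rightarrow> 'x \<Rightarrow> 'x tvec" where
  "coord_field c a x = dirderiv (atlB S) c x (axis a 1)"

text \<open>The vertical fields \<open>V\<^sub>i\<close>: the infinitesimal generator of \<open>\<eta>\<close> at \<open>q\<close> is the image of \<open>\<eta>\<close>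
  under the tangent map at the identity of \<open>h \<mapsto> h q\<close>.\<close>

definition vert_field :: "'k \<Rightarrow> 'q \<Rightarrow> 'q tvec" where
  "vert_field i q = tangent_map (atlQ S) (\<lambda>h. act S h q) (gone S) (\<xi> i)"

text \<open>The horizontal fields \<open>X\<^sub>a\<close>.\<close>

definition hor_field :: "('x, real^'m) chart \<Rightarrow> 'm \<Rightarrow> 'q \<Rightarrow> 'q tvec" where
  "hor_field c a q = (THE u. u \<in> distr S q \<and>
     tangent_map (atlB S) (proj S) q u = coord_field c a (proj S q))"

definition G_hh :: "('x, real^'m) chart \<Rightarrow> 'm \<Rightarrow> 'm \<Rightarrow> 'q \<Rightarrow> real" where
  "G_hh c a b q = gmetric S q (hor_field c a q) (hor_field c b q)"

definition G_hv :: "('x, real^'m) chart \<Rightarrow> 'm \<Rightarrow> 'k \<Rightarrow> 'q \<Rightarrow> real" where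
  "G_hv c a i q = gmetric S q (hor_field c a q) (vert_field i q)"

definition G_inv :: "('x, real^'m) chart \<Rightarrow> 'm \<Rightarrow> 'm \<Rightarrow> 'q \<Rightarrow> real" where
  "G_inv c a b q = matrix_inv (\<chi> a b. G_hh c a b q) $ a $ b"

definition K_coeff :: "('x, real^'m) chart \<Rightarrow> 'm \<Rightarrow> 'k \<Rightarrow> 'q \<Rightarrow> real" where
  "K_coeff c b i q = - (\<Sum>a\<in>UNIV. G_inv c a b q * G_hv c a i q)"

text \<open>The frame is indexed by the sum type: \<open>X\<^sub>a\<close> has index \<open>Inl a\<close>, and
  \<open>X\<^sub>i = V\<^sub>i + K\<^sup>b\<^sub>i X\<^sub>b\<close> has index \<open>Inr i\<close>.\<close>

definition frame :: "('x, real^'m) chart \<Rightarrow> 'm + 'k \<Rightarrow> 'q \<Rightarrow> 'q tvec" where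
  "frame c \<alpha> q = (case \<alpha> of
       Inl a \<Rightarrow> hor_field c a q
     | Inr i \<Rightarrow> (\<lambda>f. vert_field i q f + (\<Sum>b\<in>UNIV. K_coeff c b i q * hor_field c b q f)))"

definition g_coeff ::
  "('x, real^'m) chart \<Rightarrow> 'm + 'k \<Rightarrow> 'm + 'k \<Rightarrow> 'q \<Rightarrow> real" where
  "g_coeff c \<alpha> \<beta> q = gmetric S q (frame c \<alpha> q) (frame c \<beta> q)"

text \<open>\<open>R_coeff c \<gamma> \<alpha> \<beta>\<close> is \<open>R\<^sup>\<gamma>\<^sub>\<alpha>\<^sub>\<beta>\<close>, and \<open>Gamma_coeff c \<gamma> a b\<close> is \<open>\<Gamma>\<^sup>\<gamma>\<^sub>a\<^sub>b\<close>.\<close>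

definition R_coeff ::
  "('x, real^'m) chart \<Rightarrow> 'm + 'k \<Rightarrow> 'm + 'k \<Rightarrow> 'm + 'k \<Rightarrow> 'q \<Rightarrow> real" where
  "R_coeff c \<gamma> \<alpha> \<beta> q = component (\<lambda>\<delta>. frame c \<delta> q)
     (bracket (atlQ S) (frame c \<alpha>) (frame c \<beta>) q) \<gamma>"

definition Gamma_coeff ::
  "('x, real^'m) chart \<Rightarrow> 'm + 'k \<Rightarrow> 'm \<Rightarrow> 'm \<Rightarrow> 'q \<Rightarrow> real" where
  "Gamma_coeff c \<gamma> a b q = component (\<lambda>\<delta>. frame c \<delta> q)
     (nabla (frame c (Inl a)) (frame c (Inl b)) q) \<gamma>"

section \<open>The gyroscopic tensor and \<open>\<phi>\<close>-simplicity\<close>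

definition gyroscopic_tensor :: "('x \<Rightarrow> 'x tvec \<Rightarrow> 'x tvec \<Rightarrow> 'x tvec) \<Rightarrow> bool" where
  "gyroscopic_tensor T \<longleftrightarrow> tensor_field_12 (atlB S) T \<and>
     (\<forall>c\<in>charts (atlB S). \<forall>q. proj S q \<in> fst c \<longrightarrow> (\<forall>a b.
        T (proj S q) (coord_field c a (proj S q)) (coord_field c b (proj S q))
        = lincomb (\<lambda>d. coord_field c d (proj S q)) (\<lambda>d. R_coeff c (Inl d) (Inl a) (Inl b) q)))"

definition phi_simple :: "('x \<Rightarrow> real) \<Rightarrow> bool" where
  "phi_simple \<phi> \<longleftrightarrow> (\<exists>T. gyroscopic_tensor T \<and>
     (\<forall>x. \<forall>u\<in>tspace (atlB S) x. \<forall>w\<in>tspace (atlB S) x. T x u w = (\<lambda>f. - u \<phi> * w f + w \<phi> * u f)))"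

section \<open>Projective geodesic extensions\<close>

text \<open>Points of the manifold \<open>\<D>\<close> over the domain of \<open>c\<close> are described by \<open>(q, v)\<close>, with \<open>v\<close> the
  components in the frame \<open>X\<^sub>a\<close>. The nonholonomic field is then the derivation
  \<open>v\<^sup>a X\<^sub>a - \<Gamma>\<^sup>d\<^sub>a\<^sub>b v\<^sup>a v\<^sup>b \<partial>/\<partial>v\<^sup>d\<close>, whose integral curves satisfy the equations of motion.\<close>

definition Gamma_nh ::
  "('x, real^'m) chart \<Rightarrow> ('q \<Rightarrow> real^'m \<Rightarrow> real) \<Rightarrow> 'q \<Rightarrow> real^'m \<Rightarrow> real" where
  "Gamma_nh c f q v =
     (\<Sum>a\<in>UNIV. v $ a * frame c (Inl a) q (\<lambda>p. f p v))
     - (\<Sum>d\<in>UNIV. (\<Sum>a\<in>UNIV. \<Sum>b\<in>UNIV. Gamma_coeff c (Inl d) a b q * v $ a * v $ b)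
          * frechet_derivative (f q) (at v) (axis d 1))"

definition multiplier :: "('x, real^'m) chart \<Rightarrow> 'k \<Rightarrow> 'q \<Rightarrow> real^'m \<Rightarrow> real" where
  "multiplier c i q v =
     (\<Sum>k\<in>UNIV. \<Sum>a\<in>UNIV. \<Sum>b\<in>UNIV.
        g_coeff c (Inr k) (Inr i) q * Gamma_coeff c (Inr k) a b q * v $ a * v $ b)"

text \<open>In the rest of this section \<open>\<beta> c a i\<close> stands for the component of the modified metric on
  \<open>X\<^sub>a\<close> and \<open>X\<^sub>i\<close>, in the frame belonging to \<open>c\<close>.\<close>

definition theta :: "('c \<Rightarrow> 'm::finite \<Rightarrow> 'k \<Rightarrow> 'q \<Rightarrow> real) \<Rightarrow> 'c \<Rightarrow> 'k \<Rightarrow> 'q \<Rightarrow> real^'m \<Rightarrow> real" where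
  "theta \<beta> c k q v = (\<Sum>a\<in>UNIV. \<beta> c a k q * v $ a)"

definition condition_A ::
  "(('x, real^'m) chart \<Rightarrow> 'm \<Rightarrow> 'k \<Rightarrow> 'q \<Rightarrow> real) \<Rightarrow> ('q \<Rightarrow> real) \<Rightarrow> bool" where
  "condition_A \<beta> F \<longleftrightarrow>
     (\<forall>ch\<in>charts (atlB S). \<forall>q. proj S q \<in> fst ch \<longrightarrow> (\<forall>c. \<forall>v :: real^'m.
        (\<Sum>a\<in>UNIV. \<Sum>b\<in>UNIV. \<Sum>d\<in>UNIV. g_coeff ch (Inl b) (Inl d) q *
           (delta a d * frame ch (Inl c) q F - delta c d * frame ch (Inl a) q F) * v $ a * v $ b)
        + (\<Sum>k\<in>UNIV. \<Sum>a\<in>UNIV. theta \<beta> ch k q v * R_coeff ch (Inr k) (Inl a) (Inl c) q * v $ a)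
        = 0))"

definition condition_B ::
  "(('x, real^'m) chart \<Rightarrow> 'm \<Rightarrow> 'k \<Rightarrow> 'q \<Rightarrow> real) \<Rightarrow> ('q \<Rightarrow> real) \<Rightarrow> bool" where
  "condition_B \<beta> F \<longleftrightarrow>
     (\<forall>ch\<in>charts (atlB S). \<forall>q. proj S q \<in> fst ch \<longrightarrow> (\<forall>i. \<forall>v :: real^'m.
        Gamma_nh ch (theta \<beta> ch i) q v + multiplier ch i q v
        + (\<Sum>k\<in>UNIV. \<Sum>a\<in>UNIV. theta \<beta> ch k q v *
             (R_coeff ch (Inr k) (Inr i) (Inl a) q + delta k i * frame ch (Inl a) q F) * v $ a)
        - (\<Sum>a\<in>UNIV. \<Sum>b\<in>UNIV. g_coeff ch (Inl a) (Inl b) q * frame ch (Inr i) q F * v $ a * v $ b)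
        = 0))"

definition projective_geodesic_extension ::
  "(('x, real^'m) chart \<Rightarrow> 'm \<Rightarrow> 'k \<Rightarrow> 'q \<Rightarrow> real) \<Rightarrow> ('q \<Rightarrow> real) \<Rightarrow> bool" where
  "projective_geodesic_extension \<beta> F \<longleftrightarrow> condition_A \<beta> F \<and> condition_B \<beta> F"

definition D_preserving_modification :: "('q \<Rightarrow> 'q tvec \<Rightarrow> 'q tvec \<Rightarrow> real) \<Rightarrow> bool" where
  "D_preserving_modification h \<longleftrightarrow> symmetric_tensor (atlQ S) h \<and>
     (\<forall>q. \<forall>u\<in>distr S q. \<forall>w\<in>distr S q. h q u w = gmetric S q u w)"

text \<open>A family \<open>\<beta>\<close> is \<open>(V\<pi>, \<D>)\<close>-orthogonal if it consists of the mixed components of a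
  modification of the metric for which vertical vectors are orthogonal to \<open>\<D>\<close>.\<close>

definition orthogonal_components ::
  "(('x, real^'m) chart \<Rightarrow> 'm \<Rightarrow> 'k \<Rightarrow> 'q \<Rightarrow> real) \<Rightarrow> bool" where
  "orthogonal_components \<beta> \<longleftrightarrow> (\<exists>h. D_preserving_modification h \<and>
     (\<forall>c\<in>charts (atlB S). \<forall>q. proj S q \<in> fst c \<longrightarrow>
        (\<forall>a i. \<beta> c a i q = h q (frame c (Inl a) q) (frame c (Inr i) q))) \<and>
     (\<forall>q. \<forall>u\<in>vertical S q. \<forall>w\<in>distr S q. h q u w = 0))"

end

end

(*
  [V_i, X_a] = 0 because X_a is invariant under the action (this is the symmetry of mixed partial
  derivatives on G x Q), [X_a, X_b] is vertical since X_a projects to a coordinate field, and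
  V_i(G_ab) = 0, so that g(nabla_{X_a} V_i, X_b) is skew in a and b.

  If [X_a, X_b] = B^i_ab V_i, then R^i_ab = B^i_ab and R^d_ab = - K^d_i B^i_ab, hence
  G_ck R^k_ab = g_cd R^d_ab, which phi-simplicity turns into an expression in d phi; this is (A').
  In (B') the skew symmetry gives Gamma^nh(theta_i) + lambda_i = 0, and R^k_ia = K^b_i R^k_ba
  reduces what is left to the same contraction.

  Orthogonality is witnessed by the pullback of g along the horizontal projection. Brackets are
  tangent vectors because the Levi-Civita connection is torsion free, so that they are determined by
  their values on coordinate functions.
*)
theory Submission
  imports Defs
begin

section \<open>Smooth functions on normed spaces\<close>

text \<open>Everything that the passage from V_i to X_i costs is governed by one identity,
  \<open>H_K\<close>: G_ab K^b_i = - G_ai. It is orthogonality of X_i to D, and it also trades the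
  G_ai in theta for the components R^d_ab that phi-simplicity prescribes.

  With u = v^a X_a and P_a = X_a(F), the resulting contraction is g(u, V_k) R^k_ab = P_b g(u, X_a) -
  P_a g(u, X_b). In (A') it cancels the terms with F outright. In (B') the index b is contracted
  with K^b_i; one of the two terms then cancels delta^k_i X_a(F), the other cancels X_i(F) = K^b_i
  P_b, as F is constant along the fibres.

  The fields are given pointwise, by descriptions and tangent maps, so that smoothness and the basis
  property have to be earned. The equivariant trivialization supplies a local section, hence
  horizontal lifts, and a map to G that sends the generators back to the Lie algebra, so no
  dimension count enters. Smoothness of X_a and K^b_i comes from Cramer's rule.\<close>

lemma Ck_on_subset: "Ck_on k f S \<Longrightarrow> T \<subseteq> S \<Longrightarrow> Ck_on k f T"
  by (induction k arbitrary: f) (auto intro: continuous_on_subset)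

text \<open>Openness matters: \<open>frechet_derivative f (at x)\<close> sees f on a full
  neighbourhood of x, not only on \<open>S\<close>.\<close>

lemma Ck_on_cong:
  assumes "open S" "Ck_on k f S" "\<And>x. x \<in> S \<Longrightarrow> f x = g x"
  shows "Ck_on k g S"
  using assms(2,3)
proof (induction k arbitrary: f g)
  case 0
  then show ?case by (simp cong: continuous_on_cong)
next
  case (Suc k)
  have *: "g differentiable (at x) \<and> frechet_derivative g (at x) = frechet_derivative f (at x)"
    if "x \<in> S" for x
  proof -
    have "f differentiable (at x)" using Suc.prems that by simp
    then have "(f has_derivative frechet_derivative f (at x)) (at x)"
      using frechet_derivative_works by blast
    then have d: "(g has_derivative frechet_derivative f (at x)) (at x)"
      by (rule has_derivative_transform_within_open[OF _ \<open>open S\<close> that]) (use Suc.prems in auto)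
    show ?thesis using d frechet_derivative_at[OF d] differentiableI by metis
  qed
  have "Ck_on k (\<lambda>x. frechet_derivative g (at x) w) S" for w
    by (rule Suc.IH[of "\<lambda>x. frechet_derivative f (at x) w"]) (use * Suc.prems in auto)
  then show ?case using * by simp
qed

lemma Ck_on_imp_continuous: "Ck_on k f S \<Longrightarrow> continuous_on S f"
  by (cases k) (auto intro!: continuous_at_imp_continuous_on differentiable_imp_continuous_within)

lemma Ck_on_SucD: "Ck_on (Suc k) f S \<Longrightarrow> Ck_on k f S"
proof (induction k arbitrary: f)
  case 0
  then show ?case using Ck_on_imp_continuous[of "Suc 0"] by simp
next
  case (Suc k)
  have "Ck_on k (\<lambda>x. frechet_derivative f (at x) w) S" for w
    using Suc.prems Suc.IH[of "\<lambda>x. frechet_derivative f (at x) w"] by (metis Ck_on.simps(2))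
  then show ?case using Suc.prems by simp
qed

text \<open>Continuity and differentiability at x are decided near x, so covering neighbourhoods
  suffice even if they leave \<open>S\<close>. This is what lets the pointwise
  \<open>smooth_at\<close> replace \<open>smooth_on\<close>.\<close>

lemma Ck_on_local:
  assumes "\<And>x. x \<in> S \<Longrightarrow> \<exists>N. open N \<and> x \<in> N \<and> Ck_on k f N"
  shows "Ck_on k f S"
  using assms
proof (induction k arbitrary: f)
  case 0
  show ?case unfolding Ck_on.simps
  proof (rule continuous_at_imp_continuous_on, rule ballI)
    fix x assume "x \<in> S"
    then obtain N where "open N" "x \<in> N" "continuous_on N f" using 0 by (auto; blast)
    then show "isCont f x" using continuous_on_eq_continuous_at by blast
  qed
next
  case (Suc k)
  have "Ck_on k (\<lambda>x. frechet_derivative f (at x) w) S" for w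
    by (rule Suc.IH) (use Suc.prems in fastforce)
  moreover have "f differentiable (at x)" if "x \<in> S" for x
    using Suc.prems[OF that] by auto
  ultimately show ?case by simp
qed

lemma Ck_on_const: "Ck_on k (\<lambda>_. c) S"
  by (induction k arbitrary: c) auto

text \<open>Trades the derivative picked by \<open>frechet_derivative\<close> for an explicit
  candidate, so that the closure properties below become inductions over the usual differentiation
  rules.\<close>

lemma Ck_on_SucI:
  assumes "open S" "\<And>x. x \<in> S \<Longrightarrow> (f has_derivative f' x) (at x)" "\<And>w. Ck_on k (\<lambda>x. f' x w) S"
  shows "Ck_on (Suc k) f S"
proof -
  have "frechet_derivative f (at x) = f' x" if "x \<in> S" for x
    using assms(2)[OF that] frechet_derivative_at by metis
  then have "Ck_on k (\<lambda>x. frechet_derivative f (at x) w) S" for w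
    by (intro Ck_on_cong[OF \<open>open S\<close> assms(3)[of w]]) auto
  then show ?thesis using assms(2) by (auto simp: differentiable_def)
qed

lemma Ck_on_SucE:
  assumes "Ck_on (Suc k) f S"
  obtains "\<And>x. x \<in> S \<Longrightarrow> (f has_derivative frechet_derivative f (at x)) (at x)"
    and "\<And>w. Ck_on k (\<lambda>x. frechet_derivative f (at x) w) S"
  using assms frechet_derivative_works by (auto; blast)

lemma Ck_on_add:
  assumes "open S"
  shows "Ck_on k f S \<Longrightarrow> Ck_on k g S \<Longrightarrow> Ck_on k (\<lambda>x. f x + g x) S"
proof (induction k arbitrary: f g)
  case 0
  then show ?case by (auto intro: continuous_on_add)
next
  case (Suc k)
  show ?case
    apply (rule Ck_on_SucE[OF Suc.prems(1)], rule Ck_on_SucE[OF Suc.prems(2)])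
    by (rule Ck_on_SucI[OF assms has_derivative_add]) (auto intro: Suc.IH)
qed

text \<open>The derivative of the product again contains \<open>f\<close> and \<open>g\<close>, so
  the induction also uses them at order k, which \<open>Ck_on_SucD\<close> gives.\<close>

lemma (in bounded_bilinear) Ck_on:
  assumes "open S"
  shows "Ck_on k f S \<Longrightarrow> Ck_on k g S \<Longrightarrow> Ck_on k (\<lambda>x. prod (f x) (g x)) S"
proof (induction k arbitrary: f g)
  case 0
  then show ?case by (auto intro: continuous_on)
next
  case (Suc k)
  show ?case
  proof (rule Ck_on_SucE[OF Suc.prems(1)], rule Ck_on_SucE[OF Suc.prems(2)])
    assume *: "\<And>x. x \<in> S \<Longrightarrow> (f has_derivative frechet_derivative f (at x)) (at x)"
      "\<And>w. Ck_on k (\<lambda>x. frechet_derivative f (at x) w) S"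
      "\<And>x. x \<in> S \<Longrightarrow> (g has_derivative frechet_derivative g (at x)) (at x)"
      "\<And>w. Ck_on k (\<lambda>x. frechet_derivative g (at x) w) S"
    show ?thesis
      by (rule Ck_on_SucI[OF assms FDERIV])
        (use * Suc.prems[THEN Ck_on_SucD] in \<open>auto intro!: Ck_on_add[OF assms] Suc.IH\<close>)
  qed
qed

lemma (in bounded_linear) Ck_on:
  assumes "open S"
  shows "Ck_on k g S \<Longrightarrow> Ck_on k (\<lambda>x. f (g x)) S"
proof (induction k arbitrary: g)
  case 0
  then show ?case by (auto intro: continuous_on)
next
  case (Suc k)
  show ?case
    apply (rule Ck_on_SucE[OF Suc.prems])
    by (rule Ck_on_SucI[OF assms has_derivative]) (auto intro: Suc.IH)
qed

lemma Ck_on_ident: "open S \<Longrightarrow> Ck_on k (\<lambda>x. x) S"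
  by (cases k) (auto simp: Ck_on_const)

lemma Ck_on_sum:
  assumes "open S" "\<And>i. i \<in> I \<Longrightarrow> Ck_on k (f i) S"
  shows "Ck_on k (\<lambda>x. \<Sum>i\<in>I. f i x) S"
  using assms(2)
  by (induction I rule: infinite_finite_induct) (auto intro: Ck_on_const Ck_on_add[OF assms(1)])

lemma linear_eq_sum_Basis:
  fixes L :: "'a::euclidean_space \<Rightarrow> 'b::real_vector"
  assumes "linear L"
  shows "L y = (\<Sum>b\<in>Basis. (y \<bullet> b) *\<^sub>R L b)"
proof -
  have "L y = L (\<Sum>b\<in>Basis. (y \<bullet> b) *\<^sub>R b)" by (simp add: euclidean_representation)
  also have "\<dots> = (\<Sum>b\<in>Basis. (y \<bullet> b) *\<^sub>R L b)"
    by (simp add: linear_sum[OF assms] linear_cmul[OF assms])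
  finally show ?thesis .
qed

text \<open>\<open>Ck_on\<close> controls derivatives in a fixed direction, whereas the chain rule
  differentiates \<open>g\<close> in a direction that moves with x. Expanding that direction in
  \<open>Basis\<close> leaves fixed directions with scalar coefficients; this is why the middle
  space is Euclidean.\<close>

lemma Ck_on_compose:
  fixes f :: "'a::real_normed_vector \<Rightarrow> 'b::euclidean_space" and g :: "'b \<Rightarrow> 'c::real_normed_vector"
  assumes "open S"
  shows "Ck_on k f S \<Longrightarrow> Ck_on k g T \<Longrightarrow> f ` S \<subseteq> T \<Longrightarrow> Ck_on k (\<lambda>x. g (f x)) S"
proof (induction k arbitrary: g)
  case 0
  then show ?case by (auto intro: continuous_on_compose2)
next
  case (Suc k)
  show ?case
  proof (rule Ck_on_SucE[OF Suc.prems(1)], rule Ck_on_SucE[OF Suc.prems(2)])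
    assume *: "\<And>x. x \<in> S \<Longrightarrow> (f has_derivative frechet_derivative f (at x)) (at x)"
      "\<And>w. Ck_on k (\<lambda>x. frechet_derivative f (at x) w) S"
      "\<And>x. x \<in> T \<Longrightarrow> (g has_derivative frechet_derivative g (at x)) (at x)"
      "\<And>w. Ck_on k (\<lambda>x. frechet_derivative g (at x) w) T"
    have d: "((\<lambda>x. g (f x)) has_derivative
        (\<lambda>w. \<Sum>b\<in>Basis. (frechet_derivative f (at x) w \<bullet> b) *\<^sub>R frechet_derivative g (at (f x)) b)) (at x)"
      if "x \<in> S" for x
    proof -
      have gx: "(g has_derivative frechet_derivative g (at (f x))) (at (f x))"
        using *(3) that Suc.prems(3) by blast
      show ?thesis
        using diff_chain_at[OF *(1)[OF that] gx]
        unfolding o_def linear_eq_sum_Basis[OF has_derivative_linear[OF gx],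
            of "frechet_derivative f (at x) _"] .
    qed
    have fk: "Ck_on k f S" using Ck_on_SucD Suc.prems(1) by blast
    show ?thesis
      by (rule Ck_on_SucI[OF assms d])
        (auto intro!: Ck_on_sum bounded_bilinear.Ck_on[OF bounded_bilinear_scaleR] assms
          bounded_linear.Ck_on[OF bounded_linear_inner_left] * Suc.IH fk Suc.prems(3))
  qed
qed

text \<open>The derivative is again built from products of reciprocals, so the induction feeds
  itself.\<close>

lemma Ck_on_inverse: "Ck_on k (inverse :: real \<Rightarrow> real) (- {0})"
proof (induction k)
  case 0
  show ?case by (auto intro!: continuous_intros)
next
  case (Suc k)
  have d: "(inverse has_derivative (\<lambda>w. - (inverse x * w * inverse x))) (at x)" if "x \<in> - {0}"
    for x :: real using that by (auto intro!: derivative_eq_intros)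
  have "Ck_on k (\<lambda>x::real. (inverse x * inverse x) * (- w)) (- {0})" for w
    by (intro bounded_bilinear.Ck_on[OF bounded_bilinear_mult] Ck_on_const Suc) auto
  then have "Ck_on k (\<lambda>x::real. - (inverse x * w * inverse x)) (- {0})" for w
    by (rule Ck_on_cong[rotated]) auto
  then show ?case by (intro Ck_on_SucI[OF _ d]) auto
qed

text \<open>One neighbourhood serves for all orders. With smoothness attached to a point, later
  arguments work with germs and \<open>eventually\<close> instead of tracking open sets.\<close>

definition smooth_at :: "('a::real_normed_vector \<Rightarrow> 'b::real_normed_vector) \<Rightarrow> 'a \<Rightarrow> bool" where
  "smooth_at f x \<longleftrightarrow> (\<exists>N. open N \<and> x \<in> N \<and> smooth_on N f)"

lemma smooth_on_subset: "smooth_on S f \<Longrightarrow> T \<subseteq> S \<Longrightarrow> smooth_on T f"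
  unfolding smooth_on_def using Ck_on_subset by blast

lemma smooth_on_iff_smooth_at: "open S \<Longrightarrow> smooth_on S f \<longleftrightarrow> (\<forall>x\<in>S. smooth_at f x)"
proof
  assume "\<forall>x\<in>S. smooth_at f x"
  then show "smooth_on S f"
    unfolding smooth_on_def smooth_at_def by (intro allI Ck_on_local) blast
qed (auto simp: smooth_at_def)

lemma smooth_atI: "smooth_on S f \<Longrightarrow> open S \<Longrightarrow> x \<in> S \<Longrightarrow> smooth_at f x"
  unfolding smooth_at_def by blast

lemma smooth_at_cong_ev:
  assumes "smooth_at f x" "eventually (\<lambda>y. f y = g y) (nhds x)"
  shows "smooth_at g x"
proof -
  obtain N where N: "open N" "x \<in> N" "smooth_on N f" using assms(1) smooth_at_def by blast
  obtain M where M: "open M" "x \<in> M" "\<And>y. y \<in> M \<Longrightarrow> f y = g y"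
    using assms(2) unfolding eventually_nhds by blast
  have "smooth_on (N \<inter> M) f" using N(3) smooth_on_subset by blast
  then have "smooth_on (N \<inter> M) g"
    unfolding smooth_on_def by (meson Ck_on_cong IntD2 M N open_Int)
  then show ?thesis using N M smooth_atI[of "N \<inter> M"] by blast
qed

lemma smooth_at_eventually: "smooth_at f x \<Longrightarrow> eventually (\<lambda>y. smooth_at f y) (nhds x)"
  unfolding smooth_at_def[of f x] eventually_nhds by (metis smooth_atI)

lemma smooth_on_derivative:
  assumes "smooth_on S f"
  shows "x \<in> S \<Longrightarrow> (f has_derivative frechet_derivative f (at x)) (at x)"
    and "smooth_on S (\<lambda>x. frechet_derivative f (at x) w)"
proof -
  have k: "Ck_on (Suc k) f S" for k using assms unfolding smooth_on_def by blast
  show "smooth_on S (\<lambda>x. frechet_derivative f (at x) w)"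
    unfolding smooth_on_def using k by simp
  show "x \<in> S \<Longrightarrow> (f has_derivative frechet_derivative f (at x)) (at x)"
    using k[of 0] frechet_derivative_works by auto
qed

lemma smooth_at_has_derivative:
  "smooth_at f x \<Longrightarrow> (f has_derivative frechet_derivative f (at x)) (at x)"
  unfolding smooth_at_def using smooth_on_derivative(1) by blast

lemma smooth_at_isCont: "smooth_at f x \<Longrightarrow> isCont f x"
  using smooth_at_has_derivative has_derivative_continuous by blast

lemma smooth_at_frechet:
  "smooth_at f x \<Longrightarrow> smooth_at (\<lambda>y. frechet_derivative f (at y) w) x"
  unfolding smooth_at_def using smooth_on_derivative(2) by blast

lemma smooth_at_const [simp]: "smooth_at (\<lambda>_. c) x"
  unfolding smooth_at_def smooth_on_def using Ck_on_const by blast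

lemma smooth_at_ident [simp]: "smooth_at (\<lambda>x. x) x"
  unfolding smooth_at_def smooth_on_def using Ck_on_ident by blast

lemma smooth_at_binary:
  assumes "\<And>S k. open S \<Longrightarrow> Ck_on k f S \<Longrightarrow> Ck_on k g S \<Longrightarrow> Ck_on k h S"
    and "smooth_at f x" "smooth_at g x"
  shows "smooth_at h x"
proof -
  obtain N M where "open N" "x \<in> N" "smooth_on N f" "open M" "x \<in> M" "smooth_on M g"
    using assms unfolding smooth_at_def by blast
  then show ?thesis
    unfolding smooth_at_def smooth_on_def
    by (intro exI[of _ "N \<inter> M"]) (auto intro!: assms(1) intro: Ck_on_subset)
qed

lemma smooth_at_add: "smooth_at f x \<Longrightarrow> smooth_at g x \<Longrightarrow> smooth_at (\<lambda>y. f y + g y) x"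
  by (rule smooth_at_binary[of f g]) (auto intro: Ck_on_add)

lemma (in bounded_bilinear) smooth_at:
  "smooth_at f x \<Longrightarrow> smooth_at g x \<Longrightarrow> smooth_at (\<lambda>y. prod (f y) (g y)) x"
  by (rule smooth_at_binary[of f g]) (auto intro: Ck_on)

lemmas smooth_at_mult = bounded_bilinear.smooth_at[OF bounded_bilinear_mult]

lemma (in bounded_linear) smooth_at: "smooth_at g x \<Longrightarrow> smooth_at (\<lambda>y. f (g y)) x"
  by (rule smooth_at_binary[of g g]) (auto intro: Ck_on)

lemma smooth_at_sum:
  "(\<And>i. i \<in> I \<Longrightarrow> smooth_at (f i) x) \<Longrightarrow> smooth_at (\<lambda>y. \<Sum>i\<in>I. f i y) x"
  by (induction I rule: infinite_finite_induct) (simp_all add: smooth_at_add)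

lemma smooth_at_compose:
  fixes f :: "'a::real_normed_vector \<Rightarrow> 'b::euclidean_space" and g :: "'b \<Rightarrow> 'c::real_normed_vector"
  assumes "smooth_at f x" "smooth_at g (f x)"
  shows "smooth_at (\<lambda>x. g (f x)) x"
proof -
  obtain N M where *: "open N" "x \<in> N" "smooth_on N f" "open M" "f x \<in> M" "smooth_on M g"
    using assms unfolding smooth_at_def by blast
  define P where "P = N \<inter> f -` M"
  have "continuous_on N f"
    using *(3) Ck_on_imp_continuous unfolding smooth_on_def by blast
  then have "open P" unfolding P_def using * by (simp add: continuous_open_preimage)
  moreover have "smooth_on P f" using *(3) smooth_on_subset P_def by blast
  ultimately show ?thesis
    using * Ck_on_compose[OF \<open>open P\<close>, of _ f g M]
    by (intro smooth_atI[of P]) (auto simp: P_def smooth_on_def)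
qed

lemma smooth_at_inverse:
  fixes f :: "'a::real_normed_vector \<Rightarrow> real"
  assumes "smooth_at f x" "f x \<noteq> 0"
  shows "smooth_at (\<lambda>x. inverse (f x)) x"
proof -
  have "smooth_at (inverse :: real \<Rightarrow> real) (f x)"
    by (rule smooth_atI[of "- {0}"]) (use assms Ck_on_inverse in \<open>auto simp: smooth_on_def\<close>)
  then show ?thesis using smooth_at_compose[OF assms(1)] by blast
qed

lemma smooth_at_Pair:
  assumes "smooth_at f x" "smooth_at g x"
  shows "smooth_at (\<lambda>y. (f y, g y)) x"
proof -
  have "smooth_at (\<lambda>y. (f y, 0) + (0, g y)) x"
    by (intro smooth_at_add bounded_linear.smooth_at[OF _ assms(1)] bounded_linear.smooth_at[OF _ assms(2)]
      bounded_linear_Pair bounded_linear_ident bounded_linear_zero)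
  then show ?thesis by simp
qed

lemma smooth_at_euclidean_iff:
  fixes f :: "'a::real_normed_vector \<Rightarrow> 'b::euclidean_space"
  shows "smooth_at f x \<longleftrightarrow> (\<forall>b\<in>Basis. smooth_at (\<lambda>y. f y \<bullet> b) x)"
proof
  assume "\<forall>b\<in>Basis. smooth_at (\<lambda>y. f y \<bullet> b) x"
  then have "smooth_at (\<lambda>y. \<Sum>b\<in>Basis. (f y \<bullet> b) *\<^sub>R b) x"
    by (auto intro!: smooth_at_sum bounded_bilinear.smooth_at[OF bounded_bilinear_scaleR])
  then show "smooth_at f x" by (simp add: euclidean_representation)
qed (auto intro: bounded_linear.smooth_at[OF bounded_linear_inner_left])

lemma frechet_derivative_cong_ev:
  assumes "f differentiable (at x)" "eventually (\<lambda>y. f y = g y) (nhds x)"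
  shows "frechet_derivative f (at x) = frechet_derivative g (at x)"
  using assms frechet_derivative_transform_within_open unfolding eventually_nhds by metis

lemma frechet_derivative_chain:
  fixes f :: "'a::real_normed_vector \<Rightarrow> 'b::euclidean_space" and g :: "'b \<Rightarrow> 'c::real_normed_vector"
  assumes "smooth_at f x" "smooth_at g (f x)"
  shows "frechet_derivative (\<lambda>x. g (f x)) (at x) w =
    frechet_derivative g (at (f x)) (frechet_derivative f (at x) w)"
  using frechet_derivative_at[OF diff_chain_at[OF smooth_at_has_derivative[OF assms(1)]
    smooth_at_has_derivative[OF assms(2)]]] by (simp add: o_def fun_eq_iff)

text \<open>Two applications of the mean value theorem: in s to the difference f(x + s u + h w) -
  f(x + s u), and in t to the directional derivative \<open>p\<close> along u. Smoothness is assumed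
  on the whole parallelogram containing these segments.\<close>

lemma second_difference_mean_value:
  fixes f :: "'a::real_normed_vector \<Rightarrow> real"
  assumes h: "h > 0"
    and f: "\<And>s t. 0 \<le> s \<Longrightarrow> s \<le> h \<Longrightarrow> 0 \<le> t \<Longrightarrow> t \<le> h \<Longrightarrow> smooth_at f (x + s *\<^sub>R u + t *\<^sub>R w)"
  obtains s t where "0 \<le> s" "s \<le> h" "0 \<le> t" "t \<le> h"
    "f (x + h *\<^sub>R u + h *\<^sub>R w) - f (x + h *\<^sub>R u) - f (x + h *\<^sub>R w) + f x =
      h * h * frechet_derivative (\<lambda>y. frechet_derivative f (at y) u) (at (x + s *\<^sub>R u + t *\<^sub>R w)) w"
proof -
  define p where "p = (\<lambda>y. frechet_derivative f (at y) u)"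
  have lin: "linear (frechet_derivative f (at y))" if "smooth_at f y" for y
    using smooth_at_has_derivative[OF that] has_derivative_linear by blast
  have d1: "((\<lambda>s. f (x + s *\<^sub>R u + t *\<^sub>R w)) has_derivative (\<lambda>r. r * p (x + s *\<^sub>R u + t *\<^sub>R w))) (at s)"
    if "0 \<le> s" "s \<le> h" "0 \<le> t" "t \<le> h" for s t
  proof -
    have "((\<lambda>s. x + s *\<^sub>R u + t *\<^sub>R w) has_derivative (\<lambda>r. r *\<^sub>R u)) (at s)"
      by (auto intro!: derivative_eq_intros)
    from diff_chain_at[OF this smooth_at_has_derivative[OF f[OF that]]]
    show ?thesis using linear_cmul[OF lin[OF f[OF that]]] by (simp add: o_def p_def)
  qed
  have d2: "((\<lambda>t. p (x + s *\<^sub>R u + t *\<^sub>R w)) has_derivative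
      (\<lambda>r. r * frechet_derivative p (at (x + s *\<^sub>R u + t *\<^sub>R w)) w)) (at t)"
    if "0 \<le> s" "s \<le> h" "0 \<le> t" "t \<le> h" for s t
  proof -
    have *: "(p has_derivative frechet_derivative p (at (x + s *\<^sub>R u + t *\<^sub>R w))) (at (x + s *\<^sub>R u + t *\<^sub>R w))"
      unfolding p_def using smooth_at_has_derivative[OF smooth_at_frechet[OF f[OF that]]] .
    have "((\<lambda>t. x + s *\<^sub>R u + t *\<^sub>R w) has_derivative (\<lambda>r. r *\<^sub>R w)) (at t)"
      by (auto intro!: derivative_eq_intros)
    from diff_chain_at[OF this *] show ?thesis
      using linear_cmul[OF has_derivative_linear[OF *]] by (simp add: o_def)
  qed
  have "\<exists>s\<in>{0<..<h}. (f (x + h *\<^sub>R u + h *\<^sub>R w) - f (x + h *\<^sub>R u + 0 *\<^sub>R w)) -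
      (f (x + 0 *\<^sub>R u + h *\<^sub>R w) - f (x + 0 *\<^sub>R u + 0 *\<^sub>R w)) =
      (h - 0) * p (x + s *\<^sub>R u + h *\<^sub>R w) - (h - 0) * p (x + s *\<^sub>R u + 0 *\<^sub>R w)"
    by (rule mvt_simple[OF h]) (auto intro!: has_derivative_diff
        has_derivative_at_withinI[OF d1] simp: h less_imp_le simp del: scaleR_zero_left add_0_right)
  then obtain s where s: "0 < s" "s < h"
    "f (x + h *\<^sub>R u + h *\<^sub>R w) - f (x + h *\<^sub>R u) - f (x + h *\<^sub>R w) + f x =
      h * (p (x + s *\<^sub>R u + h *\<^sub>R w) - p (x + s *\<^sub>R u))"
    by (auto simp: algebra_simps)
  have "\<exists>t\<in>{0<..<h}. p (x + s *\<^sub>R u + h *\<^sub>R w) - p (x + s *\<^sub>R u + 0 *\<^sub>R w) =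
      (h - 0) * frechet_derivative p (at (x + s *\<^sub>R u + t *\<^sub>R w)) w"
    by (rule mvt_simple[OF h]) (use s in \<open>auto intro!: has_derivative_at_withinI[OF d2]\<close>)
  then obtain t where "0 < t" "t < h"
    "p (x + s *\<^sub>R u + h *\<^sub>R w) - p (x + s *\<^sub>R u) =
      h * frechet_derivative p (at (x + s *\<^sub>R u + t *\<^sub>R w)) w" by auto
  then show ?thesis using that[of s t] s by (simp add: p_def)
qed

text \<open>The second difference is symmetric in u and w, so the two mixed derivatives take a
  common value at points arbitrarily close to x; by continuity they cannot differ at x.\<close>

lemma second_derivative_symmetric:
  fixes f :: "'a::real_normed_vector \<Rightarrow> real"
  assumes "smooth_at f x"
  shows "frechet_derivative (\<lambda>y. frechet_derivative f (at y) u) (at x) w =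
    frechet_derivative (\<lambda>y. frechet_derivative f (at y) w) (at x) u" (is "?P x = ?Q x")
proof (rule ccontr)
  assume ne: "?P x \<noteq> ?Q x"
  \<comment> \<open>Half the gap: two numbers strictly within \<open>e\<close> of the two values at
    x cannot coincide.\<close>
  define e where "e = \<bar>?P x - ?Q x\<bar> / 2"
  have "e > 0" using ne e_def by simp
  have ev: "eventually (\<lambda>y. dist (F y) (F x) < e) (nhds x)" if "smooth_at F x" for F :: "'a \<Rightarrow> real"
    using smooth_at_isCont[OF that] \<open>e > 0\<close> tendstoD
    unfolding isCont_def tendsto_at_iff_tendsto_nhds by blast
  have "eventually (\<lambda>y. dist (?P y) (?P x) < e) (nhds x)" "eventually (\<lambda>y. dist (?Q y) (?Q x) < e) (nhds x)"
    by (rule ev, rule smooth_at_frechet[OF smooth_at_frechet[OF assms]])+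
  with smooth_at_eventually[OF assms] have
    "eventually (\<lambda>y. smooth_at f y \<and> dist (?P y) (?P x) < e \<and> dist (?Q y) (?Q x) < e) (nhds x)"
    by eventually_elim auto
  then obtain r where r: "r > 0" "\<And>y. dist y x < r \<Longrightarrow> smooth_at f y \<and> dist (?P y) (?P x) < e \<and> dist (?Q y) (?Q x) < e"
    unfolding eventually_nhds_metric by blast
  \<comment> \<open>Makes h (norm u + norm w) at most r / 2; the summand 1 keeps the denominator
    positive when u = w = 0.\<close>
  define h where "h = r / 2 / (norm u + norm w + 1)"
  have n: "norm u + norm w + 1 > 0" by (smt (verit) norm_ge_zero)
  have h: "h > 0" using r n by (simp add: h_def)
  have near: "dist (x + s *\<^sub>R u + t *\<^sub>R w) x < r" if "0 \<le> s" "s \<le> h" "0 \<le> t" "t \<le> h" for s t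
  proof -
    have "dist (x + s *\<^sub>R u + t *\<^sub>R w) x = norm (s *\<^sub>R u + t *\<^sub>R w)" by (simp add: dist_norm)
    also have "\<dots> \<le> s * norm u + t * norm w" using that by (metis abs_of_nonneg norm_scaleR norm_triangle_ineq)
    also have "\<dots> \<le> h * norm u + h * norm w" using that by (intro add_mono mult_right_mono) auto
    also have "\<dots> \<le> h * (norm u + norm w + 1)" using h by (simp add: algebra_simps)
    also have "\<dots> = r / 2"
      unfolding h_def by (rule nonzero_eq_divide_eq[THEN iffD1, OF _ refl]) (use n in linarith)
    also have "\<dots> < r" using r by simp
    finally show ?thesis .
  qed
  obtain s t where st: "0 \<le> s" "s \<le> h" "0 \<le> t" "t \<le> h"
    "f (x + h *\<^sub>R u + h *\<^sub>R w) - f (x + h *\<^sub>R u) - f (x + h *\<^sub>R w) + f x = h * h * ?P (x + s *\<^sub>R u + t *\<^sub>R w)"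
    using second_difference_mean_value[OF h, of f x u w] r(2) near by metis
  have sm: "smooth_at f (x + s *\<^sub>R w + t *\<^sub>R u)" if "0 \<le> s" "s \<le> h" "0 \<le> t" "t \<le> h" for s t
    using r(2) near[OF that(3,4,1,2)] by (simp add: add.commute add.left_commute)
  obtain s' t' where st': "0 \<le> s'" "s' \<le> h" "0 \<le> t'" "t' \<le> h"
    "f (x + h *\<^sub>R w + h *\<^sub>R u) - f (x + h *\<^sub>R w) - f (x + h *\<^sub>R u) + f x = h * h * ?Q (x + s' *\<^sub>R w + t' *\<^sub>R u)"
    using second_difference_mean_value[OF h, of f x w u] sm by metis
  have sw: "x + s' *\<^sub>R w + t' *\<^sub>R u = x + t' *\<^sub>R u + s' *\<^sub>R w" "x + h *\<^sub>R w + h *\<^sub>R u = x + h *\<^sub>R u + h *\<^sub>R w"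
    by simp_all
  have "h * h * ?P (x + s *\<^sub>R u + t *\<^sub>R w) = h * h * ?Q (x + t' *\<^sub>R u + s' *\<^sub>R w)"
    using st(5) st'(5) unfolding sw by linarith
  then have "?P (x + s *\<^sub>R u + t *\<^sub>R w) = ?Q (x + t' *\<^sub>R u + s' *\<^sub>R w)" using h by simp
  moreover have "dist (?P (x + s *\<^sub>R u + t *\<^sub>R w)) (?P x) < e" using r(2) near st by blast
  moreover have "dist (?Q (x + t' *\<^sub>R u + s' *\<^sub>R w)) (?Q x) < e" using r(2) near st' by blast
  ultimately show False unfolding e_def dist_real_def by (smt (verit) field_sum_of_halves)
qed

section \<open>Tangent vectors and smooth maps\<close>

lemma chart_open_image:
  assumes "is_chart c" "open N"
  shows "open (snd c ` (fst c \<inter> N))"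
proof -
  have "openin (top_of_set (snd c ` fst c)) (snd c ` (fst c \<inter> N))"
    using assms homeomorphism_imp_open_map openin_open_Int unfolding is_chart_def by metis
  then show ?thesis using assms openin_open_trans unfolding is_chart_def by blast
qed

lemma chart_open_preimage:
  assumes "is_chart c" "open N"
  shows "open (fst c \<inter> snd c -` N)"
  using assms continuous_open_preimage[of "fst c" "snd c" N]
  unfolding is_chart_def homeomorphism_def by blast

lemma chart_inv_left [simp]: "is_chart c \<Longrightarrow> p \<in> fst c \<Longrightarrow> chart_inv c (snd c p) = p"
  unfolding is_chart_def homeomorphism_def by blast

lemma chart_eventually:
  assumes "is_chart c" "p \<in> fst c" "eventually P (nhds p)"
  shows "eventually (\<lambda>y. P (chart_inv c y)) (nhds (snd c p))"
proof -
  obtain N where "open N" "p \<in> N" "\<forall>x\<in>N. P x" using assms(3) unfolding eventually_nhds by blast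
  then show ?thesis unfolding eventually_nhds using assms chart_open_image[of c N]
    by (intro exI[of _ "snd c ` (fst c \<inter> N)"]) auto
qed

lemma chart_eventually_inv:
  assumes "is_chart c" "p \<in> fst c"
  shows "eventually (\<lambda>y. chart_inv c y \<in> fst c \<and> snd c (chart_inv c y) = y) (nhds (snd c p))"
  unfolding eventually_nhds using assms chart_open_image[of c UNIV]
  by (intro exI[of _ "snd c ` fst c"]) auto

lemma chart_eventually_domain:
  "is_chart c \<Longrightarrow> p \<in> fst c \<Longrightarrow> eventually (\<lambda>x. x \<in> fst c) (nhds p)"
  unfolding is_chart_def by (simp add: eventually_nhds_in_open)

section \<open>Germs and tangent vectors on one manifold\<close>

locale smooth_mfd =
  fixes A :: "('p::{t2_space, second_countable_topology}, 'e::euclidean_space) chart set"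
  assumes mfd: "smooth_manifold A"
begin

lemma charts_is_chart: "c \<in> charts A \<Longrightarrow> is_chart c"
  by (simp add: charts_def)

lemma atlas_charts: "c \<in> A \<Longrightarrow> c \<in> charts A"
  using mfd by (auto simp: smooth_manifold_def charts_def)

lemma atlas_cover: obtains c where "c \<in> A" "p \<in> fst c"
proof -
  have "p \<in> (\<Union>c\<in>A. fst c)" using mfd by (simp add: smooth_manifold_def)
  then show thesis using that by blast
qed

lemma chart_cover: obtains c where "c \<in> charts A" "p \<in> fst c"
  using atlas_cover atlas_charts by metis

text \<open>Charts of the maximal atlas are compatible with those of \<open>A\<close> by definition,
  but not visibly with each other. The transition is factored through a chart \<open>e\<close> of
  \<open>A\<close> around q.\<close>

lemma smooth_at_transition:
  assumes c: "c \<in> charts A" and d: "d \<in> charts A" and q: "q \<in> fst c" "q \<in> fst d"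
  shows "smooth_at (\<lambda>y. snd d (chart_inv c y)) (snd c q)"
proof -
  obtain e where e: "e \<in> A" "q \<in> fst e" using atlas_cover .
  note ch = charts_is_chart[OF c] charts_is_chart[OF d] charts_is_chart[OF atlas_charts[OF e(1)]]
  have "smooth_on (snd c ` (fst c \<inter> fst e)) (snd e \<circ> chart_inv c)"
    using c e unfolding charts_def compatible_def by blast
  then have 1: "smooth_at (\<lambda>y. snd e (chart_inv c y)) (snd c q)"
    using smooth_atI[OF _ chart_open_image[OF ch(1)]] q e ch unfolding is_chart_def o_def by blast
  have "smooth_on (snd e ` (fst d \<inter> fst e)) (snd d \<circ> chart_inv e)"
    using d e unfolding charts_def compatible_def by blast
  then have 2: "smooth_at (\<lambda>y. snd d (chart_inv e y)) (snd e q)"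
    using smooth_atI[OF _ chart_open_image[OF ch(3)]] q e ch unfolding is_chart_def o_def
    by (metis (no_types, lifting) IntI imageI inf_commute)
  have "smooth_at (\<lambda>y. snd d (chart_inv e (snd e (chart_inv c y)))) (snd c q)"
    by (rule smooth_at_compose[OF 1]) (use 2 q ch in simp)
  then show ?thesis
    by (rule smooth_at_cong_ev)
      (use chart_eventually[OF ch(1) q(1) chart_eventually_domain[OF ch(3) e(2)]] ch
        in \<open>auto elim!: eventually_mono\<close>)
qed

text \<open>Transitions are smooth, so one chart of the maximal atlas decides what
  \<open>smooth_fun\<close> tests in all charts of \<open>A\<close>. Later statements about germs
  are read in one convenient chart.\<close>

lemma smooth_near_iff:
  assumes c: "c \<in> charts A" and q: "q \<in> fst c"
  shows "smooth_near A f q \<longleftrightarrow> smooth_at (\<lambda>y. f (chart_inv c y)) (snd c q)"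
proof
  note ch = charts_is_chart[OF c]
  {
    assume "smooth_near A f q"
    then obtain W where W: "open W" "q \<in> W" "smooth_fun A W f" unfolding smooth_near_def by blast
    obtain e where e: "e \<in> A" "q \<in> fst e" using atlas_cover .
    note ch' = charts_is_chart[OF atlas_charts[OF e(1)]]
    have "smooth_on (snd e ` (fst e \<inter> W)) (f \<circ> chart_inv e)"
      using W e unfolding smooth_fun_def by blast
    then have "smooth_at (\<lambda>y. f (chart_inv e y)) (snd e q)"
      using smooth_atI[OF _ chart_open_image[OF ch' W(1)]] W e unfolding o_def by blast
    then have "smooth_at (\<lambda>y. f (chart_inv e (snd e (chart_inv c y)))) (snd c q)"
      using smooth_at_compose[OF smooth_at_transition[OF c atlas_charts[OF e(1)] q e(2)],
          of "\<lambda>y. f (chart_inv e y)"] ch q by simp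
    then show "smooth_at (\<lambda>y. f (chart_inv c y)) (snd c q)"
      by (rule smooth_at_cong_ev)
        (use chart_eventually[OF ch q chart_eventually_domain[OF ch' e(2)]] ch'
          in \<open>auto elim!: eventually_mono\<close>)
  }
  assume "smooth_at (\<lambda>y. f (chart_inv c y)) (snd c q)"
  then obtain N where N: "open N" "snd c q \<in> N" "\<And>y. y \<in> N \<Longrightarrow> smooth_at (\<lambda>y. f (chart_inv c y)) y"
    unfolding smooth_at_def[of _ "snd c q"] by (metis smooth_atI)
  define W where "W = fst c \<inter> snd c -` N"
  have W: "open W" unfolding W_def by (rule chart_open_preimage[OF ch N(1)])
  have "smooth_on (snd e ` (fst e \<inter> W)) (f \<circ> chart_inv e)" if e: "e \<in> A" for e
  proof -
    note ch' = charts_is_chart[OF atlas_charts[OF e]]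
    have "smooth_at (f \<circ> chart_inv e) (snd e p)" if p: "p \<in> fst e" "p \<in> W" for p
    proof -
      have pc: "p \<in> fst c" "snd c p \<in> N" using p W_def by auto
      have "smooth_at (\<lambda>y. f (chart_inv c (snd c (chart_inv e y)))) (snd e p)"
        using smooth_at_compose[OF smooth_at_transition[OF atlas_charts[OF e] c p(1) pc(1)],
          of "\<lambda>y. f (chart_inv c y)"] N(3) pc ch' p by simp
      then show ?thesis
        by (rule smooth_at_cong_ev)
          (use chart_eventually[OF ch' p(1) chart_eventually_domain[OF ch pc(1)]] ch
            in \<open>auto elim!: eventually_mono\<close>)
    qed
    then show ?thesis using smooth_on_iff_smooth_at[OF chart_open_image[OF ch' W]] by blast
  qed
  then have "smooth_fun A W f" unfolding smooth_fun_def by blast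
  then show "smooth_near A f q" using W q N W_def unfolding smooth_near_def by blast
qed

lemma smooth_fun_iff:
  assumes "open W"
  shows "smooth_fun A W f \<longleftrightarrow> (\<forall>q\<in>W. smooth_near A f q)"
proof
  assume "smooth_fun A W f"
  then show "\<forall>q\<in>W. smooth_near A f q" using assms unfolding smooth_near_def by blast
next
  assume *: "\<forall>q\<in>W. smooth_near A f q"
  have "smooth_on (snd e ` (fst e \<inter> W)) (f \<circ> chart_inv e)" if e: "e \<in> A" for e
    using smooth_on_iff_smooth_at[OF chart_open_image[OF charts_is_chart[OF atlas_charts[OF e]] assms]]
      smooth_near_iff[OF atlas_charts[OF e]] * by (auto simp: o_def)
  then show "smooth_fun A W f" unfolding smooth_fun_def by blast
qed

lemma smooth_near_eventually: "smooth_near A f q \<Longrightarrow> eventually (smooth_near A f) (nhds q)"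
  unfolding smooth_near_def[of A f q] eventually_nhds using smooth_fun_iff by blast

lemma smooth_near_cong_ev:
  assumes "smooth_near A f q" "eventually (\<lambda>p. f p = g p) (nhds q)"
  shows "smooth_near A g q"
proof -
  obtain c where c: "c \<in> A" "q \<in> fst c" using atlas_cover .
  note c' = atlas_charts[OF c(1)]
  show ?thesis
    using smooth_at_cong_ev[OF iffD1[OF smooth_near_iff[OF c' c(2)] assms(1)]
        chart_eventually[OF charts_is_chart[OF c'] c(2) assms(2)]]
    unfolding smooth_near_iff[OF c' c(2)] .
qed

lemma smooth_near_compose:
  fixes f :: "'p \<Rightarrow> 'f::euclidean_space"
  assumes "\<And>b. b \<in> Basis \<Longrightarrow> smooth_near A (\<lambda>p. f p \<bullet> b) q" "smooth_at F (f q)"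
  shows "smooth_near A (\<lambda>p. F (f p)) q"
proof -
  obtain c where c: "c \<in> A" "q \<in> fst c" using atlas_cover .
  note c' = atlas_charts[OF c(1)]
  have "smooth_at (\<lambda>y. f (chart_inv c y)) (snd c q)"
    using assms(1) unfolding smooth_near_iff[OF c' c(2)] smooth_at_euclidean_iff[of "\<lambda>y. f (chart_inv c y)"]
    by blast
  then show ?thesis
    using smooth_at_compose[of "\<lambda>y. f (chart_inv c y)" "snd c q" F] assms(2)
      charts_is_chart[OF c'] c
    unfolding smooth_near_iff[OF c' c(2)] by simp
qed

lemma smooth_near_const [simp]: "smooth_near A (\<lambda>_. k) q"
  by (rule chart_cover[of q]) (simp add: smooth_near_iff)

lemma smooth_near_add: "smooth_near A f q \<Longrightarrow> smooth_near A g q \<Longrightarrow> smooth_near A (\<lambda>p. f p + g p) q"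
  by (rule chart_cover[of q]) (simp add: smooth_near_iff smooth_at_add)

lemma smooth_near_mult: "smooth_near A f q \<Longrightarrow> smooth_near A g q \<Longrightarrow> smooth_near A (\<lambda>p. f p * g p) q"
  by (rule chart_cover[of q]) (simp add: smooth_near_iff smooth_at_mult)

lemma smooth_near_minus: "smooth_near A f q \<Longrightarrow> smooth_near A (\<lambda>p. - f p) q"
  using smooth_near_mult[of "\<lambda>_. -1" q f] by simp

lemma smooth_near_sum:
  "(\<And>i. i \<in> I \<Longrightarrow> smooth_near A (f i) q) \<Longrightarrow> smooth_near A (\<lambda>p. \<Sum>i\<in>I. f i p) q"
  by (induction I rule: infinite_finite_induct) (simp_all add: smooth_near_add)

lemma smooth_near_prod:
  "(\<And>i. i \<in> I \<Longrightarrow> smooth_near A (f i) q) \<Longrightarrow> smooth_near A (\<lambda>p. \<Prod>i\<in>I. f i p) q"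
  by (induction I rule: infinite_finite_induct) (simp_all add: smooth_near_mult)

lemma smooth_near_inverse:
  assumes "smooth_near A f q" "f q \<noteq> 0"
  shows "smooth_near A (\<lambda>p. inverse (f p)) q"
  by (rule smooth_near_compose[of f]) (use assms smooth_at_inverse[of "\<lambda>x. x"] in auto)

lemma smooth_near_coord:
  assumes c: "c \<in> charts A" and q: "q \<in> fst c"
  shows "smooth_near A (\<lambda>p. snd c p \<bullet> b) q"
proof -
  have "smooth_at (\<lambda>y. y \<bullet> b) (snd c q)"
    by (rule bounded_linear.smooth_at[OF bounded_linear_inner_left smooth_at_ident])
  then show ?thesis
    unfolding smooth_near_iff[OF assms]
    by (rule smooth_at_cong_ev)
      (use chart_eventually_inv[OF charts_is_chart[OF c] q] in \<open>auto elim!: eventually_mono\<close>)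
qed

lemma smooth_near_isCont:
  assumes "smooth_near A f q"
  shows "isCont f q"
proof -
  obtain c where c: "c \<in> A" "q \<in> fst c" using atlas_cover .
  note ch = charts_is_chart[OF atlas_charts[OF c(1)]]
  have "isCont (\<lambda>y. f (chart_inv c y)) (snd c q)"
    using assms smooth_near_iff[OF atlas_charts[OF c(1)] c(2)] smooth_at_isCont by blast
  moreover have "isCont (snd c) q"
    using ch c continuous_on_eq_continuous_at unfolding is_chart_def homeomorphism_def by blast
  ultimately have "isCont (\<lambda>p. f (chart_inv c (snd c p))) q" using isCont_o2 by blast
  moreover have "eventually (\<lambda>p. f (chart_inv c (snd c p)) = f p) (nhds q)"
    using chart_eventually_domain[OF ch c(2)] by eventually_elim (use ch in simp)
  ultimately show ?thesis using isCont_cong[of "\<lambda>p. f (chart_inv c (snd c p))" f q] by simp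
qed

lemma dirderiv_eq:
  "smooth_near A f q \<Longrightarrow> dirderiv A c q w f = frechet_derivative (\<lambda>y. f (chart_inv c y)) (at (snd c q)) w"
  by (simp add: dirderiv_def o_def)

lemma dirderiv_in_tspace: "c \<in> charts A \<Longrightarrow> q \<in> fst c \<Longrightarrow> dirderiv A c q w \<in> tspace A q"
  unfolding tspace_def by blast

lemma dirderiv_coord:
  assumes c: "c \<in> charts A" and q: "q \<in> fst c"
  shows "dirderiv A c q w (\<lambda>p. snd c p \<bullet> b) = w \<bullet> b"
proof -
  have "((\<lambda>y. y \<bullet> b) has_derivative (\<lambda>y. y \<bullet> b)) (at (snd c q))"
    by (rule bounded_linear_imp_has_derivative[OF bounded_linear_inner_left])
  then have d: "(\<lambda>y. y \<bullet> b) differentiable (at (snd c q))"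
    "frechet_derivative (\<lambda>y. y \<bullet> b) (at (snd c q)) = (\<lambda>y. y \<bullet> b)"
    using frechet_derivative_at differentiableI by metis+
  have "frechet_derivative (\<lambda>y. snd c (chart_inv c y) \<bullet> b) (at (snd c q)) = (\<lambda>y. y \<bullet> b)"
    by (rule trans[OF frechet_derivative_cong_ev[OF d(1), symmetric] d(2)])
      (use chart_eventually_inv[OF charts_is_chart[OF c] q] in \<open>auto elim!: eventually_mono\<close>)
  then show ?thesis by (simp add: dirderiv_eq[OF smooth_near_coord[OF assms]])
qed

lemma tvec_not_smooth: "u \<in> tspace A q \<Longrightarrow> \<not> smooth_near A f q \<Longrightarrow> u f = 0"
  unfolding tspace_def dirderiv_def by auto

text \<open>Smoothness at q passes from f to g, and where it fails both values are 0 by the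
  convention in \<open>dirderiv\<close>. Tangent vectors thus act on germs, with no smoothness to
  check.\<close>

lemma tvec_cong_ev:
  assumes "u \<in> tspace A q" "eventually (\<lambda>p. f p = g p) (nhds q)"
  shows "u f = u g"
proof (cases "smooth_near A f q")
  case True
  then have g: "smooth_near A g q" using smooth_near_cong_ev assms(2) by blast
  obtain c w where c: "c \<in> charts A" "q \<in> fst c" "u = dirderiv A c q w"
    using assms unfolding tspace_def by blast
  have d: "(\<lambda>y. f (chart_inv c y)) differentiable (at (snd c q))"
    using True smooth_near_iff[OF c(1,2)] smooth_at_has_derivative differentiableI by blast
  show ?thesis
    unfolding c(3) dirderiv_eq[OF True] dirderiv_eq[OF g]
    using frechet_derivative_cong_ev[OF d chart_eventually[OF charts_is_chart[OF c(1)] c(2) assms(2)]]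
    by simp
next
  case False
  have "eventually (\<lambda>p. g p = f p) (nhds q)" using assms(2) by (simp add: eq_commute)
  then have "\<not> smooth_near A g q" using smooth_near_cong_ev False by blast
  then show ?thesis using tvec_not_smooth[OF assms(1)] False by simp
qed

text \<open>In a chart, u differentiates along one direction, and f moves along the vector whose
  components are u applied to the components of f. Taking a chart for \<open>f\<close> yields the
  coordinate form of u.\<close>

lemma tvec_chain:
  fixes f :: "'p \<Rightarrow> 'f::euclidean_space" and F :: "'f \<Rightarrow> real"
  assumes u: "u \<in> tspace A q"
    and f: "\<And>b. b \<in> Basis \<Longrightarrow> smooth_near A (\<lambda>p. f p \<bullet> b) q" and F: "smooth_at F (f q)"
  shows "u (\<lambda>p. F (f p)) = frechet_derivative F (at (f q)) (\<Sum>b\<in>Basis. u (\<lambda>p. f p \<bullet> b) *\<^sub>R b)"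
proof -
  obtain c w where c: "c \<in> charts A" "q \<in> fst c" "u = dirderiv A c q w"
    using u unfolding tspace_def by blast
  define f' where "f' = frechet_derivative (\<lambda>y. f (chart_inv c y)) (at (snd c q))"
  have s: "smooth_at (\<lambda>y. f (chart_inv c y)) (snd c q)"
    using f unfolding smooth_near_iff[OF c(1,2)] smooth_at_euclidean_iff[of "\<lambda>y. f (chart_inv c y)"]
    by blast
  have d: "((\<lambda>y. f (chart_inv c y) \<bullet> b) has_derivative (\<lambda>w. f' w \<bullet> b)) (at (snd c q))" for b
    using has_derivative_inner_left[OF smooth_at_has_derivative[OF s]] unfolding f'_def .
  have "u (\<lambda>p. f p \<bullet> b) = f' w \<bullet> b" if "b \<in> Basis" for b
    unfolding c(3) dirderiv_eq[OF f[OF that]] frechet_derivative_at[OF d, symmetric] ..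
  then have "(\<Sum>b\<in>Basis. u (\<lambda>p. f p \<bullet> b) *\<^sub>R b) = f' w"
    by (simp add: euclidean_representation)
  moreover have "smooth_near A (\<lambda>p. F (f p)) q"
    using smooth_near_compose[of f q F] f F by blast
  then have "u (\<lambda>p. F (f p)) = frechet_derivative F (at (f q)) (f' w)"
    unfolding c(3) f'_def
    using dirderiv_eq[of "\<lambda>p. F (f p)" q c w]
    using frechet_derivative_chain[OF s, of F w] F charts_is_chart[OF c(1)] c(2) by simp
  ultimately show ?thesis by simp
qed

text \<open>Near q every f is a function of the coordinates of \<open>c\<close>, so the chain rule
  expresses u f through the values of u on them. The chart need not be the one that produced u;
  hence vectors can be compared in a common chart.\<close>

lemma tvec_chart:
  assumes u: "u \<in> tspace A q" and c: "c \<in> charts A" "q \<in> fst c"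
  shows "u = dirderiv A c q (\<Sum>b\<in>Basis. u (\<lambda>p. snd c p \<bullet> b) *\<^sub>R b)"
proof
  fix f
  show "u f = dirderiv A c q (\<Sum>b\<in>Basis. u (\<lambda>p. snd c p \<bullet> b) *\<^sub>R b) f"
  proof (cases "smooth_near A f q")
    case True
    have "u f = u (\<lambda>p. f (chart_inv c (snd c p)))"
      by (rule tvec_cong_ev[OF u])
        (use chart_eventually_domain[OF charts_is_chart[OF c(1)] c(2)] charts_is_chart[OF c(1)]
          in \<open>auto elim!: eventually_mono\<close>)
    also have "\<dots> = frechet_derivative (\<lambda>y. f (chart_inv c y)) (at (snd c q))
        (\<Sum>b\<in>Basis. u (\<lambda>p. snd c p \<bullet> b) *\<^sub>R b)"
      by (rule tvec_chain[OF u smooth_near_coord[OF c]]) (use True smooth_near_iff[OF c] in blast)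
    finally show ?thesis using dirderiv_eq[OF True] by simp
  next
    case False
    then show ?thesis using tvec_not_smooth u dirderiv_in_tspace[OF c] by metis
  qed
qed

lemma tvec_eqI:
  assumes "u \<in> tspace A q" "v \<in> tspace A q" "c \<in> charts A" "q \<in> fst c"
    and "\<And>b. b \<in> Basis \<Longrightarrow> u (\<lambda>p. snd c p \<bullet> b) = v (\<lambda>p. snd c p \<bullet> b)"
  shows "u = v"
proof -
  have "(\<Sum>b\<in>Basis. u (\<lambda>p. snd c p \<bullet> b) *\<^sub>R b) = (\<Sum>b\<in>Basis. v (\<lambda>p. snd c p \<bullet> b) *\<^sub>R b)"
    using assms(5) by (intro sum.cong) auto
  then show ?thesis using tvec_chart[OF assms(1,3,4)] tvec_chart[OF assms(2,3,4)] by simp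
qed

lemma tvec_add:
  assumes u: "u \<in> tspace A q" and f: "smooth_near A f q" "smooth_near A g q"
  shows "u (\<lambda>p. f p + g p) = u f + u g"
proof -
  obtain c w where c: "c \<in> charts A" "q \<in> fst c" "u = dirderiv A c q w"
    using u unfolding tspace_def by blast
  show ?thesis
    unfolding c(3) dirderiv_eq[OF f(1)] dirderiv_eq[OF f(2)] dirderiv_eq[OF smooth_near_add[OF f]]
    using frechet_derivative_at[OF has_derivative_add[OF
          smooth_at_has_derivative[OF iffD1[OF smooth_near_iff[OF c(1,2)] f(1)]]
          smooth_at_has_derivative[OF iffD1[OF smooth_near_iff[OF c(1,2)] f(2)]]], symmetric]
    by simp
qed

lemma tvec_mult:
  assumes u: "u \<in> tspace A q" and f: "smooth_near A f q" "smooth_near A g q"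
  shows "u (\<lambda>p. f p * g p) = f q * u g + u f * g q"
proof -
  obtain c w where c: "c \<in> charts A" "q \<in> fst c" "u = dirderiv A c q w"
    using u unfolding tspace_def by blast
  show ?thesis
    unfolding c(3) dirderiv_eq[OF f(1)] dirderiv_eq[OF f(2)] dirderiv_eq[OF smooth_near_mult[OF f]]
    using frechet_derivative_at[OF has_derivative_mult[OF
          smooth_at_has_derivative[OF iffD1[OF smooth_near_iff[OF c(1,2)] f(1)]]
          smooth_at_has_derivative[OF iffD1[OF smooth_near_iff[OF c(1,2)] f(2)]]], symmetric]
      charts_is_chart[OF c(1)] c(2)
    by simp
qed

lemma tvec_const:
  assumes "u \<in> tspace A q"
  shows "u (\<lambda>_. k) = 0"
  using tvec_chain[OF assms, of "\<lambda>_. 0::real" "\<lambda>_. k"] by simp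

lemma tvec_sum:
  assumes "u \<in> tspace A q"
  shows "(\<And>i. i \<in> I \<Longrightarrow> smooth_near A (f i) q) \<Longrightarrow> u (\<lambda>p. \<Sum>i\<in>I. f i p) = (\<Sum>i\<in>I. u (f i))"
  by (induction I rule: infinite_finite_induct) (simp_all add: tvec_const[OF assms] tvec_add[OF assms] smooth_near_sum)

lemma tvec_minus:
  assumes "u \<in> tspace A q" "smooth_near A f q"
  shows "u (\<lambda>p. - f p) = - u f"
  using tvec_mult[OF assms(1), of "\<lambda>_. -1" f] assms by (simp add: tvec_const[OF assms(1)])

text \<open>The two vectors may come from different charts; once both are rewritten in one chart,
  combining them means combining their directions.\<close>

lemma tspace_combination:
  assumes "u \<in> tspace A q" "v \<in> tspace A q"
  shows "(\<lambda>f. s * u f + t * v f) \<in> tspace A q"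
proof -
  obtain c where "c \<in> A" "q \<in> fst c" using atlas_cover .
  then have c: "c \<in> charts A" "q \<in> fst c" using atlas_charts by auto
  define x y where "x = (\<Sum>b\<in>Basis. u (\<lambda>p. snd c p \<bullet> b) *\<^sub>R b)"
    and "y = (\<Sum>b\<in>Basis. v (\<lambda>p. snd c p \<bullet> b) *\<^sub>R b)"
  have uv: "u = dirderiv A c q x" "v = dirderiv A c q y"
    unfolding x_def y_def using tvec_chart assms c by blast+
  have "s * u f + t * v f = dirderiv A c q (s *\<^sub>R x + t *\<^sub>R y) f" for f
  proof (cases "smooth_near A f q")
    case True
    have "linear (frechet_derivative (\<lambda>y. f (chart_inv c y)) (at (snd c q)))"
      using True smooth_near_iff[OF c] smooth_at_has_derivative has_derivative_linear by blast
    then show ?thesis by (simp add: uv dirderiv_eq[OF True] linear_add linear_cmul)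
  next
    case False
    then show ?thesis using uv by (simp add: dirderiv_def)
  qed
  then show ?thesis using dirderiv_in_tspace[OF c] by (simp add: fun_eq_iff)
qed

lemma tspace_zero: "(\<lambda>_. 0) \<in> tspace A q"
proof -
  obtain c where "c \<in> A" "q \<in> fst c" using atlas_cover .
  then have "dirderiv A c q 0 \<in> tspace A q" using dirderiv_in_tspace atlas_charts by blast
  from tspace_combination[OF this this, of 0 0] show ?thesis by simp
qed

lemma tspace_add: "u \<in> tspace A q \<Longrightarrow> v \<in> tspace A q \<Longrightarrow> (\<lambda>f. u f + v f) \<in> tspace A q"
  using tspace_combination[of u q v 1 1] by simp

lemma tspace_diff: "u \<in> tspace A q \<Longrightarrow> v \<in> tspace A q \<Longrightarrow> (\<lambda>f. u f - v f) \<in> tspace A q"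
  using tspace_combination[of u q v 1 "-1"] by simp

lemma tspace_scale: "u \<in> tspace A q \<Longrightarrow> (\<lambda>f. s * u f) \<in> tspace A q"
  using tspace_combination[of u q u s 0] by simp

lemma tspace_sum: "(\<And>i. i \<in> I \<Longrightarrow> e i \<in> tspace A q) \<Longrightarrow> (\<lambda>f. \<Sum>i\<in>I. r i * e i f) \<in> tspace A q"
  by (induction I rule: infinite_finite_induct) (simp_all add: tspace_zero tspace_add tspace_scale)

lemma tspace_lincomb: "(\<And>i. e i \<in> tspace A q) \<Longrightarrow> lincomb e r \<in> tspace A q"
  unfolding lincomb_def by (rule tspace_sum)

lemma vector_fieldI:
  assumes "\<And>q. q \<in> U \<Longrightarrow> X q \<in> tspace A q"
    and "\<And>q f. q \<in> U \<Longrightarrow> smooth_near A f q \<Longrightarrow> smooth_near A (\<lambda>p. X p f) q"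
  shows "vector_field A U X"
  unfolding vector_field_def
proof (intro conjI ballI allI impI)
  fix W f assume "open W \<and> W \<subseteq> U \<and> smooth_fun A W f"
  then have W: "open W" "W \<subseteq> U" "\<forall>q\<in>W. smooth_near A f q" using smooth_fun_iff by blast+
  have "smooth_near A (\<lambda>p. X p f) q" if "q \<in> W" for q
    by (rule assms(2)) (use that W in auto)
  then show "smooth_fun A W (\<lambda>q. X q f)" using smooth_fun_iff[OF W(1)] by blast
qed (rule assms(1))

lemma vector_field_smooth_near:
  assumes "vector_field A U X" "open U" "q \<in> U" "smooth_near A f q"
  shows "smooth_near A (\<lambda>p. X p f) q"
proof -
  obtain W where W: "open W" "q \<in> W" "smooth_fun A W f" using assms(4) unfolding smooth_near_def by blast
  have "smooth_fun A (W \<inter> U) f" using W assms(2) smooth_fun_iff by (metis IntD1 open_Int)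
  then have "smooth_fun A (W \<inter> U) (\<lambda>p. X p f)"
    using assms(1,2) W unfolding vector_field_def by blast
  then show ?thesis using W assms(2,3) smooth_near_def by blast
qed

end

lemma vector_field_tspace: "vector_field A U X \<Longrightarrow> q \<in> U \<Longrightarrow> X q \<in> tspace A q"
  unfolding vector_field_def by blast

text \<open>Formulated by pullback of smooth germs, so that maps compose without charts of the
  codomain. Continuity is what keeps f p inside a given chart for p near q.\<close>

definition smooth_map_at ::
  "('p::t2_space, 'e::euclidean_space) chart set \<Rightarrow>
   ('r::topological_space, 'f::euclidean_space) chart set \<Rightarrow> ('p \<Rightarrow> 'r) \<Rightarrow> 'p \<Rightarrow> bool" where
  "smooth_map_at A B f q \<longleftrightarrow> isCont f q \<and>
     (\<forall>h. smooth_near B h (f q) \<longrightarrow> smooth_near A (\<lambda>p. h (f p)) q)"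

lemma smooth_map_atD:
  "smooth_map_at A B f q \<Longrightarrow> smooth_near B h (f q) \<Longrightarrow> smooth_near A (\<lambda>p. h (f p)) q"
  unfolding smooth_map_at_def by blast

lemma smooth_map_on_imp_at:
  fixes A :: "('p::{t2_space, second_countable_topology}, 'e::euclidean_space) chart set"
    and B :: "('r::{t2_space, second_countable_topology}, 'f::euclidean_space) chart set"
  assumes "smooth_mfd A" "smooth_mfd B" "smooth_map_on A B W f" "open W" "q \<in> W"
  shows "smooth_map_at A B f q"
proof -
  interpret A: smooth_mfd A by fact
  interpret B: smooth_mfd B by fact
  have cont: "isCont f q"
    using assms(3-5) continuous_on_eq_continuous_at unfolding smooth_map_on_def by blast
  have "smooth_near A (\<lambda>p. h (f p)) q" if h: "smooth_near B h (f q)" for h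
  proof -
    obtain c where c: "c \<in> A" "q \<in> fst c" using A.atlas_cover .
    obtain d where d: "d \<in> B" "f q \<in> fst d" using B.atlas_cover .
    note c' = A.atlas_charts[OF c(1)] and d' = B.atlas_charts[OF d(1)]
    note chc = A.charts_is_chart[OF c'] and chd = B.charts_is_chart[OF d']
    have o: "open (W \<inter> f -` fst d)"
      using assms(3,4) chd continuous_open_preimage unfolding smooth_map_on_def is_chart_def by blast
    have "smooth_on (snd c ` (fst c \<inter> (W \<inter> f -` fst d))) (snd d \<circ> f \<circ> chart_inv c)"
      using assms(3) c d unfolding smooth_map_on_def Int_assoc by blast
    moreover have "snd c q \<in> snd c ` (fst c \<inter> (W \<inter> f -` fst d))" using c d assms(5) by blast
    ultimately have s: "smooth_at (\<lambda>y. snd d (f (chart_inv c y))) (snd c q)"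
      using smooth_atI chart_open_image[OF chc o] unfolding o_def by blast
    have "smooth_at (\<lambda>y. h (chart_inv d y)) (snd d (f q))"
      using h B.smooth_near_iff[OF d' d(2)] by blast
    then have "smooth_at (\<lambda>y. h (chart_inv d (snd d (f (chart_inv c y))))) (snd c q)"
      using smooth_at_compose[OF s, of "\<lambda>y. h (chart_inv d y)"] chc c(2) by simp
    moreover have "eventually (\<lambda>y. h (chart_inv d (snd d (f (chart_inv c y)))) = h (f (chart_inv c y)))
        (nhds (snd c q))"
      by (rule eventually_mono[OF chart_eventually[OF chc c(2) eventually_nhds_in_open[OF o]]])
        (use assms(5) d chd in auto)
    ultimately have "smooth_at (\<lambda>y. h (f (chart_inv c y))) (snd c q)"
      by (rule smooth_at_cong_ev)
    then show ?thesis using A.smooth_near_iff[OF c' c(2)] by blast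
  qed
  then show ?thesis using cont unfolding smooth_map_at_def by blast
qed

lemma tangent_map_apply: "smooth_near B h (f q) \<Longrightarrow> tangent_map B f q u h = u (\<lambda>p. h (f p))"
  by (simp add: tangent_map_def o_def)

text \<open>A member of \<open>tspace\<close> must be exhibited as a directional derivative. The
  chain rule supplies the direction \<open>w\<close>: its components are u applied to the
  coordinates of f.\<close>

lemma tangent_map_in_tspace:
  fixes A :: "('p::{t2_space, second_countable_topology}, 'e::euclidean_space) chart set"
    and B :: "('r::{t2_space, second_countable_topology}, 'f::euclidean_space) chart set"
  assumes "smooth_mfd A" "smooth_mfd B" "smooth_map_at A B f q" "u \<in> tspace A q"
  shows "tangent_map B f q u \<in> tspace B (f q)"
proof -
  interpret A: smooth_mfd A by fact
  interpret B: smooth_mfd B by fact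
  obtain d where d: "d \<in> B" "f q \<in> fst d" using B.atlas_cover .
  note d' = B.atlas_charts[OF d(1)]
  note chd = B.charts_is_chart[OF d']
  define w where "w = (\<Sum>b\<in>Basis. u (\<lambda>p. snd d (f p) \<bullet> b) *\<^sub>R b)"
  have "tangent_map B f q u h = dirderiv B d (f q) w h" for h
  proof (cases "smooth_near B h (f q)")
    case True
    have "filterlim f (nhds (f q)) (nhds q)"
      using assms(3) unfolding smooth_map_at_def isCont_def tendsto_at_iff_tendsto_nhds by blast
    then have dom: "eventually (\<lambda>p. f p \<in> fst d) (nhds q)"
      using chart_eventually_domain[OF chd d(2)] unfolding filterlim_iff by blast
    have "u (\<lambda>p. h (f p)) = u (\<lambda>p. h (chart_inv d (snd d (f p))))"
      by (rule A.tvec_cong_ev[OF assms(4)]) (use dom chd in \<open>auto elim!: eventually_mono\<close>)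
    also have "\<dots> = frechet_derivative (\<lambda>y. h (chart_inv d y)) (at (snd d (f q))) w"
      unfolding w_def
      by (rule A.tvec_chain[OF assms(4)])
        (use smooth_map_atD[OF assms(3) B.smooth_near_coord[OF d' d(2)]] True B.smooth_near_iff[OF d' d(2)]
          in auto)
    finally show ?thesis using True by (simp add: tangent_map_apply B.dirderiv_eq)
  qed (simp add: tangent_map_def dirderiv_def)
  then have "tangent_map B f q u = dirderiv B d (f q) w" by blast
  then show ?thesis using B.dirderiv_in_tspace[OF d' d(2)] by simp
qed

text \<open>Maps on a product are read in pairs of coordinates, so the product needs no tangent
  spaces of its own. \<open>prod_atlas\<close> pairs atlas charts; arbitrary charts c and d are
  reached by a transition map in each factor.\<close>

lemma smooth_map_on_prod_imp_at:
  fixes A :: "('p::{t2_space, second_countable_topology}, 'e::euclidean_space) chart set"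
    and B :: "('r::{t2_space, second_countable_topology}, 'f::euclidean_space) chart set"
    and C :: "('s::{t2_space, second_countable_topology}, 'h::euclidean_space) chart set"
  assumes "smooth_mfd A" "smooth_mfd B" "smooth_mfd C"
    and f: "smooth_map_on (prod_atlas A B) C W f" "open W" "(p, r) \<in> W"
    and c: "c \<in> charts A" "p \<in> fst c" and d: "d \<in> charts B" "r \<in> fst d"
    and h: "smooth_near C h (f (p, r))"
  shows "smooth_at (\<lambda>y. h (f (chart_inv c (fst y), chart_inv d (snd y)))) (snd c p, snd d r)"
proof -
  interpret A: smooth_mfd A by fact
  interpret B: smooth_mfd B by fact
  interpret C: smooth_mfd C by fact
  obtain c0 where c0: "c0 \<in> A" "p \<in> fst c0" using A.atlas_cover .
  obtain d0 where d0: "d0 \<in> B" "r \<in> fst d0" using B.atlas_cover .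
  obtain e where e: "e \<in> C" "f (p, r) \<in> fst e" using C.atlas_cover .
  note ch = A.charts_is_chart[OF c(1)] B.charts_is_chart[OF d(1)] A.charts_is_chart[OF A.atlas_charts[OF c0(1)]]
    B.charts_is_chart[OF B.atlas_charts[OF d0(1)]] C.charts_is_chart[OF C.atlas_charts[OF e(1)]]
  have "open (W \<inter> f -` fst e)"
    using f ch(5) continuous_open_preimage unfolding smooth_map_on_def is_chart_def by blast
  moreover have "(p, r) \<in> W \<inter> f -` fst e" using f(3) e(2) by simp
  ultimately obtain U1 U2 where U: "open U1" "open U2" "p \<in> U1" "r \<in> U2" "U1 \<times> U2 \<subseteq> W \<inter> f -` fst e"
    by (rule open_prod_elim) blast
  define k where "k = (fst c0 \<times> fst d0, map_prod (snd c0) (snd d0))"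
  have k: "k \<in> prod_atlas A B" using c0 d0 unfolding k_def prod_atlas_def by blast
  \<comment> \<open>\<open>chart_inv\<close> is \<open>inv_into\<close> on the product domain, so it
    splits into the two factors only through injectivity.\<close>
  have kinv: "chart_inv k (snd c0 x, snd d0 y) = (x, y)" if "x \<in> fst c0" "y \<in> fst d0" for x y
  proof -
    have "inj_on (snd c0) (fst c0)" "inj_on (snd d0) (fst d0)"
      using ch chart_inv_left by (metis inj_on_inverseI)+
    then have "inj_on (snd k) (fst k)"
      unfolding k_def by (simp add: map_prod_inj_on)
    then show ?thesis
      using inv_into_f_f[of "snd k" "fst k" "(x, y)"] that unfolding chart_inv_def k_def by simp
  qed
  define N where "N = snd c0 ` (fst c0 \<inter> U1) \<times> snd d0 ` (fst d0 \<inter> U2)"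
  have N: "open N" unfolding N_def by (intro open_Times chart_open_image ch U)
  have "smooth_on (snd k ` (fst k \<inter> W \<inter> f -` fst e)) (snd e \<circ> f \<circ> chart_inv k)"
    using f(1) k e unfolding smooth_map_on_def by blast
  moreover have "N \<subseteq> snd k ` (fst k \<inter> W \<inter> f -` fst e)"
  proof
    fix z assume "z \<in> N"
    then obtain x y where "z = snd k (x, y)" "x \<in> fst c0" "x \<in> U1" "y \<in> fst d0" "y \<in> U2"
      unfolding N_def k_def by auto
    then show "z \<in> snd k ` (fst k \<inter> W \<inter> f -` fst e)" using U(5) unfolding k_def by auto
  qed
  ultimately have "smooth_on N (snd e \<circ> f \<circ> chart_inv k)" using smooth_on_subset by blast
  then have s: "smooth_at (snd e \<circ> f \<circ> chart_inv k) (snd c0 p, snd d0 r)"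
    using smooth_atI[OF _ N] U c0 d0 unfolding N_def by blast
  have "smooth_at (\<lambda>y. h (chart_inv e y)) (snd e (f (p, r)))"
    using h C.smooth_near_iff[OF C.atlas_charts[OF e(1)] e(2)] by blast
  then have s2: "smooth_at (\<lambda>z. h (chart_inv e ((snd e \<circ> f \<circ> chart_inv k) z))) (snd c0 p, snd d0 r)"
    using smooth_at_compose[OF s, of "\<lambda>y. h (chart_inv e y)"] kinv c0 d0 by simp
  have t: "smooth_at (\<lambda>y. (snd c0 (chart_inv c (fst y)), snd d0 (chart_inv d (snd y)))) (snd c p, snd d r)"
    by (intro smooth_at_Pair smooth_at_compose[of fst _ "\<lambda>y. snd c0 (chart_inv c y)"]
        smooth_at_compose[of snd _ "\<lambda>y. snd d0 (chart_inv d y)"]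
        bounded_linear.smooth_at[OF bounded_linear_fst smooth_at_ident]
        bounded_linear.smooth_at[OF bounded_linear_snd smooth_at_ident])
      (use A.smooth_at_transition[OF c(1) A.atlas_charts[OF c0(1)]] B.smooth_at_transition[OF d(1) B.atlas_charts[OF d0(1)]]
        c d c0 d0 in auto)
  have "smooth_at (\<lambda>y. h (chart_inv e ((snd e \<circ> f \<circ> chart_inv k)
      (snd c0 (chart_inv c (fst y)), snd d0 (chart_inv d (snd y)))))) (snd c p, snd d r)"
    using smooth_at_compose[OF t, of "\<lambda>z. h (chart_inv e ((snd e \<circ> f \<circ> chart_inv k) z))"] s2 ch c d by simp
  then show ?thesis
  proof (rule smooth_at_cong_ev)
    define M where "M = snd c ` (fst c \<inter> (fst c0 \<inter> U1)) \<times> snd d ` (fst d \<inter> (fst d0 \<inter> U2))"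
    have "open M" unfolding M_def
      by (intro open_Times chart_open_image ch open_Int U) (use ch in \<open>auto simp: is_chart_def\<close>)
    moreover have "(snd c p, snd d r) \<in> M" using c d c0 d0 U unfolding M_def by blast
    moreover have "h (chart_inv e ((snd e \<circ> f \<circ> chart_inv k)
      (snd c0 (chart_inv c (fst y)), snd d0 (chart_inv d (snd y))))) =
      h (f (chart_inv c (fst y), chart_inv d (snd y)))" if y: "y \<in> M" for y
    proof -
      obtain x z where xz: "fst y = snd c x" "snd y = snd d z" "x \<in> fst c" "x \<in> fst c0" "x \<in> U1"
        "z \<in> fst d" "z \<in> fst d0" "z \<in> U2" using y unfolding M_def mem_Times_iff by blast
      then have "f (x, z) \<in> fst e" using U(5) by blast
      then show ?thesis using xz ch kinv by simp
    qed
    ultimately show "eventually (\<lambda>y. h (chart_inv e ((snd e \<circ> f \<circ> chart_inv k)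
      (snd c0 (chart_inv c (fst y)), snd d0 (chart_inv d (snd y))))) =
      h (f (chart_inv c (fst y), chart_inv d (snd y)))) (nhds (snd c p, snd d r))"
      unfolding eventually_nhds by blast
  qed
qed

section \<open>Maps on products of manifolds\<close>

lemma frechet_derivative_partial:
  fixes F :: "'a::euclidean_space \<times> 'b::euclidean_space \<Rightarrow> 'c::real_normed_vector"
  assumes "smooth_at F (x, y)"
  shows "smooth_at (\<lambda>x. F (x, y)) x" "smooth_at (\<lambda>y. F (x, y)) y"
    and "frechet_derivative (\<lambda>x. F (x, y)) (at x) w = frechet_derivative F (at (x, y)) (w, 0)"
    and "frechet_derivative (\<lambda>y. F (x, y)) (at y) z = frechet_derivative F (at (x, y)) (0, z)"
proof -
  have s: "smooth_at (\<lambda>x. (x, y)) x" "smooth_at (\<lambda>y. (x, y)) y"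
    by (intro smooth_at_Pair smooth_at_ident smooth_at_const)+
  have d: "((\<lambda>x. (x, y)) has_derivative (\<lambda>w. (w, 0))) (at x)"
    "((\<lambda>y. (x, y)) has_derivative (\<lambda>w. (0, w))) (at y)"
    by (auto intro!: derivative_eq_intros)
  note d' = frechet_derivative_at[OF d(1), symmetric] frechet_derivative_at[OF d(2), symmetric]
  show "smooth_at (\<lambda>x. F (x, y)) x" "smooth_at (\<lambda>y. F (x, y)) y"
    using smooth_at_compose[OF s(1) assms] smooth_at_compose[OF s(2) assms] by simp_all
  show "frechet_derivative (\<lambda>x. F (x, y)) (at x) w = frechet_derivative F (at (x, y)) (w, 0)"
    using frechet_derivative_chain[OF s(1) assms] d' by simp
  show "frechet_derivative (\<lambda>y. F (x, y)) (at y) z = frechet_derivative F (at (x, y)) (0, z)"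
    using frechet_derivative_chain[OF s(2) assms] d' by simp
qed

lemma smooth_map_at_filterlim: "smooth_map_at A B f q \<Longrightarrow> filterlim f (nhds (f q)) (nhds q)"
  unfolding smooth_map_at_def isCont_def tendsto_at_iff_tendsto_nhds by blast

locale three_mfds = A: smooth_mfd A + B: smooth_mfd B + C: smooth_mfd C
  for A :: "('p::{t2_space, second_countable_topology}, 'e::euclidean_space) chart set"
    and B :: "('r::{t2_space, second_countable_topology}, 'f::euclidean_space) chart set"
    and C :: "('s::{t2_space, second_countable_topology}, 'h::euclidean_space) chart set"
begin

context
  fixes f :: "'p \<times> 'r \<Rightarrow> 's" and W p r
  assumes f: "smooth_map_on (prod_atlas A B) C W f" "open W" "(p, r) \<in> W"
begin

lemmas smooth_at_charts = smooth_map_on_prod_imp_at[OF A.smooth_mfd_axioms B.smooth_mfd_axioms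
    C.smooth_mfd_axioms f]

lemma smooth_map_at_slices:
  shows "smooth_map_at A C (\<lambda>p. f (p, r)) p" "smooth_map_at B C (\<lambda>r. f (p, r)) r"
proof -
  obtain c where c: "c \<in> charts A" "p \<in> fst c" using A.chart_cover .
  obtain d where d: "d \<in> charts B" "r \<in> fst d" using B.chart_cover .
  note inv = chart_inv_left[OF A.charts_is_chart[OF c(1)] c(2)]
    chart_inv_left[OF B.charts_is_chart[OF d(1)] d(2)]
  have cont: "isCont f (p, r)"
    using f continuous_on_eq_continuous_at unfolding smooth_map_on_def by blast
  have "isCont (\<lambda>p. f (p, r)) p" "isCont (\<lambda>r. f (p, r)) r"
    by (rule isCont_o2[of _ "\<lambda>x. (x, r)" f, simplified], simp_all add: cont)
      (rule isCont_o2[of _ "\<lambda>x. (p, x)" f, simplified], simp_all add: cont)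
  moreover have "smooth_near A (\<lambda>p. h (f (p, r))) p" "smooth_near B (\<lambda>r. h (f (p, r))) r"
    if h: "smooth_near C h (f (p, r))" for h
    using frechet_derivative_partial(1,2)[OF smooth_at_charts[OF c d h]] inv
    by (simp_all add: A.smooth_near_iff[OF c] B.smooth_near_iff[OF d])
  ultimately show "smooth_map_at A C (\<lambda>p. f (p, r)) p" "smooth_map_at B C (\<lambda>r. f (p, r)) r"
    unfolding smooth_map_at_def by blast+
qed

text \<open>The vectors u and v differentiate in different factors. In coordinates these are the
  directions (w, 0) and (0, z) of one function \<open>F\<close>, so the exchange is symmetry of its
  second derivative.\<close>

lemma partial_derivatives:
  assumes u: "u \<in> tspace A p" and v: "v \<in> tspace B r" and h: "smooth_near C h (f (p, r))"
  shows "smooth_near B (\<lambda>r. u (\<lambda>p. h (f (p, r)))) r"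
    and "u (\<lambda>p. v (\<lambda>r. h (f (p, r)))) = v (\<lambda>r. u (\<lambda>p. h (f (p, r))))"
proof -
  obtain c w where c: "c \<in> charts A" "p \<in> fst c" and w: "u = dirderiv A c p w"
    using u unfolding tspace_def by blast
  obtain d z where d: "d \<in> charts B" "r \<in> fst d" and z: "v = dirderiv B d r z"
    using v unfolding tspace_def by blast
  note inv = chart_inv_left[OF A.charts_is_chart[OF c(1)] c(2)]
    chart_inv_left[OF B.charts_is_chart[OF d(1)] d(2)]
  define F where "F = (\<lambda>y. h (f (chart_inv c (fst y), chart_inv d (snd y))))"
  define a b where "a = snd c p" and "b = snd d r"
  have F: "smooth_at F (a, b)"
    unfolding F_def a_def b_def by (rule smooth_at_charts[OF c d h])
  have t: "filterlim (\<lambda>y. (a, y)) (nhds (a, b)) (nhds b)" "filterlim (\<lambda>x. (x, b)) (nhds (a, b)) (nhds a)"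
    unfolding nhds_prod by (intro filterlim_Pair filterlim_ident tendsto_const)+
  have u_eq: "u (\<lambda>p. h (f (p, chart_inv d y))) = frechet_derivative F (at (a, y)) (w, 0)"
    if "smooth_at F (a, y)" for y
  proof -
    have "smooth_near A (\<lambda>p. h (f (p, chart_inv d y))) p"
      using frechet_derivative_partial(1)[OF that] by (simp add: A.smooth_near_iff[OF c] F_def a_def)
    then show ?thesis
      using frechet_derivative_partial(3)[OF that, of w] by (simp add: w A.dirderiv_eq F_def a_def)
  qed
  have v_eq: "v (\<lambda>r. h (f (chart_inv c x, r))) = frechet_derivative F (at (x, b)) (0, z)"
    if "smooth_at F (x, b)" for x
  proof -
    have "smooth_near B (\<lambda>r. h (f (chart_inv c x, r))) r"
      using frechet_derivative_partial(2)[OF that] by (simp add: B.smooth_near_iff[OF d] F_def b_def)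
    then show ?thesis
      using frechet_derivative_partial(4)[OF that, of z] by (simp add: z B.dirderiv_eq F_def b_def)
  qed
  \<comment> \<open>\<open>F\<close> is known to be smooth only near (a, b), so the formula for the
    inner derivative holds only near b; its germ is enough for the outer one.\<close>
  have evu: "eventually (\<lambda>y. frechet_derivative F (at (a, y)) (w, 0) = u (\<lambda>p. h (f (p, chart_inv d y)))) (nhds b)"
    using eventually_compose_filterlim[OF smooth_at_eventually[OF F] t(1)]
    by eventually_elim (simp add: u_eq)
  have evv: "eventually (\<lambda>x. frechet_derivative F (at (x, b)) (0, z) = v (\<lambda>r. h (f (chart_inv c x, r)))) (nhds a)"
    using eventually_compose_filterlim[OF smooth_at_eventually[OF F] t(2)]
    by eventually_elim (simp add: v_eq)
  have D1: "smooth_at (\<lambda>y. frechet_derivative F (at (a, y)) (w, 0)) b"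
    "frechet_derivative (\<lambda>y. frechet_derivative F (at (a, y)) (w, 0)) (at b) z =
     frechet_derivative (\<lambda>y. frechet_derivative F (at y) (w, 0)) (at (a, b)) (0, z)"
    using frechet_derivative_partial(2,4)[OF smooth_at_frechet[OF F]] by blast+
  have D2: "smooth_at (\<lambda>x. frechet_derivative F (at (x, b)) (0, z)) a"
    "frechet_derivative (\<lambda>x. frechet_derivative F (at (x, b)) (0, z)) (at a) w =
     frechet_derivative (\<lambda>y. frechet_derivative F (at y) (0, z)) (at (a, b)) (w, 0)"
    using frechet_derivative_partial(1,3)[OF smooth_at_frechet[OF F]] by blast+
  have s1: "smooth_at (\<lambda>y. u (\<lambda>p. h (f (p, chart_inv d y)))) b"
    by (rule smooth_at_cong_ev[OF D1(1) evu])
  have s2: "smooth_at (\<lambda>x. v (\<lambda>r. h (f (chart_inv c x, r)))) a"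
    by (rule smooth_at_cong_ev[OF D2(1) evv])
  show n1: "smooth_near B (\<lambda>r. u (\<lambda>p. h (f (p, r)))) r"
    using s1 by (simp add: B.smooth_near_iff[OF d] b_def)
  have n2: "smooth_near A (\<lambda>p. v (\<lambda>r. h (f (p, r)))) p"
    using s2 by (simp add: A.smooth_near_iff[OF c] a_def)
  have "v (\<lambda>r. u (\<lambda>p. h (f (p, r)))) = frechet_derivative (\<lambda>y. u (\<lambda>p. h (f (p, chart_inv d y)))) (at b) z"
    unfolding z B.dirderiv_eq[OF n1[unfolded z]] b_def ..
  also have "\<dots> = frechet_derivative (\<lambda>y. frechet_derivative F (at (a, y)) (w, 0)) (at b) z"
    using frechet_derivative_cong_ev[OF _ evu] smooth_at_has_derivative[OF D1(1)] differentiableI by metis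
  also have "\<dots> = frechet_derivative (\<lambda>x. frechet_derivative F (at (x, b)) (0, z)) (at a) w"
    using D1(2) D2(2) second_derivative_symmetric[OF F] by simp
  also have "\<dots> = frechet_derivative (\<lambda>x. v (\<lambda>r. h (f (chart_inv c x, r)))) (at a) w"
    using frechet_derivative_cong_ev[OF _ evv] smooth_at_has_derivative[OF D2(1)] differentiableI by metis
  also have "\<dots> = u (\<lambda>p. v (\<lambda>r. h (f (p, r))))"
    unfolding w A.dirderiv_eq[OF n2[unfolded w]] a_def ..
  finally show "u (\<lambda>p. v (\<lambda>r. h (f (p, r)))) = v (\<lambda>r. u (\<lambda>p. h (f (p, r))))" ..
qed

text \<open>Since \<open>f\<close> inverts the pair (a, b) near s, every function is there a
  function of the coordinates of a and b, on which u and v agree. For a bundle, a is the projection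
  and b the fibre coordinate.\<close>

lemma tvec_eqI_prod:
  assumes s: "a s = p" "b s = r"
    and ab: "smooth_map_at C A a s" "smooth_map_at C B b s"
    and inv: "eventually (\<lambda>x. f (a x, b x) = x) (nhds s)"
    and uv: "u \<in> tspace C s" "v \<in> tspace C s"
    and eqa: "\<And>h. smooth_near A h p \<Longrightarrow> u (\<lambda>x. h (a x)) = v (\<lambda>x. h (a x))"
    and eqb: "\<And>h. smooth_near B h r \<Longrightarrow> u (\<lambda>x. h (b x)) = v (\<lambda>x. h (b x))"
  shows "u = v"
proof
  fix h
  obtain c where c: "c \<in> charts A" "p \<in> fst c" using A.chart_cover .
  obtain d where d: "d \<in> charts B" "r \<in> fst d" using B.chart_cover .
  note chc = A.charts_is_chart[OF c(1)] and chd = B.charts_is_chart[OF d(1)]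
  define k where "k x = (snd c (a x), snd d (b x))" for x
  have ks: "smooth_near C (\<lambda>x. snd c (a x) \<bullet> z) s" "smooth_near C (\<lambda>x. snd d (b x) \<bullet> z') s" for z z'
    using smooth_map_atD[OF ab(1), of "\<lambda>y. snd c y \<bullet> z"] smooth_map_atD[OF ab(2), of "\<lambda>y. snd d y \<bullet> z'"]
      A.smooth_near_coord[OF c] B.smooth_near_coord[OF d] s by simp_all
  then have k: "smooth_near C (\<lambda>x. k x \<bullet> z) s" for z
    unfolding k_def by (simp add: inner_prod_def C.smooth_near_add)
  have eq: "u (\<lambda>x. k x \<bullet> z) = v (\<lambda>x. k x \<bullet> z)" for z
    unfolding k_def using eqa[OF A.smooth_near_coord[OF c]] eqb[OF B.smooth_near_coord[OF d]]
    by (simp add: inner_prod_def C.tvec_add[OF uv(1) ks] C.tvec_add[OF uv(2) ks])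
  show "u h = v h"
  proof (cases "smooth_near C h s")
    case True
    define F where "F y = h (f (chart_inv c (fst y), chart_inv d (snd y)))" for y
    have fs: "f (p, r) = s" using eventually_nhds_x_imp_x[OF inv] s by simp
    have F: "smooth_at F (k s)"
      unfolding F_def k_def s by (rule smooth_at_charts[OF c d]) (simp add: fs True)
    have "filterlim a (nhds p) (nhds s)" "filterlim b (nhds r) (nhds s)"
      using ab s unfolding smooth_map_at_def isCont_def tendsto_at_iff_tendsto_nhds by auto
    then have "eventually (\<lambda>x. a x \<in> fst c) (nhds s)" "eventually (\<lambda>x. b x \<in> fst d) (nhds s)"
      using chart_eventually_domain[OF chc c(2)] chart_eventually_domain[OF chd d(2)]
      unfolding filterlim_iff by blast+
    with inv have ev: "eventually (\<lambda>x. h x = F (k x)) (nhds s)"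
      by eventually_elim (simp add: F_def k_def chc chd)
    have "u h = u (\<lambda>x. F (k x))" by (rule C.tvec_cong_ev[OF uv(1) ev])
    also have "\<dots> = v (\<lambda>x. F (k x))"
      using C.tvec_chain[OF uv(1) k F] C.tvec_chain[OF uv(2) k F] eq by simp
    also have "\<dots> = v h" by (rule C.tvec_cong_ev[OF uv(2) ev, symmetric])
    finally show ?thesis .
  next
    case False
    then show ?thesis using C.tvec_not_smooth uv by metis
  qed
qed

end

end

section \<open>Smooth dependence of inverse matrices\<close>

lemma matrix_inv_cancel:
  fixes M :: "'a::semiring_1^'n^'m"
  assumes "invertible M"
  shows "M ** matrix_inv M = mat 1" "matrix_inv M ** M = mat 1"
  using someI_ex[OF assms[unfolded invertible_def]] unfolding matrix_inv_def by blast+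

lemma matrix_inv_eq_left_inverse:
  fixes M N :: "real^'n^'n"
  assumes "N ** M = mat 1"
  shows "invertible M" "matrix_inv M = N"
proof -
  show i: "invertible M"
    using assms matrix_left_right_inverse unfolding invertible_def by blast
  have "matrix_inv M = (N ** M) ** matrix_inv M" using assms by simp
  also have "\<dots> = N" by (simp add: matrix_mul_assoc[symmetric] matrix_inv_cancel[OF i])
  finally show "matrix_inv M = N" .
qed

lemma (in smooth_mfd) smooth_near_det:
  fixes M :: "'p \<Rightarrow> real^'n^'n"
  assumes "\<And>i j. smooth_near A (\<lambda>p. M p $ i $ j) q"
  shows "smooth_near A (\<lambda>p. det (M p)) q"
  unfolding det_def by (intro smooth_near_sum smooth_near_mult smooth_near_const smooth_near_prod assms)

text \<open>By Cramer's rule an entry of the inverse is a quotient of determinants, which are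
  polynomials in the entries. The denominator stays nonzero near q, so the formula holds on a
  neighbourhood.\<close>

lemma (in smooth_mfd) smooth_near_matrix_inv:
  fixes M :: "'p \<Rightarrow> real^'n^'n"
  assumes M: "\<And>i j. smooth_near A (\<lambda>p. M p $ i $ j) q" and inv: "invertible (M q)"
  shows "smooth_near A (\<lambda>p. matrix_inv (M p) $ i $ j) q"
proof -
  \<comment> \<open>Column j of the inverse solves M x = e_j, and its entry i is wanted: hence
    column i of \<open>M p\<close> is replaced by e_j.\<close>
  define E where "E p = (\<chi> k l. if l = i then axis j 1 $ k else M p $ k $ l)" for p
  have det: "det (M q) \<noteq> 0" using inv invertible_det_nz by blast
  have E: "smooth_near A (\<lambda>p. E p $ k $ l) q" for k l
    by (cases "l = i") (simp_all add: M E_def)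
  have "smooth_near A (\<lambda>p. inverse (det (M p)) * det (E p)) q"
    by (intro smooth_near_mult smooth_near_inverse smooth_near_det M E det)
  moreover have "eventually (\<lambda>p. inverse (det (M p)) * det (E p) = matrix_inv (M p) $ i $ j) (nhds q)"
  proof -
    have "isCont (\<lambda>p. det (M p)) q" by (rule smooth_near_isCont[OF smooth_near_det[OF M]])
    then have "((\<lambda>p. det (M p)) \<longlongrightarrow> det (M q)) (nhds q)"
      using tendsto_at_iff_tendsto_nhds[of "\<lambda>p. det (M p)" q] unfolding isCont_def by blast
    then have "eventually (\<lambda>p. det (M p) \<in> - {0}) (nhds q)"
      by (rule topological_tendstoD) (use det in auto)
    then show ?thesis
    proof eventually_elim
      case (elim p)
      then have nz: "det (M p) \<noteq> 0" by simp
      then have "M p ** matrix_inv (M p) = mat 1" using matrix_inv_cancel(1) invertible_det_nz by blast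
      then have "M p *v (matrix_inv (M p) *v axis j 1) = axis j 1"
        by (simp add: matrix_vector_mul_assoc)
      then have "matrix_inv (M p) *v axis j 1 =
          (\<chi> k. det (\<chi> k' l. if l = k then axis j 1 $ k' else M p $ k' $ l) / det (M p))"
        using cramer[OF nz] by blast
      then have "(matrix_inv (M p) *v axis j 1) $ i = det (E p) / det (M p)" by (simp add: E_def)
      then show ?case
        by (simp add: matrix_vector_mult_basis column_def divide_inverse mult.commute)
    qed
  qed
  ultimately show ?thesis by (rule smooth_near_cong_ev)
qed

lemma Basis_vec_real: "(Basis :: (real^'n) set) = range (\<lambda>i. axis i 1)"
  unfolding Basis_vec_def by auto

locale smooth_mfd_vec = smooth_mfd A
  for A :: "('p::{t2_space, second_countable_topology}, real^'n) chart set"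
begin

lemma smooth_near_coord_vec:
  assumes "c \<in> charts A" "q \<in> fst c"
  shows "smooth_near A (\<lambda>p. snd c p $ a) q"
  using smooth_near_coord[OF assms, of "axis a 1"] by (simp add: inner_axis)

lemma dirderiv_axis_coord:
  assumes "c \<in> charts A" "q \<in> fst c"
  shows "dirderiv A c q (axis a 1) (\<lambda>p. snd c p $ b) = delta a b"
proof -
  have "dirderiv A c q (axis a 1) (\<lambda>p. snd c p $ b) = axis a 1 $ b"
    using dirderiv_coord[OF assms, of "axis a 1" "axis b 1"] by (simp add: inner_axis)
  also have "\<dots> = delta a b" by (simp add: axis_def delta_def)
  finally show ?thesis .
qed

lemma tvec_eqI_vec:
  assumes "u \<in> tspace A q" "v \<in> tspace A q" "c \<in> charts A" "q \<in> fst c"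
    and "\<And>a. u (\<lambda>p. snd c p $ a) = v (\<lambda>p. snd c p $ a)"
  shows "u = v"
  by (rule tvec_eqI[OF assms(1-4)]) (use assms(5) in \<open>auto simp: Basis_vec_real inner_axis\<close>)

end

section \<open>Finite bases of spaces of tangent vectors\<close>

lemma sum_delta: "(\<Sum>a\<in>UNIV. f a * delta a b) = f b" "(\<Sum>a\<in>UNIV. f a * delta b a) = f b"
  "(\<Sum>a\<in>UNIV. delta a b * f a) = f b" "(\<Sum>a\<in>UNIV. delta b a * f a) = f b"
  for b :: "'i::finite"
  by (simp_all add: delta_def mult_delta_left mult_delta_right)

lemma lincomb_delta: "lincomb e (\<lambda>i. delta i j) = e j"
  by (simp add: lincomb_def sum_delta)

lemma is_basisD:
  assumes "is_basis T e"
  shows "lincomb e r \<in> T" and "e i \<in> T" and "u \<in> T \<Longrightarrow> \<exists>r. u = lincomb e r"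
    and "lincomb e r = lincomb e s \<Longrightarrow> r = s" and "component e (lincomb e r) = r"
proof -
  show *: "lincomb e r \<in> T" for r using assms unfolding is_basis_def bij_betw_def by blast
  show "e i \<in> T" using *[of "\<lambda>j. delta j i"] by (simp add: lincomb_delta)
  show "u \<in> T \<Longrightarrow> \<exists>r. u = lincomb e r" using assms unfolding is_basis_def bij_betw_def by blast
  show inj: "lincomb e r = lincomb e s \<Longrightarrow> r = s" for r s
    using assms unfolding is_basis_def bij_betw_def inj_def by blast
  show "component e (lincomb e r) = r" unfolding component_def using inj by blast
qed

lemma is_basisI:
  assumes "\<And>r. lincomb e r \<in> T" "\<And>u. u \<in> T \<Longrightarrow> \<exists>r. u = lincomb e r"
    and "\<And>r s. lincomb e r = lincomb e s \<Longrightarrow> r = s"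
  shows "is_basis T e"
  unfolding is_basis_def bij_betw_def inj_def using assms by blast

lemma is_basis_combination:
  assumes "is_basis T e" "u \<in> T" "v \<in> T"
  shows "(\<lambda>f. s * u f + t * v f) \<in> T"
proof -
  obtain x y where "u = lincomb e x" "v = lincomb e y" using is_basisD(3) assms by metis
  then have "(\<lambda>f. s * u f + t * v f) = lincomb e (\<lambda>i. s * x i + t * y i)"
    by (simp add: lincomb_def sum_distrib_left sum.distrib algebra_simps)
  then show ?thesis using is_basisD(1)[OF assms(1)] by simp
qed

section \<open>Vertical vectors and horizontal lifts\<close>

locale chaplygin =
  fixes S :: "('q::{t2_space, second_countable_topology}, 'x::{t2_space, second_countable_topology},
      'g::{t2_space, second_countable_topology}, 'n::finite, 'm::finite, 'k::finite) chaplygin_data"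
    and \<xi> :: "'k \<Rightarrow> 'g tvec"
  assumes system: "chaplygin_system S" and basis: "lie_algebra_basis S \<xi>"

sublocale chaplygin \<subseteq> Q: smooth_mfd_vec "atlQ S"
  using system by unfold_locales (simp add: chaplygin_system_def)

sublocale chaplygin \<subseteq> B: smooth_mfd_vec "atlB S"
  using system by unfold_locales (simp add: chaplygin_system_def)

sublocale chaplygin \<subseteq> G: smooth_mfd_vec "atlG S"
  using system by unfold_locales (simp add: chaplygin_system_def lie_group_def)

sublocale chaplygin \<subseteq> grp: Groups.group "gmul S" "gone S" "ginv S"
  using system by (simp add: chaplygin_system_def lie_group_def)

sublocale chaplygin \<subseteq> GQQ: three_mfds "atlG S" "atlQ S" "atlQ S"
  by unfold_locales

sublocale chaplygin \<subseteq> BGQ: three_mfds "atlB S" "atlG S" "atlQ S"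
  by unfold_locales

sublocale chaplygin \<subseteq> GGG: three_mfds "atlG S" "atlG S" "atlG S"
  by unfold_locales

context chaplygin
begin

lemma proj_smooth: "smooth_map_at (atlQ S) (atlB S) (proj S) q"
  using system smooth_map_on_imp_at[OF Q.smooth_mfd_axioms B.smooth_mfd_axioms, of UNIV "proj S" q]
  by (simp add: chaplygin_system_def principal_bundle_def)

lemma proj_pullback: "smooth_near (atlB S) h (proj S q) \<Longrightarrow> smooth_near (atlQ S) (\<lambda>p. h (proj S p)) q"
  by (rule smooth_map_atD[OF proj_smooth])

lemma act_smooth: "smooth_map_on (prod_atlas (atlG S) (atlQ S)) (atlQ S) UNIV (\<lambda>(h, q). act S h q)"
  and act_one [simp]: "act S (gone S) q = q"
  using system by (auto simp: chaplygin_system_def smooth_action_def)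

lemma act_slices:
  "smooth_map_at (atlG S) (atlQ S) (\<lambda>h. act S h q) h" "smooth_map_at (atlQ S) (atlQ S) (act S h) q"
  using GQQ.smooth_map_at_slices[OF act_smooth, of h q] by simp_all

lemma proj_act [simp]: "proj S (act S h q) = proj S q"
  using system by (metis chaplygin_system_def principal_bundle_def)

lemma mult_right_smooth: "smooth_map_at (atlG S) (atlG S) (\<lambda>a. gmul S a b) a"
  using GGG.smooth_map_at_slices(1)[of UNIV "\<lambda>(a, b). gmul S a b" a b] system
  by (simp add: chaplygin_system_def lie_group_def)

lemma open_proj_vimage: "open U \<Longrightarrow> open (proj S -` U)"
  using system unfolding chaplygin_system_def principal_bundle_def smooth_map_on_def
  by (metis continuous_on_open_vimage Int_UNIV_right open_UNIV)

lemma trivialization: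
  obtains U \<kappa> \<tau> where "open U" "proj S q \<in> U" "smooth_map_at (atlQ S) (atlG S) \<kappa> q"
    "smooth_map_on (prod_atlas (atlB S) (atlG S)) (atlQ S) (U \<times> UNIV) \<tau>"
    "\<And>p. proj S p \<in> U \<Longrightarrow> \<tau> (proj S p, \<kappa> p) = p"
    "\<And>y h. y \<in> U \<Longrightarrow> proj S (\<tau> (y, h)) = y"
    "\<And>p h. proj S p \<in> U \<Longrightarrow> \<kappa> (act S h p) = gmul S h (\<kappa> p)"
proof -
  have pb: "principal_bundle S" using system by (simp add: chaplygin_system_def)
  then obtain U \<kappa> \<tau> where U: "open U" "proj S q \<in> U"
    "smooth_map_on (atlQ S) (atlG S) (proj S -` U) \<kappa>"
    "smooth_map_on (prod_atlas (atlB S) (atlG S)) (atlQ S) (U \<times> UNIV) \<tau>"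
    "\<forall>p\<in>proj S -` U. \<tau> (proj S p, \<kappa> p) = p"
    "\<forall>y\<in>U. \<forall>h. proj S (\<tau> (y, h)) = y \<and> \<kappa> (\<tau> (y, h)) = h"
    "\<forall>p\<in>proj S -` U. \<forall>h. \<kappa> (act S h p) = gmul S h (\<kappa> p)"
    unfolding principal_bundle_def by metis
  have "smooth_map_at (atlQ S) (atlG S) \<kappa> q"
    using smooth_map_on_imp_at[OF Q.smooth_mfd_axioms G.smooth_mfd_axioms U(3) open_proj_vimage[OF U(1)]]
      U(2) by simp
  then show thesis using that[of U \<kappa> \<tau>] U by auto
qed

abbreviation push :: "'q \<Rightarrow> 'q tvec \<Rightarrow> 'x tvec" where
  "push \<equiv> tangent_map (atlB S) (proj S)"

lemma push_in_tspace: "u \<in> tspace (atlQ S) q \<Longrightarrow> push q u \<in> tspace (atlB S) (proj S q)"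
  by (rule tangent_map_in_tspace[OF Q.smooth_mfd_axioms B.smooth_mfd_axioms proj_smooth])

lemma push_apply: "smooth_near (atlB S) h (proj S q) \<Longrightarrow> push q u h = u (\<lambda>p. h (proj S p))"
  by (rule tangent_map_apply)

text \<open>Freezing the fibre coordinate at its value at q gives a local section through q. Its
  tangent map lifts v, because the section followed by \<open>proj\<close> is the identity near
  \<open>proj S q\<close>.\<close>

lemma push_surj:
  assumes v: "v \<in> tspace (atlB S) (proj S q)"
  obtains u where "u \<in> tspace (atlQ S) q" "push q u = v"
proof -
  obtain U \<kappa> \<tau> where U: "open U" "proj S q \<in> U" "smooth_map_at (atlQ S) (atlG S) \<kappa> q"
    "smooth_map_on (prod_atlas (atlB S) (atlG S)) (atlQ S) (U \<times> UNIV) \<tau>"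
    "\<And>p. proj S p \<in> U \<Longrightarrow> \<tau> (proj S p, \<kappa> p) = p"
    "\<And>y h. y \<in> U \<Longrightarrow> proj S (\<tau> (y, h)) = y"
    "\<And>p h. proj S p \<in> U \<Longrightarrow> \<kappa> (act S h p) = gmul S h (\<kappa> p)" by (rule trivialization[of q]) blast
  define s where "s y = \<tau> (y, \<kappa> q)" for y
  have sq: "s (proj S q) = q" unfolding s_def using U(2,5) by blast
  have s: "smooth_map_at (atlB S) (atlQ S) s (proj S q)"
    unfolding s_def
    by (rule BGQ.smooth_map_at_slices(1)[OF U(4)]) (use U in \<open>auto intro: open_Times\<close>)
  define u where "u = tangent_map (atlQ S) s (proj S q) v"
  have "u \<in> tspace (atlQ S) q"
    using tangent_map_in_tspace[OF B.smooth_mfd_axioms Q.smooth_mfd_axioms s v] sq by (simp add: u_def)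
  moreover have "push q u = v"
  proof
    fix h
    show "push q u h = v h"
    proof (cases "smooth_near (atlB S) h (proj S q)")
      case True
      have "push q u h = v (\<lambda>y. h (proj S (s y)))"
        using tangent_map_apply[of "atlQ S" "\<lambda>p. h (proj S p)" s "proj S q" v] proj_pullback[OF True] sq
        by (simp add: push_apply[OF True] u_def)
      also have "\<dots> = v h"
        by (rule B.tvec_cong_ev[OF v], rule eventually_mono[OF eventually_nhds_in_open[OF U(1,2)]])
          (simp add: s_def U(6))
      finally show ?thesis .
    next
      case False
      then show ?thesis using B.tvec_not_smooth[OF v] by (simp add: tangent_map_def)
    qed
  qed
  ultimately show thesis using that by blast
qed

lemma vertical_iff:
  "u \<in> vertical S q \<longleftrightarrow> u \<in> tspace (atlQ S) q \<and>
     (\<forall>h. smooth_near (atlB S) h (proj S q) \<longrightarrow> u (\<lambda>p. h (proj S p)) = 0)"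
  unfolding vertical_def by (auto simp: tangent_map_def fun_eq_iff o_def)

lemma lie_basis: "is_basis (tspace (atlG S) (gone S)) \<xi>"
  using basis by (simp add: lie_algebra_basis_def)

lemma lie_tspace: "\<xi> i \<in> tspace (atlG S) (gone S)"
  using is_basisD(2)[OF lie_basis] .

lemma vert_field_tspace: "vert_field S \<xi> i q \<in> tspace (atlQ S) q"
  using tangent_map_in_tspace[OF G.smooth_mfd_axioms Q.smooth_mfd_axioms act_slices(1) lie_tspace]
  unfolding vert_field_def by (metis act_one)

lemma vert_field_apply:
  "smooth_near (atlQ S) f q \<Longrightarrow> vert_field S \<xi> i q f = \<xi> i (\<lambda>h. f (act S h q))"
  unfolding vert_field_def by (rule tangent_map_apply) simp

lemma vert_field_vertical: "vert_field S \<xi> i q \<in> vertical S q"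
  unfolding vertical_iff
  by (simp add: vert_field_tspace vert_field_apply[OF proj_pullback] G.tvec_const[OF lie_tspace])

text \<open>The fibre coordinate, translated so that q goes to the identity, is a map
  \<open>\<mu>\<close> with \<open>\<mu> (act S h q) = h\<close>. Its tangent map sends the
  generators to the \<open>\<xi> i\<close>, which gives independence. For spanning, a vertical u is
  compared with the combination that has the same image under \<open>\<mu>\<close>: both have image
  0 under \<open>proj\<close>, and the two maps together determine a vector.\<close>

lemma vert_basis: "is_basis (vertical S q) (\<lambda>i. vert_field S \<xi> i q)"
proof -
  obtain U \<kappa> \<tau> where U: "open U" "proj S q \<in> U" and \<kappa>: "smooth_map_at (atlQ S) (atlG S) \<kappa> q"
    and \<tau>: "smooth_map_on (prod_atlas (atlB S) (atlG S)) (atlQ S) (U \<times> UNIV) \<tau>"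
    "\<And>p. proj S p \<in> U \<Longrightarrow> \<tau> (proj S p, \<kappa> p) = p"
    and equiv: "\<And>p h. proj S p \<in> U \<Longrightarrow> \<kappa> (act S h p) = gmul S h (\<kappa> p)" by (rule trivialization[of q]) blast
  define g where "g = \<kappa> q"
  define \<mu> where "\<mu> p = gmul S (\<kappa> p) (ginv S g)" for p
  have \<mu>q: "\<mu> q = gone S" by (simp add: \<mu>_def g_def)
  have \<mu>: "smooth_map_at (atlQ S) (atlG S) \<mu> q"
  proof -
    have "isCont (\<lambda>a. gmul S a (ginv S g)) (\<kappa> q)" "isCont \<kappa> q"
      using mult_right_smooth \<kappa> unfolding smooth_map_at_def by blast+
    then have "isCont \<mu> q" unfolding \<mu>_def using isCont_o2 by blast
    moreover have "smooth_near (atlQ S) (\<lambda>p. k (\<mu> p)) q" if "smooth_near (atlG S) k (\<mu> q)" for k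
      unfolding \<mu>_def
      by (rule smooth_map_atD[OF \<kappa>, of "\<lambda>a. k (gmul S a (ginv S g))"],
          rule smooth_map_atD[OF mult_right_smooth]) (use that in \<open>simp add: \<mu>_def\<close>)
    ultimately show ?thesis unfolding smooth_map_at_def by blast
  qed
  have transport: "lincomb (\<lambda>i. vert_field S \<xi> i q) r (\<lambda>p. k (\<mu> p)) = lincomb \<xi> r k"
    if k: "smooth_near (atlG S) k (gone S)" for r k
  proof -
    have "smooth_near (atlQ S) (\<lambda>p. k (\<mu> p)) q"
      by (rule smooth_map_atD[OF \<mu>]) (simp add: \<mu>q k)
    moreover have "\<mu> (act S h q) = h" for h
      using equiv[OF U(2)] by (simp add: \<mu>_def g_def grp.assoc)
    ultimately show ?thesis by (simp add: lincomb_def vert_field_apply)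
  qed
  show ?thesis
  proof (rule is_basisI)
    show "lincomb (\<lambda>i. vert_field S \<xi> i q) r \<in> vertical S q" for r
      using vert_field_vertical unfolding vertical_iff
      by (auto simp: lincomb_def intro!: Q.tspace_sum)
  next
    fix r s assume *: "lincomb (\<lambda>i. vert_field S \<xi> i q) r = lincomb (\<lambda>i. vert_field S \<xi> i q) s"
    have "lincomb \<xi> r k = lincomb \<xi> s k" for k
    proof (cases "smooth_near (atlG S) k (gone S)")
      case True
      then show ?thesis using transport * by metis
    next
      case False
      then show ?thesis using G.tvec_not_smooth is_basisD(1)[OF lie_basis] by metis
    qed
    then show "r = s" using is_basisD(4)[OF lie_basis] by blast
  next
    fix u assume u: "u \<in> vertical S q"
    have "tangent_map (atlG S) \<mu> q u \<in> tspace (atlG S) (gone S)"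
      using tangent_map_in_tspace[OF Q.smooth_mfd_axioms G.smooth_mfd_axioms \<mu>] u \<mu>q
      unfolding vertical_iff by metis
    then obtain r where r: "tangent_map (atlG S) \<mu> q u = lincomb \<xi> r"
      using is_basisD(3)[OF lie_basis] by blast
    define v where "v = lincomb (\<lambda>i. vert_field S \<xi> i q) r"
    have v: "v \<in> vertical S q"
      using vert_field_vertical unfolding vertical_iff v_def
      by (auto simp: lincomb_def intro!: Q.tspace_sum)
    have eq: "u (\<lambda>p. k (\<mu> p)) = v (\<lambda>p. k (\<mu> p))" if k: "smooth_near (atlG S) k (gone S)" for k
      using transport[OF k, of r] tangent_map_apply[of "atlG S" k \<mu> q u] k r by (simp add: v_def \<mu>q)
    have "u = v"
    proof (rule BGQ.tvec_eqI_prod[OF \<tau>(1), of "proj S q" g])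
      show "eventually (\<lambda>p. \<tau> (proj S p, \<kappa> p) = p) (nhds q)"
        using eventually_nhds_in_open[OF open_proj_vimage[OF U(1)], of q] U(2)
        by (auto elim!: eventually_mono simp: \<tau>(2))
      show "u (\<lambda>p. h (proj S p)) = v (\<lambda>p. h (proj S p))" if "smooth_near (atlB S) h (proj S q)" for h
        using that u v unfolding vertical_iff by simp
      \<comment> \<open>A function of \<kappa> is a function of \<mu> after right translation by g,
        as \<kappa> = \<mu> g.\<close>
      show "u (\<lambda>p. h (\<kappa> p)) = v (\<lambda>p. h (\<kappa> p))" if h: "smooth_near (atlG S) h g" for h
      proof -
        have "smooth_near (atlG S) (\<lambda>a. h (gmul S a g)) (gone S)"
          by (rule smooth_map_atD[OF mult_right_smooth]) (simp add: h)
        from eq[OF this] show ?thesis by (simp add: \<mu>_def grp.assoc)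
      qed
    qed (use u v \<kappa> proj_smooth U in \<open>auto simp: g_def vertical_iff intro: open_Times\<close>)
    then show "\<exists>r. u = lincomb (\<lambda>i. vert_field S \<xi> i q) r" using v_def by blast
  qed
qed

lemma act_eventually: "smooth_near (atlQ S) f q \<Longrightarrow>
    eventually (\<lambda>h. smooth_near (atlQ S) f (act S h q)) (nhds (gone S))"
  using smooth_map_at_filterlim[OF act_slices(1)[of q "gone S"]] Q.smooth_near_eventually[of f q]
  unfolding filterlim_iff by simp

text \<open>Differentiation with a parameter: the function f(h p) lives on G x Q, and its derivative
  in h at the identity is smooth in p.\<close>

lemma vert_field_smooth:
  assumes "smooth_near (atlQ S) f q"
  shows "smooth_near (atlQ S) (\<lambda>p. vert_field S \<xi> i p f) q"
proof -
  have "smooth_near (atlQ S) (\<lambda>p. \<xi> i (\<lambda>h. f (act S h p))) q"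
    using GQQ.partial_derivatives(1)[OF act_smooth open_UNIV _ lie_tspace Q.tspace_zero] assms by simp
  moreover have "eventually (\<lambda>p. \<xi> i (\<lambda>h. f (act S h p)) = vert_field S \<xi> i p f) (nhds q)"
    using Q.smooth_near_eventually[OF assms] by eventually_elim (simp add: vert_field_apply)
  ultimately show ?thesis by (rule Q.smooth_near_cong_ev)
qed

lemma vert_field_vector_field: "vector_field (atlQ S) U (vert_field S \<xi> i)"
  by (rule Q.vector_fieldI[OF vert_field_tspace vert_field_smooth])

section \<open>The distribution and horizontal lifting\<close>

lemma distr_frame:
  obtains U and Y :: "'m \<Rightarrow> 'q \<Rightarrow> 'q tvec" where "open U" "q \<in> U"
    "\<And>a. vector_field (atlQ S) U (Y a)" "\<And>p. p \<in> U \<Longrightarrow> is_basis (distr S p) (\<lambda>a. Y a p)"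
  using system unfolding chaplygin_system_def principal_connection_def distribution_def by metis

lemma distr_combination:
  "u \<in> distr S q \<Longrightarrow> v \<in> distr S q \<Longrightarrow> (\<lambda>f. s * u f + t * v f) \<in> distr S q"
  by (rule distr_frame[of q]) (blast intro: is_basis_combination)

lemma distr_lincomb:
  assumes "\<And>i. e i \<in> distr S q"
  shows "lincomb e r \<in> distr S q"
proof -
  \<comment> \<open>Some member is at hand to produce the zero vector, the value of the empty sum,
    as 0 u + 0 u.\<close>
  obtain u where u: "u \<in> distr S q" using assms by blast
  have "(\<lambda>f. \<Sum>i\<in>I. r i * e i f) \<in> distr S q" for I
  proof (induction I rule: infinite_finite_induct)
    case (insert x F)
    then show ?case using distr_combination[OF assms insert.IH, of "r x" x 1] by simp
  qed (use distr_combination[OF u u, of 0 0] in simp_all)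
  then show ?thesis by (simp add: lincomb_def)
qed

lemma distr_tspace: "u \<in> distr S q \<Longrightarrow> u \<in> tspace (atlQ S) q"
  using system unfolding chaplygin_system_def principal_connection_def distribution_def by blast

lemma distr_vertical: "u \<in> distr S q \<Longrightarrow> u \<in> vertical S q \<Longrightarrow> u = (\<lambda>_. 0)"
  using system unfolding chaplygin_system_def principal_connection_def by blast

lemma distr_decompose:
  assumes "u \<in> tspace (atlQ S) q"
  obtains v w where "v \<in> distr S q" "w \<in> vertical S q" "u = (\<lambda>f. v f + w f)"
  using system assms unfolding chaplygin_system_def principal_connection_def by metis

lemma distr_act: "tangent_map (atlQ S) (act S h) q ` distr S q = distr S (act S h q)"
  using system unfolding chaplygin_system_def principal_connection_def by metis

lemma distr_eqI:
  assumes "u \<in> distr S q" "v \<in> distr S q" "push q u = push q v"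
  shows "u = v"
proof -
  have "(\<lambda>f. 1 * u f + (-1) * v f) \<in> distr S q" using distr_combination assms by blast
  moreover have "(\<lambda>f. 1 * u f + (-1) * v f) \<in> vertical S q"
    unfolding vertical_iff
  proof (intro conjI allI impI)
    fix h assume h: "smooth_near (atlB S) h (proj S q)"
    show "1 * u (\<lambda>p. h (proj S p)) + (-1) * v (\<lambda>p. h (proj S p)) = 0"
      using push_apply[OF h, of u] push_apply[OF h, of v] assms(3) by simp
  qed (rule Q.tspace_combination[OF distr_tspace[OF assms(1)] distr_tspace[OF assms(2)]])
  ultimately have "(\<lambda>f. 1 * u f + (-1) * v f) = (\<lambda>_. 0)" by (rule distr_vertical)
  then show ?thesis by (auto simp: fun_eq_iff)
qed

text \<open>Existence takes any lift and drops its vertical part, which the projection kills;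
  uniqueness is transversality of the distribution to the fibres. It licenses the definite
  description in \<open>hor_field\<close>.\<close>

lemma distr_lift:
  assumes "v \<in> tspace (atlB S) (proj S q)"
  shows "\<exists>!u. u \<in> distr S q \<and> push q u = v"
proof -
  obtain u where u: "u \<in> tspace (atlQ S) q" "push q u = v" using push_surj assms by blast
  obtain x w where x: "x \<in> distr S q" "w \<in> vertical S q" "u = (\<lambda>f. x f + w f)"
    using distr_decompose[OF u(1)] by blast
  have "push q x = v"
    unfolding u(2)[symmetric] x(3) using x(2) unfolding vertical_iff
    by (auto simp: tangent_map_def fun_eq_iff o_def)
  then show ?thesis using x(1) distr_eqI by metis
qed

end

section \<open>The adapted frame\<close>

context chaplygin
begin

lemma metric_tensor: "symmetric_tensor (atlQ S) (gmetric S)"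
  using system unfolding chaplygin_system_def riemannian_metric_def by blast

lemma metric_sym:
  "u \<in> tspace (atlQ S) q \<Longrightarrow> w \<in> tspace (atlQ S) q \<Longrightarrow> gmetric S q u w = gmetric S q w u"
  using metric_tensor[unfolded symmetric_tensor_def, THEN conjunct1] by blast

lemma metric_combination:
  "u \<in> tspace (atlQ S) q \<Longrightarrow> v \<in> tspace (atlQ S) q \<Longrightarrow> w \<in> tspace (atlQ S) q \<Longrightarrow>
    gmetric S q (\<lambda>f. s * u f + t * v f) w = s * gmetric S q u w + t * gmetric S q v w"
  using metric_tensor[unfolded symmetric_tensor_def, THEN conjunct2, THEN conjunct1] by blast

lemma metric_pos: "u \<in> tspace (atlQ S) q \<Longrightarrow> u \<noteq> (\<lambda>_. 0) \<Longrightarrow> gmetric S q u u > 0"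
  using system unfolding chaplygin_system_def riemannian_metric_def by blast

lemma metric_smooth:
  assumes "open U" "vector_field (atlQ S) U X" "vector_field (atlQ S) U Y" "q \<in> U"
  shows "smooth_near (atlQ S) (\<lambda>q. gmetric S q (X q) (Y q)) q"
proof -
  have "smooth_fun (atlQ S) U (\<lambda>q. gmetric S q (X q) (Y q))"
    using assms metric_tensor[unfolded symmetric_tensor_def, THEN conjunct2, THEN conjunct2] by blast
  then show ?thesis using assms unfolding smooth_near_def by blast
qed

lemma metric_sum_left:
  assumes "\<And>i. e i \<in> tspace (atlQ S) q" "w \<in> tspace (atlQ S) q"
  shows "gmetric S q (\<lambda>f. \<Sum>i\<in>I. r i * e i f) w = (\<Sum>i\<in>I. r i * gmetric S q (e i) w)"
proof (induction I rule: infinite_finite_induct)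
  case (insert x F)
  have "gmetric S q (\<lambda>f. r x * e x f + 1 * (\<Sum>i\<in>F. r i * e i f)) w =
      r x * gmetric S q (e x) w + 1 * gmetric S q (\<lambda>f. \<Sum>i\<in>F. r i * e i f) w"
    by (rule metric_combination[OF assms(1) Q.tspace_sum[OF assms(1)] assms(2)])
  with insert show ?case by simp
qed (use metric_combination[OF assms(2) assms(2) assms(2), of 0 0] in simp_all)

lemma metric_lincomb_left:
  assumes "\<And>i. e i \<in> tspace (atlQ S) q" "w \<in> tspace (atlQ S) q"
  shows "gmetric S q (lincomb e r) w = (\<Sum>i\<in>UNIV. r i * gmetric S q (e i) w)"
  unfolding lincomb_def by (rule metric_sum_left[OF assms])

lemma metric_lincomb_right:
  assumes "\<And>i. e i \<in> tspace (atlQ S) q" "w \<in> tspace (atlQ S) q"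
  shows "gmetric S q w (lincomb e r) = (\<Sum>i\<in>UNIV. r i * gmetric S q w (e i))"
proof -
  have "gmetric S q w (lincomb e r) = gmetric S q (lincomb e r) w"
    by (rule metric_sym[OF assms(2) Q.tspace_lincomb[OF assms(1)]])
  also have "\<dots> = (\<Sum>i\<in>UNIV. r i * gmetric S q (e i) w)"
    by (rule metric_lincomb_left[OF assms])
  finally show ?thesis by (simp add: metric_sym[OF assms(1) assms(2)])
qed

lemma push_act:
  "push (act S h q) (tangent_map (atlQ S) (act S h) q u) = push q u"
proof
  fix k
  show "push (act S h q) (tangent_map (atlQ S) (act S h) q u) k = push q u k"
  proof (cases "smooth_near (atlB S) k (proj S q)")
    case True
    then show ?thesis
      using tangent_map_apply[of "atlQ S" "\<lambda>p. k (proj S p)" "act S h" q u] proj_pullback[of k "act S h q"]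
      by (simp add: push_apply)
  qed (simp add: tangent_map_def)
qed

end

section \<open>The frame over one chart of the quotient\<close>

locale chaplygin_chart = chaplygin S \<xi>
  for S :: "('q::{t2_space, second_countable_topology}, 'x::{t2_space, second_countable_topology},
      'g::{t2_space, second_countable_topology}, 'n::finite, 'm::finite, 'k::finite) chaplygin_data"
    and \<xi> :: "'k \<Rightarrow> 'g tvec" +
  fixes c :: "('x, real^'m) chart"
  assumes chart: "c \<in> charts (atlB S)"
begin

abbreviation dom :: "'q set" where "dom \<equiv> proj S -` fst c"
abbreviation crd :: "'m \<Rightarrow> 'q \<Rightarrow> real" where "crd a \<equiv> (\<lambda>p. snd c (proj S p) $ a)"
abbreviation X :: "'m \<Rightarrow> 'q \<Rightarrow> 'q tvec" where "X \<equiv> hor_field S c"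
abbreviation V :: "'k \<Rightarrow> 'q \<Rightarrow> 'q tvec" where "V \<equiv> vert_field S \<xi>"
abbreviation K :: "'m \<Rightarrow> 'k \<Rightarrow> 'q \<Rightarrow> real" where "K \<equiv> K_coeff S \<xi> c"
abbreviation Z :: "'m + 'k \<Rightarrow> 'q \<Rightarrow> 'q tvec" where "Z \<equiv> frame S \<xi> c"
abbreviation H :: "'m \<Rightarrow> 'm \<Rightarrow> 'q \<Rightarrow> real" where "H \<equiv> G_hh S c"
abbreviation HV :: "'m \<Rightarrow> 'k \<Rightarrow> 'q \<Rightarrow> real" where "HV \<equiv> G_hv S \<xi> c"

lemma open_dom: "open dom"
  using open_proj_vimage B.charts_is_chart[OF chart] by (simp add: is_chart_def)

lemma crd_smooth: "q \<in> dom \<Longrightarrow> smooth_near (atlQ S) (crd a) q"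
  using proj_pullback[OF B.smooth_near_coord_vec[OF chart]] by simp

lemma coord_field_tspace: "x \<in> fst c \<Longrightarrow> coord_field S c a x \<in> tspace (atlB S) x"
  unfolding coord_field_def by (rule B.dirderiv_in_tspace[OF chart])

lemma coord_field_coord: "x \<in> fst c \<Longrightarrow> coord_field S c a x (\<lambda>y. snd c y $ b) = delta a b"
  unfolding coord_field_def by (rule B.dirderiv_axis_coord[OF chart])

lemma X_distr_push: "q \<in> dom \<Longrightarrow> X a q \<in> distr S q \<and> push q (X a q) = coord_field S c a (proj S q)"
  unfolding hor_field_def by (rule theI'[OF distr_lift]) (simp add: coord_field_tspace)

lemma X_distr: "q \<in> dom \<Longrightarrow> X a q \<in> distr S q"
  and X_push: "q \<in> dom \<Longrightarrow> push q (X a q) = coord_field S c a (proj S q)"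
  using X_distr_push by blast+

lemma X_tspace: "q \<in> dom \<Longrightarrow> X a q \<in> tspace (atlQ S) q"
  using X_distr distr_tspace by blast

lemma X_pullback:
  assumes "q \<in> dom" "smooth_near (atlB S) h (proj S q)"
  shows "X a q (\<lambda>p. h (proj S p)) = coord_field S c a (proj S q) h"
  using push_apply[OF assms(2), of "X a q"] X_push[OF assms(1)] by simp

text \<open>Together with \<open>V_crd\<close> this makes the pulled back coordinates dual to the
  X_a: they read off horizontal coefficients and annihilate vertical vectors.\<close>

lemma X_crd: "q \<in> dom \<Longrightarrow> X a q (crd b) = delta a b"
  using X_pullback[OF _ B.smooth_near_coord_vec[OF chart]] coord_field_coord by simp

lemma V_pullback: "smooth_near (atlB S) h (proj S q) \<Longrightarrow> V i q (\<lambda>p. h (proj S p)) = 0"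
  using vert_field_vertical vertical_iff by blast

lemma V_crd: "q \<in> dom \<Longrightarrow> V i q (crd b) = 0"
  using V_pullback[OF B.smooth_near_coord_vec[OF chart]] by simp

lemma push_eqI:
  assumes "q \<in> dom" "u \<in> tspace (atlQ S) q" "v \<in> tspace (atlQ S) q" "\<And>a. u (crd a) = v (crd a)"
  shows "push q u = push q v"
  by (rule B.tvec_eqI_vec[OF push_in_tspace push_in_tspace chart])
    (use assms in \<open>simp_all add: push_apply B.smooth_near_coord_vec[OF chart]\<close>)

lemma vertical_crd_iff:
  assumes "q \<in> dom"
  shows "u \<in> vertical S q \<longleftrightarrow> u \<in> tspace (atlQ S) q \<and> (\<forall>a. u (crd a) = 0)"
proof -
  have "push q (\<lambda>_. 0) = (\<lambda>_. 0)" by (simp add: tangent_map_def fun_eq_iff)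
  then have "push q u = (\<lambda>_. 0)" if "u \<in> tspace (atlQ S) q" "\<forall>a. u (crd a) = 0"
    using push_eqI[OF assms that(1) Q.tspace_zero] that(2) by simp
  moreover have "u (crd a) = 0" if "push q u = (\<lambda>_. 0)" for a
    using push_apply[OF B.smooth_near_coord_vec[OF chart], of q u a] that assms by simp
  ultimately show ?thesis unfolding vertical_def by blast
qed

lemma lincomb_X_crd: "q \<in> dom \<Longrightarrow> lincomb (\<lambda>a. X a q) r (crd b) = r b"
  by (simp add: lincomb_def X_crd sum_delta)

lemma lincomb_X_distr: "q \<in> dom \<Longrightarrow> lincomb (\<lambda>a. X a q) r \<in> distr S q"
  by (rule distr_lincomb[OF X_distr])

text \<open>The action preserves the distribution and covers the identity of the quotient, so the
  transported vector is again the horizontal lift of the same coordinate vector.\<close>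

lemma X_act:
  assumes "q \<in> dom"
  shows "tangent_map (atlQ S) (act S h) q (X a q) = X a (act S h q)"
proof (rule distr_eqI)
  show "tangent_map (atlQ S) (act S h) q (X a q) \<in> distr S (act S h q)"
    using distr_act[of h q] X_distr[OF assms] by blast
qed (use assms in \<open>simp_all add: X_distr push_act X_push\<close>)

text \<open>A pointwise description carries no smoothness; it is imported from a smooth local frame
  Y of the distribution. Since X_a(q^d) = delta, the coefficients of the X_a in this frame form the
  inverse of the matrix of the functions Y_b(q^a).\<close>

lemma X_smooth:
  assumes q: "q \<in> dom" and f: "smooth_near (atlQ S) f q"
  shows "smooth_near (atlQ S) (\<lambda>p. X a p f) q"
proof -
  obtain U and Y :: "'m \<Rightarrow> 'q \<Rightarrow> 'q tvec" where U: "open U" "q \<in> U"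
    and Y: "\<And>a. vector_field (atlQ S) U (Y a)" "\<And>p. p \<in> U \<Longrightarrow> is_basis (distr S p) (\<lambda>a. Y a p)"
    using distr_frame[of q] by blast
  define M :: "'q \<Rightarrow> real^'m^'m" where "M p = (\<chi> b a. Y b p (crd a))" for p
  have inv: "invertible (M p) \<and> X a p = lincomb (\<lambda>b. Y b p) (\<lambda>b. matrix_inv (M p) $ a $ b)"
    if p: "p \<in> U \<inter> dom" for p a
  proof -
    have "\<forall>a. \<exists>r. X a p = lincomb (\<lambda>b. Y b p) r" using is_basisD(3)[OF Y(2)] X_distr p by blast
    then obtain P where P: "\<And>a. X a p = lincomb (\<lambda>b. Y b p) (P a)" by metis
    have "(\<chi> a b. P a b) ** M p = mat 1"
    proof -
      have "(\<Sum>b\<in>UNIV. P a b * Y b p (crd d)) = delta a d" for a d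
        using X_crd[of p a d] p P[of a] by (simp add: lincomb_def)
      then show ?thesis
        by (simp add: matrix_matrix_mult_def mat_def M_def vec_eq_iff delta_def)
    qed
    from matrix_inv_eq_left_inverse[OF this] show ?thesis using P[of a] by simp
  qed
  have "smooth_near (atlQ S) (\<lambda>p. \<Sum>b\<in>UNIV. matrix_inv (M p) $ a $ b * Y b p f) q"
  proof (intro Q.smooth_near_sum Q.smooth_near_mult Q.smooth_near_matrix_inv)
    show "smooth_near (atlQ S) (\<lambda>p. M p $ i $ j) q" for i j
      using Q.vector_field_smooth_near[OF Y(1) U crd_smooth[OF q]] by (simp add: M_def)
    show "smooth_near (atlQ S) (\<lambda>p. Y b p f) q" for b
      by (rule Q.vector_field_smooth_near[OF Y(1) U f])
  qed (use inv U q in blast)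
  then show ?thesis
  proof (rule Q.smooth_near_cong_ev)
    show "eventually (\<lambda>p. (\<Sum>b\<in>UNIV. matrix_inv (M p) $ a $ b * Y b p f) = X a p f) (nhds q)"
    proof -
      have "eventually (\<lambda>p. p \<in> U \<inter> dom) (nhds q)"
        by (rule eventually_nhds_in_open) (use U open_dom q in auto)
      then show ?thesis by eventually_elim (use inv in \<open>simp add: lincomb_def\<close>)
    qed
  qed
qed

lemma X_vector_field: "vector_field (atlQ S) dom (X a)"
  by (rule Q.vector_fieldI[OF X_tspace X_smooth])

lemma H_smooth: "q \<in> dom \<Longrightarrow> smooth_near (atlQ S) (H a b) q"
  unfolding G_hh_def by (rule metric_smooth[OF open_dom X_vector_field X_vector_field])

lemma HV_smooth: "q \<in> dom \<Longrightarrow> smooth_near (atlQ S) (HV a i) q"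
  unfolding G_hv_def by (rule metric_smooth[OF open_dom X_vector_field vert_field_vector_field])

lemma H_sym: "q \<in> dom \<Longrightarrow> H a b q = H b a q"
  unfolding G_hh_def by (rule metric_sym[OF X_tspace X_tspace])

text \<open>A kernel vector x gives a horizontal vector u = x^a X_a that is orthogonal to all X_a,
  hence to itself. Positivity makes u zero, and its base coordinates are the entries of x.\<close>

lemma H_invertible:
  assumes q: "q \<in> dom"
  shows "invertible (\<chi> a b. H a b q)"
proof -
  have "x = 0" if x: "(\<chi> a b. H a b q) *v x = 0" for x :: "real^'m"
  proof -
    define u where "u = lincomb (\<lambda>a. X a q) (\<lambda>a. x $ a)"
    have u: "u \<in> tspace (atlQ S) q" unfolding u_def by (rule Q.tspace_lincomb[OF X_tspace[OF q]])
    have "(\<Sum>b\<in>UNIV. H a b q * x $ b) = 0" for a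
      using x by (simp add: matrix_vector_mult_def vec_eq_iff)
    then have "gmetric S q (X a q) u = 0" for a
      unfolding u_def
      by (subst metric_lincomb_right) (simp_all add: X_tspace[OF q] G_hh_def mult.commute)
    then have "gmetric S q u u = 0"
      using metric_lincomb_left[of "\<lambda>a. X a q" q u "\<lambda>a. x $ a", OF X_tspace[OF q] u]
      by (simp add: u_def[symmetric])
    then have "u = (\<lambda>_. 0)" using metric_pos[OF u] by force
    then have "x $ a = 0" for a
      using lincomb_X_crd[OF q, of "\<lambda>a. x $ a" a] unfolding u_def[symmetric] by simp
    then show ?thesis by (simp add: vec_eq_iff)
  qed
  then obtain N where "N ** (\<chi> a b. H a b q) = mat 1"
    using matrix_left_invertible_ker by blast
  then show ?thesis by (rule matrix_inv_eq_left_inverse)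
qed

text \<open>Multiplying by G_ab undoes the inverse in \<open>K_coeff\<close>, whose index order is
  made up for by the symmetry of G_ab. The identity is the exchange rule for all later
  contractions.\<close>

lemma H_K:
  assumes q: "q \<in> dom"
  shows "(\<Sum>b\<in>UNIV. H a b q * K b i q) = - HV a i q"
proof -
  have inv: "(\<Sum>b\<in>UNIV. G_inv S c d b q * H b a q) = delta d a" for d
    using matrix_inv_cancel(2)[OF H_invertible[OF q]]
    by (simp add: matrix_matrix_mult_def mat_def vec_eq_iff delta_def G_inv_def)
  have "(\<Sum>b\<in>UNIV. H a b q * K b i q) = - (\<Sum>b\<in>UNIV. \<Sum>d\<in>UNIV. G_inv S c d b q * H b a q * HV d i q)"
    by (simp add: K_coeff_def sum_distrib_left sum_negf H_sym[OF q, of a] mult_ac)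
  also have "\<dots> = - (\<Sum>d\<in>UNIV. (\<Sum>b\<in>UNIV. G_inv S c d b q * H b a q) * HV d i q)"
    by (subst sum.swap) (simp add: sum_distrib_right)
  also have "\<dots> = - HV a i q" by (simp add: inv sum_delta)
  finally show ?thesis .
qed

lemma K_smooth:
  assumes q: "q \<in> dom"
  shows "smooth_near (atlQ S) (K b i) q"
proof -
  have "smooth_near (atlQ S) (\<lambda>p. matrix_inv (\<chi> a b. H a b p) $ a $ b) q" for a
    by (rule Q.smooth_near_matrix_inv) (simp_all add: H_smooth[OF q] H_invertible[OF q])
  then show ?thesis
    unfolding K_coeff_def G_inv_def
    by (intro Q.smooth_near_minus Q.smooth_near_sum Q.smooth_near_mult HV_smooth[OF q])
qed

lemma frame_Inl [simp]: "Z (Inl a) = X a"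
  by (simp add: frame_def fun_eq_iff)

lemma frame_Inr: "Z (Inr i) q = (\<lambda>f. V i q f + (\<Sum>b\<in>UNIV. K b i q * X b q f))"
  by (simp add: frame_def)

lemma frame_Inr_tspace: "q \<in> dom \<Longrightarrow> Z (Inr i) q \<in> tspace (atlQ S) q"
  unfolding frame_Inr by (intro Q.tspace_add vert_field_tspace Q.tspace_sum X_tspace)

lemma frame_vector_field: "vector_field (atlQ S) dom (Z \<alpha>)"
proof (cases \<alpha>)
  case (Inr i)
  show ?thesis
    unfolding Inr
    by (rule Q.vector_fieldI[OF frame_Inr_tspace], assumption)
      (simp add: frame_Inr Q.smooth_near_add Q.smooth_near_sum Q.smooth_near_mult vert_field_smooth K_smooth X_smooth)
qed (simp add: X_vector_field)

lemma frame_tspace: "q \<in> dom \<Longrightarrow> Z \<alpha> q \<in> tspace (atlQ S) q"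
  by (rule vector_field_tspace[OF frame_vector_field])

lemma sum_UNIV_Plus: "(\<Sum>\<alpha>\<in>(UNIV :: ('m + 'k) set). f \<alpha>) = (\<Sum>a\<in>UNIV. f (Inl a)) + (\<Sum>i\<in>UNIV. f (Inr i))"
  unfolding UNIV_Plus_UNIV[symmetric] by (subst sum.Plus) simp_all

text \<open>Passing to the X_a and V_i is a triangular change of frame, and there the coefficients
  are accessible: \<open>X_V_unique\<close> separates them.\<close>

lemma lincomb_frame:
  "lincomb (\<lambda>\<alpha>. Z \<alpha> q) r f =
    (\<Sum>a\<in>UNIV. (r (Inl a) + (\<Sum>i\<in>UNIV. K a i q * r (Inr i))) * X a q f) + (\<Sum>i\<in>UNIV. r (Inr i) * V i q f)"
proof -
  have "(\<Sum>i\<in>UNIV. r (Inr i) * (\<Sum>b\<in>UNIV. K b i q * X b q f)) =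
      (\<Sum>b\<in>UNIV. \<Sum>i\<in>UNIV. K b i q * r (Inr i) * X b q f)"
    by (subst sum.swap) (simp add: sum_distrib_left mult_ac)
  then show ?thesis
    by (simp add: lincomb_def sum_UNIV_Plus frame_Inr distrib_left distrib_right sum.distrib sum_distrib_right)
qed

text \<open>Subtracting the horizontal vector with the same base coordinates leaves a vertical one,
  which the generators span.\<close>

lemma tvec_X_V:
  assumes q: "q \<in> dom" and u: "u \<in> tspace (atlQ S) q"
  obtains s where "u = (\<lambda>f. (\<Sum>a\<in>UNIV. u (crd a) * X a q f) + (\<Sum>i\<in>UNIV. s i * V i q f))"
proof -
  have "(\<lambda>f. u f - (\<Sum>a\<in>UNIV. u (crd a) * X a q f)) \<in> vertical S q"
    unfolding vertical_crd_iff[OF q]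
    by (simp add: Q.tspace_diff[OF u] Q.tspace_sum X_tspace[OF q] X_crd[OF q] sum_delta)
  then obtain s where s: "(\<lambda>f. u f - (\<Sum>a\<in>UNIV. u (crd a) * X a q f)) = lincomb (\<lambda>i. V i q) s"
    using is_basisD(3)[OF vert_basis] by blast
  have "u f = (\<Sum>a\<in>UNIV. u (crd a) * X a q f) + (\<Sum>i\<in>UNIV. s i * V i q f)" for f
    using fun_cong[OF s, of f] by (simp add: lincomb_def)
  then show thesis using that by blast
qed

lemma X_V_unique:
  assumes q: "q \<in> dom"
    and eq: "\<And>f. (\<Sum>a\<in>UNIV. p a * X a q f) + (\<Sum>i\<in>UNIV. s i * V i q f) =
      (\<Sum>a\<in>UNIV. p' a * X a q f) + (\<Sum>i\<in>UNIV. s' i * V i q f)"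
  shows "p = p'" "s = s'"
proof -
  show p: "p = p'"
    using eq[of "crd _"] by (simp add: X_crd[OF q] V_crd[OF q] sum_delta fun_eq_iff)
  show "s = s'"
    by (rule is_basisD(4)[OF vert_basis[of q]]) (use eq in \<open>simp add: p lincomb_def fun_eq_iff\<close>)
qed

lemma frame_basis:
  assumes q: "q \<in> dom"
  shows "is_basis (tspace (atlQ S) q) (\<lambda>\<alpha>. Z \<alpha> q)"
proof (rule is_basisI)
  fix r s assume eq: "lincomb (\<lambda>\<alpha>. Z \<alpha> q) r = lincomb (\<lambda>\<alpha>. Z \<alpha> q) s"
  note * = X_V_unique[OF q, OF fun_cong[OF eq, unfolded lincomb_frame]]
  show "r = s"
  proof
    fix \<alpha> show "r \<alpha> = s \<alpha>"
      using fun_cong[OF *(1)] fun_cong[OF *(2)] by (cases \<alpha>) simp_all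
  qed
next
  fix u assume "u \<in> tspace (atlQ S) q"
  then obtain s where s: "u = (\<lambda>f. (\<Sum>a\<in>UNIV. u (crd a) * X a q f) + (\<Sum>i\<in>UNIV. s i * V i q f))"
    using tvec_X_V[OF q] by blast
  define r where "r \<alpha> = (case \<alpha> of Inl a \<Rightarrow> u (crd a) - (\<Sum>i\<in>UNIV. K a i q * s i) | Inr i \<Rightarrow> s i)" for \<alpha>
  have "u f = lincomb (\<lambda>\<alpha>. Z \<alpha> q) r f" for f
    using fun_cong[OF s, of f] by (simp add: lincomb_frame r_def)
  then show "\<exists>r. u = lincomb (\<lambda>\<alpha>. Z \<alpha> q) r" by blast
qed (rule Q.tspace_lincomb[OF frame_tspace[OF q]])

text \<open>V_i = X_i - K^a_i X_a: vertical coefficients survive unchanged and enter the horizontal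
  ones with a minus sign.\<close>

lemma frame_component:
  assumes q: "q \<in> dom"
    and u: "\<And>f. u f = (\<Sum>a\<in>UNIV. p a * X a q f) + (\<Sum>i\<in>UNIV. s i * V i q f)"
  shows "component (\<lambda>\<alpha>. Z \<alpha> q) u (Inl a) = p a - (\<Sum>i\<in>UNIV. K a i q * s i)"
    and "component (\<lambda>\<alpha>. Z \<alpha> q) u (Inr i) = s i"
proof -
  define r where "r \<alpha> = (case \<alpha> of Inl a \<Rightarrow> p a - (\<Sum>i\<in>UNIV. K a i q * s i) | Inr i \<Rightarrow> s i)" for \<alpha>
  have "u = lincomb (\<lambda>\<alpha>. Z \<alpha> q) r"
    by (rule ext) (simp add: u lincomb_frame r_def)
  then have "component (\<lambda>\<alpha>. Z \<alpha> q) u = r" using is_basisD(5)[OF frame_basis[OF q]] by simp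
  then show "component (\<lambda>\<alpha>. Z \<alpha> q) u (Inl a) = p a - (\<Sum>i\<in>UNIV. K a i q * s i)"
    "component (\<lambda>\<alpha>. Z \<alpha> q) u (Inr i) = s i" by (simp_all add: r_def)
qed

lemma metric_frame_Inr:
  assumes q: "q \<in> dom" and u: "u \<in> tspace (atlQ S) q"
  shows "gmetric S q u (Z (Inr i) q) = gmetric S q u (V i q) + (\<Sum>b\<in>UNIV. K b i q * gmetric S q u (X b q))"
proof -
  have s: "(\<lambda>f. \<Sum>b\<in>UNIV. K b i q * X b q f) \<in> tspace (atlQ S) q"
    by (rule Q.tspace_sum[OF X_tspace[OF q]])
  have "gmetric S q u (Z (Inr i) q) = gmetric S q (\<lambda>f. 1 * V i q f + 1 * (\<Sum>b\<in>UNIV. K b i q * X b q f)) u"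
    using metric_sym[OF u frame_Inr_tspace[OF q]] by (simp add: frame_Inr)
  also have "\<dots> = gmetric S q (V i q) u + (\<Sum>b\<in>UNIV. K b i q * gmetric S q (X b q) u)"
    unfolding metric_combination[OF vert_field_tspace s u] metric_sum_left[OF X_tspace[OF q] u] by simp
  finally show ?thesis
    by (simp add: metric_sym[OF u vert_field_tspace] metric_sym[OF u X_tspace[OF q]])
qed

lemma metric_X_frame_Inr:
  assumes q: "q \<in> dom"
  shows "gmetric S q (X a q) (Z (Inr i) q) = 0"
  using metric_frame_Inr[OF q X_tspace[OF q], of a i] H_K[OF q, of a i]
  by (simp add: G_hh_def G_hv_def mult.commute)

end

section \<open>The horizontal part of the metric\<close>

context chaplygin
begin

text \<open>This is the projection onto the distribution along the vertical space. Describing it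
  through the image in the quotient gives the coordinate formula \<open>hor_chart\<close> at
  once.\<close>

definition hor :: "'q \<Rightarrow> 'q tvec \<Rightarrow> 'q tvec" where
  "hor q u = (THE v. v \<in> distr S q \<and> push q v = push q u)"

lemma hor_eqI: "v \<in> distr S q \<Longrightarrow> push q v = push q u \<Longrightarrow> hor q u = v"
  unfolding hor_def by (rule the_equality) (auto intro: distr_eqI)

text \<open>It vanishes as soon as one argument is vertical, hence is degenerate; a
  \<open>D_preserving_modification\<close> is merely a symmetric tensor, so this is allowed.\<close>

definition hor_metric :: "'q \<Rightarrow> 'q tvec \<Rightarrow> 'q tvec \<Rightarrow> real" where
  "hor_metric q u w = gmetric S q (hor q u) (hor q w)"

end

lemma (in chaplygin_chart) hor_chart:
  assumes q: "q \<in> dom" and u: "u \<in> tspace (atlQ S) q"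
  shows "hor q u = lincomb (\<lambda>a. X a q) (\<lambda>a. u (crd a))"
  by (rule hor_eqI[OF lincomb_X_distr[OF q]], rule push_eqI[OF q])
    (use q u lincomb_X_distr distr_tspace in \<open>auto simp: lincomb_X_crd\<close>)

context chaplygin
begin

lemma chart_interpretation:
  obtains c where "chaplygin_chart S \<xi> c" "proj S q \<in> fst c"
proof -
  obtain c where "c \<in> charts (atlB S)" "proj S q \<in> fst c" using B.chart_cover .
  then show thesis
    using that[of c] chaplygin_axioms unfolding chaplygin_chart_def chaplygin_chart_axioms_def by blast
qed

lemma hor_distr:
  assumes "u \<in> tspace (atlQ S) q"
  shows "hor q u \<in> distr S q"
proof -
  obtain c where c: "chaplygin_chart S \<xi> c" "proj S q \<in> fst c" by (rule chart_interpretation)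
  interpret chaplygin_chart S \<xi> c by fact
  show ?thesis using hor_chart[OF _ assms] lincomb_X_distr c(2) by simp
qed

lemma hor_tspace: "u \<in> tspace (atlQ S) q \<Longrightarrow> hor q u \<in> tspace (atlQ S) q"
  using hor_distr distr_tspace by blast

lemma hor_combination:
  assumes "u \<in> tspace (atlQ S) q" "v \<in> tspace (atlQ S) q"
  shows "hor q (\<lambda>f. s * u f + t * v f) = (\<lambda>f. s * hor q u f + t * hor q v f)"
proof -
  obtain c where c: "chaplygin_chart S \<xi> c" "proj S q \<in> fst c" by (rule chart_interpretation)
  interpret chaplygin_chart S \<xi> c by fact
  show ?thesis
    using c(2) assms Q.tspace_combination[OF assms, of s t]
    by (simp add: hor_chart lincomb_def sum_distrib_left sum.distrib algebra_simps)
qed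

lemma hor_vector_field:
  assumes U: "open U" and Y: "vector_field (atlQ S) U Y"
  shows "vector_field (atlQ S) U (\<lambda>p. hor p (Y p))"
proof (rule Q.vector_fieldI)
  show "hor q (Y q) \<in> tspace (atlQ S) q" if "q \<in> U" for q
    by (rule hor_tspace[OF vector_field_tspace[OF Y that]])
next
  fix q f assume q: "q \<in> U" and f: "smooth_near (atlQ S) f q"
  obtain c where c: "chaplygin_chart S \<xi> c" "proj S q \<in> fst c" by (rule chart_interpretation)
  interpret chaplygin_chart S \<xi> c by fact
  have qd: "q \<in> dom" using c(2) by simp
  have "smooth_near (atlQ S) (\<lambda>p. \<Sum>a\<in>UNIV. Y p (crd a) * X a p f) q"
    by (intro Q.smooth_near_sum Q.smooth_near_mult X_smooth[OF qd f]
        Q.vector_field_smooth_near[OF Y U q crd_smooth[OF qd]])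
  moreover have "eventually (\<lambda>p. p \<in> U \<inter> dom) (nhds q)"
    by (rule eventually_nhds_in_open) (use U open_dom q qd in auto)
  then have "eventually (\<lambda>p. (\<Sum>a\<in>UNIV. Y p (crd a) * X a p f) = hor p (Y p) f) (nhds q)"
  proof eventually_elim
    case (elim p)
    then show ?case using hor_chart[of p "Y p"] vector_field_tspace[OF Y, of p] by (simp add: lincomb_def)
  qed
  ultimately show "smooth_near (atlQ S) (\<lambda>p. hor p (Y p) f) q" by (rule Q.smooth_near_cong_ev)
qed

lemma hor_metric_symmetric_tensor: "symmetric_tensor (atlQ S) hor_metric"
  unfolding symmetric_tensor_def
proof (intro conjI allI ballI impI)
  fix q u w assume "u \<in> tspace (atlQ S) q" "w \<in> tspace (atlQ S) q"
  then show "hor_metric q u w = hor_metric q w u"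
    unfolding hor_metric_def by (intro metric_sym hor_tspace)
next
  fix q u v w s t assume "u \<in> tspace (atlQ S) q" "v \<in> tspace (atlQ S) q" "w \<in> tspace (atlQ S) q"
  then show "hor_metric q (\<lambda>f. s * u f + t * v f) w = s * hor_metric q u w + t * hor_metric q v w"
    unfolding hor_metric_def by (simp only: hor_combination metric_combination hor_tspace)
next
  fix U Y Y'
  assume *: "open U \<and> vector_field (atlQ S) U Y \<and> vector_field (atlQ S) U Y'"
  then have "\<forall>q\<in>U. smooth_near (atlQ S) (\<lambda>q. hor_metric q (Y q) (Y' q)) q"
    unfolding hor_metric_def by (intro ballI metric_smooth[of U] hor_vector_field) auto
  then show "smooth_fun (atlQ S) U (\<lambda>q. hor_metric q (Y q) (Y' q))"
    using Q.smooth_fun_iff * by blast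
qed

lemma orthogonal_components_hor_metric:
  "orthogonal_components S \<xi> (\<lambda>c a i q. - G_hv S \<xi> c a i q)"
  unfolding orthogonal_components_def D_preserving_modification_def
proof (intro exI[of _ hor_metric] conjI ballI allI impI)
  show "symmetric_tensor (atlQ S) hor_metric" by (rule hor_metric_symmetric_tensor)
next
  fix q u w assume "u \<in> distr S q" "w \<in> distr S q"
  then show "hor_metric q u w = gmetric S q u w" by (simp add: hor_metric_def hor_eqI)
next
  fix q u w assume u: "u \<in> vertical S q" and w: "w \<in> distr S q"
  have z: "(\<lambda>_. 0) \<in> distr S q" using distr_combination[OF w w, of 0 0] by simp
  have "push q (\<lambda>_. 0) = push q u" using u by (simp add: vertical_def) (simp add: tangent_map_def fun_eq_iff)
  then have "hor q u = (\<lambda>_. 0)" using hor_eqI z by blast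
  then show "hor_metric q u w = 0"
    using metric_combination[of w q w w 0 0] distr_tspace[OF w] hor_eqI[OF w] by (simp add: hor_metric_def)
next
  fix c q a i assume c: "c \<in> charts (atlB S)" and q': "proj S q \<in> fst c"
  interpret chaplygin_chart S \<xi> c using c by unfold_locales
  have q: "q \<in> dom" using q' by simp
  \<comment> \<open>The horizontal part of X_i is K^b_i X_b, so pairing it with X_a gives G_ab K^b_i
    = - G_ai.\<close>
  have "hor q (Z (Inr i) q) = lincomb (\<lambda>a. X a q) (\<lambda>a. K a i q)"
    unfolding hor_chart[OF q frame_tspace[OF q]]
    by (simp add: frame_Inr V_crd[OF q] X_crd[OF q] sum_delta)
  then have "hor_metric q (X a q) (Z (Inr i) q) = (\<Sum>b\<in>UNIV. K b i q * H a b q)"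
    using metric_lincomb_right[OF X_tspace[OF q] X_tspace[OF q]]
    by (simp add: hor_metric_def hor_eqI[OF X_distr[OF q]] G_hh_def)
  also have "\<dots> = - HV a i q" using H_K[OF q] by (simp add: mult.commute)
  finally show "- HV a i q = hor_metric q (Z (Inl a) q) (Z (Inr i) q)" by simp
qed

end

section \<open>Structure functions and the two conditions\<close>

lemma skew_sum_zero:
  fixes E :: "'i::finite \<Rightarrow> 'i \<Rightarrow> real"
  assumes "\<And>a b. E a b + E b a = 0"
  shows "(\<Sum>a\<in>UNIV. \<Sum>b\<in>UNIV. E a b * v a * v b) = 0"
proof -
  have "(\<Sum>a\<in>UNIV. \<Sum>b\<in>UNIV. E a b * v a * v b) = (\<Sum>a\<in>UNIV. \<Sum>b\<in>UNIV. E b a * v a * v b)"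
    by (subst sum.swap) (simp add: mult_ac)
  also have "\<dots> = - (\<Sum>a\<in>UNIV. \<Sum>b\<in>UNIV. E a b * v a * v b)"
    unfolding sum_negf[symmetric] using assms
    by (intro sum.cong refl) (metis add_eq_0_iff mult_minus_left)
  finally show ?thesis by simp
qed

locale chaplygin_levi = chaplygin_chart S \<xi> c
  for S :: "('q::{t2_space, second_countable_topology}, 'x::{t2_space, second_countable_topology},
      'g::{t2_space, second_countable_topology}, 'n::finite, 'm::finite, 'k::finite) chaplygin_data"
    and \<xi> :: "'k \<Rightarrow> 'g tvec" and c :: "('x, real^'m) chart" +
  fixes nabla :: "('q \<Rightarrow> 'q tvec) \<Rightarrow> ('q \<Rightarrow> 'q tvec) \<Rightarrow> 'q \<Rightarrow> 'q tvec"
  assumes levi: "levi_civita (atlQ S) (gmetric S) nabla"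
begin

abbreviation R :: "'m + 'k \<Rightarrow> 'm + 'k \<Rightarrow> 'm + 'k \<Rightarrow> 'q \<Rightarrow> real" where "R \<equiv> R_coeff S \<xi> c"
abbreviation \<Gamma> :: "'m + 'k \<Rightarrow> 'm \<Rightarrow> 'm \<Rightarrow> 'q \<Rightarrow> real" where "\<Gamma> \<equiv> Gamma_coeff S \<xi> nabla c"

lemma nabla_rules:
  assumes "vector_field (atlQ S) dom Y" "vector_field (atlQ S) dom Y'" "vector_field (atlQ S) dom Y''"
    and q: "q \<in> dom"
  shows "nabla Y Y' q \<in> tspace (atlQ S) q"
    and "(\<lambda>h. nabla Y Y' q h - nabla Y' Y q h) = bracket (atlQ S) Y Y' q"
    and "Y q (\<lambda>p. gmetric S p (Y' p) (Y'' p)) =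
      gmetric S q (nabla Y Y' q) (Y'' q) + gmetric S q (Y' q) (nabla Y Y'' q)"
proof -
  \<comment> \<open>To instantiate \<open>levi_civita\<close> a smooth function f has to be
    supplied; the zero function is at hand.\<close>
  have "smooth_fun (atlQ S) dom (\<lambda>_. 0)" using Q.smooth_fun_iff[OF open_dom] by simp
  then have prem: "open dom \<and> vector_field (atlQ S) dom Y \<and> vector_field (atlQ S) dom Y' \<and>
      vector_field (atlQ S) dom Y'' \<and> smooth_fun (atlQ S) dom (\<lambda>_. 0)"
    using assms open_dom by blast
  note * = levi[unfolded levi_civita_def, THEN spec[of _ dom], THEN spec[of _ Y], THEN spec[of _ Y'],
      THEN spec[of _ Y''], THEN spec[of _ "\<lambda>_. 0"], THEN mp, OF prem]
  show "nabla Y Y' q \<in> tspace (atlQ S) q"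
    by (rule vector_field_tspace[OF conjunct1[OF *] q])
  note ** = bspec[OF conjunct2[OF *] q]
  show "(\<lambda>h. nabla Y Y' q h - nabla Y' Y q h) = bracket (atlQ S) Y Y' q"
    by (rule **[THEN conjunct2, THEN conjunct2, THEN conjunct2, THEN conjunct2, THEN conjunct1])
  show "Y q (\<lambda>p. gmetric S p (Y' p) (Y'' p)) =
      gmetric S q (nabla Y Y' q) (Y'' q) + gmetric S q (Y' q) (nabla Y Y'' q)"
    by (rule **[THEN conjunct2, THEN conjunct2, THEN conjunct2, THEN conjunct2, THEN conjunct2])
qed

section \<open>Brackets of the frame fields\<close>

lemma bracket_tspace:
  assumes "vector_field (atlQ S) dom Y" "vector_field (atlQ S) dom Y'" and q: "q \<in> dom"
  shows "bracket (atlQ S) Y Y' q \<in> tspace (atlQ S) q"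
  using Q.tspace_diff[OF nabla_rules(1)[OF assms(1,2,2) q] nabla_rules(1)[OF assms(2,1,1) q]]
    nabla_rules(2)[OF assms(1,2,2) q] by simp

lemma bracket_apply: "smooth_near (atlQ S) f q \<Longrightarrow>
    bracket (atlQ S) Y Y' q f = Y q (\<lambda>p. Y' p f) - Y' q (\<lambda>p. Y p f)"
  by (simp add: bracket_def)

lemma eventually_dom: "q \<in> dom \<Longrightarrow> eventually (\<lambda>p. p \<in> dom) (nhds q)"
  by (rule eventually_nhds_in_open[OF open_dom])

lemma bracket_X:
  assumes q: "q \<in> dom"
  shows "bracket (atlQ S) (X a) (X b) q f = (\<Sum>i\<in>UNIV. R (Inr i) (Inl a) (Inl b) q * V i q f)"
    and "R (Inl d) (Inl a) (Inl b) q = - (\<Sum>i\<in>UNIV. K d i q * R (Inr i) (Inl a) (Inl b) q)"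
proof -
  define br where "br = bracket (atlQ S) (X a) (X b) q"
  \<comment> \<open>The inner function equals the constant delta only over the chart domain, so the
    comparison is one of germs.\<close>
  have "X a q (\<lambda>p. X b p (crd d)) = 0" for a b d
  proof -
    have "X a q (\<lambda>p. X b p (crd d)) = X a q (\<lambda>_. delta b d)"
      by (rule Q.tvec_cong_ev[OF X_tspace[OF q]], rule eventually_mono[OF eventually_dom[OF q]]) (rule X_crd)
    then show ?thesis by (simp add: Q.tvec_const[OF X_tspace[OF q]])
  qed
  then have "br (crd d) = 0" for d
    unfolding br_def by (simp add: bracket_apply[OF crd_smooth[OF q]])
  moreover have "br \<in> tspace (atlQ S) q"
    unfolding br_def by (rule bracket_tspace[OF X_vector_field X_vector_field q])
  ultimately obtain s where s: "br = (\<lambda>f. (\<Sum>a\<in>UNIV. 0 * X a q f) + (\<Sum>i\<in>UNIV. s i * V i q f))"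
    using tvec_X_V[OF q, of br] by (metis (no_types, lifting) sum.cong)
  have R: "R (Inr i) (Inl a) (Inl b) q = s i"
    "R (Inl d) (Inl a) (Inl b) q = 0 - (\<Sum>i\<in>UNIV. K d i q * s i)" for i d
    unfolding R_coeff_def frame_Inl br_def[symmetric] by (rule frame_component[OF q fun_cong[OF s]])+
  show "bracket (atlQ S) (X a) (X b) q f = (\<Sum>i\<in>UNIV. R (Inr i) (Inl a) (Inl b) q * V i q f)"
    using fun_cong[OF s, of f] by (simp add: R br_def[symmetric])
  show "R (Inl d) (Inl a) (Inl b) q = - (\<Sum>i\<in>UNIV. K d i q * R (Inr i) (Inl a) (Inl b) q)"
    by (simp add: R)
qed

text \<open>By invariance, X_a at h q applied to f is X_a at q applied to f(h p) as a function of p.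
  Thus V_i differentiates in h and X_a in p, for a single function on G x Q, and the two derivatives
  commute.\<close>

lemma V_X_commute:
  assumes q: "q \<in> dom" and f: "smooth_near (atlQ S) f q"
  shows "V i q (\<lambda>p. X a p f) = X a q (\<lambda>p. V i p f)"
proof -
  have "V i q (\<lambda>p. X a p f) = \<xi> i (\<lambda>h. X a (act S h q) f)"
    by (rule vert_field_apply[OF X_smooth[OF q f]])
  also have "\<dots> = \<xi> i (\<lambda>h. X a q (\<lambda>p. f (act S h p)))"
  proof (rule G.tvec_cong_ev[OF lie_tspace])
    show "eventually (\<lambda>h. X a (act S h q) f = X a q (\<lambda>p. f (act S h p))) (nhds (gone S))"
      using act_eventually[OF f]
    proof eventually_elim
      case (elim h)
      then show ?case using tangent_map_apply[of "atlQ S" f "act S h" q "X a q"] X_act[OF q] by simp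
    qed
  qed
  also have "\<dots> = X a q (\<lambda>p. \<xi> i (\<lambda>h. f (act S h p)))"
    using GQQ.partial_derivatives(2)[OF act_smooth open_UNIV _ lie_tspace X_tspace[OF q], of f] f by simp
  also have "\<dots> = X a q (\<lambda>p. V i p f)"
    by (rule Q.tvec_cong_ev[OF X_tspace[OF q]], rule eventually_mono[OF Q.smooth_near_eventually[OF f]])
      (simp add: vert_field_apply)
  finally show ?thesis .
qed

lemma bracket_V_X:
  assumes q: "q \<in> dom"
  shows "bracket (atlQ S) (X a) (V i) q = (\<lambda>_. 0)"
proof
  fix f
  show "bracket (atlQ S) (X a) (V i) q f = 0"
    using V_X_commute[OF q, of f i a] by (cases "smooth_near (atlQ S) f q") (simp_all add: bracket_def)
qed

text \<open>Differentiating the functions K^b_i only produces multiples of X_b, which do not reach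
  the vertical component. As V_i commutes with X_a, what remains is K^b_i [X_b, X_a].\<close>

lemma R_mixed:
  assumes q: "q \<in> dom"
  shows "R (Inr k) (Inr i) (Inl a) q = (\<Sum>b\<in>UNIV. K b i q * R (Inr k) (Inl b) (Inl a) q)"
proof -
  have "bracket (atlQ S) (Z (Inr i)) (Z (Inl a)) q f =
      (\<Sum>b\<in>UNIV. - X a q (K b i) * X b q f) +
      (\<Sum>k\<in>UNIV. (\<Sum>b\<in>UNIV. K b i q * R (Inr k) (Inl b) (Inl a) q) * V k q f)" for f
  proof (cases "smooth_near (atlQ S) f q")
    case True
    note Xf = X_smooth[OF q True]
    have KX: "smooth_near (atlQ S) (\<lambda>p. K b i p * X b p f) q" for b
      by (rule Q.smooth_near_mult[OF K_smooth[OF q] Xf])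
    have "X a q (\<lambda>p. Z (Inr i) p f) = X a q (\<lambda>p. V i p f) +
        (\<Sum>b\<in>UNIV. K b i q * X a q (\<lambda>p. X b p f) + X a q (K b i) * X b q f)"
      unfolding frame_Inr
        Q.tvec_add[OF X_tspace[OF q] vert_field_smooth[OF True] Q.smooth_near_sum[OF KX]]
        Q.tvec_sum[OF X_tspace[OF q] KX] Q.tvec_mult[OF X_tspace[OF q] K_smooth[OF q] Xf] ..
    moreover have "Z (Inr i) q (\<lambda>p. X a p f) = X a q (\<lambda>p. V i p f) + (\<Sum>b\<in>UNIV. K b i q * X b q (\<lambda>p. X a p f))"
      by (simp add: frame_Inr V_X_commute[OF q True])
    ultimately have "bracket (atlQ S) (Z (Inr i)) (Z (Inl a)) q f =
        (\<Sum>b\<in>UNIV. - X a q (K b i) * X b q f) + (\<Sum>b\<in>UNIV. K b i q * bracket (atlQ S) (X b) (X a) q f)"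
      by (simp add: bracket_apply[OF True] sum_subtractf sum.distrib sum_negf right_diff_distrib)
    also have "(\<Sum>b\<in>UNIV. K b i q * bracket (atlQ S) (X b) (X a) q f) =
        (\<Sum>k\<in>UNIV. (\<Sum>b\<in>UNIV. K b i q * R (Inr k) (Inl b) (Inl a) q) * V k q f)"
      unfolding bracket_X(1)[OF q] sum_distrib_left sum_distrib_right
      by (subst sum.swap) (simp add: mult.assoc)
    finally show ?thesis .
  next
    \<comment> \<open>Equality of tangent vectors is equality on all functions; at a germ that is
      not smooth both sides are 0 by convention.\<close>
    case False
    then show ?thesis
      by (simp add: bracket_def Q.tvec_not_smooth[OF X_tspace[OF q]] Q.tvec_not_smooth[OF vert_field_tspace])
  qed
  from frame_component(2)[OF q this] show ?thesis unfolding R_coeff_def by simp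
qed

section \<open>Connection coefficients and multipliers\<close>

lemma nabla_X_frame:
  assumes q: "q \<in> dom"
  shows "nabla (X a) (X b) q = lincomb (\<lambda>\<alpha>. Z \<alpha> q) (\<lambda>\<gamma>. \<Gamma> \<gamma> a b q)"
proof -
  have "nabla (X a) (X b) q \<in> tspace (atlQ S) q"
    by (rule nabla_rules(1)[OF X_vector_field X_vector_field X_vector_field q])
  then obtain r where r: "nabla (X a) (X b) q = lincomb (\<lambda>\<alpha>. Z \<alpha> q) r"
    using is_basisD(3)[OF frame_basis[OF q]] by blast
  have "(\<lambda>\<gamma>. \<Gamma> \<gamma> a b q) = r"
    unfolding Gamma_coeff_def frame_Inl r is_basisD(5)[OF frame_basis[OF q]] ..
  then show ?thesis using r by simp
qed

text \<open>As X_i is orthogonal to the X_a, the sum over k is the pairing of nabla_{X_a} X_b with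
  X_i. Expanding X_i = V_i + K^d_i X_d and using \<open>H_K\<close> removes g_ij and K from the
  expression.\<close>

lemma multiplier_coeff:
  assumes q: "q \<in> dom"
  shows "(\<Sum>k\<in>UNIV. g_coeff S \<xi> c (Inr k) (Inr i) q * \<Gamma> (Inr k) a b q) =
    gmetric S q (nabla (X a) (X b) q) (V i q) - (\<Sum>d\<in>UNIV. \<Gamma> (Inl d) a b q * HV d i q)"
proof -
  define n where "n = nabla (X a) (X b) q"
  have n: "n \<in> tspace (atlQ S) q"
    unfolding n_def by (rule nabla_rules(1)[OF X_vector_field X_vector_field X_vector_field q])
  have exp: "gmetric S q n u = (\<Sum>\<alpha>\<in>UNIV. \<Gamma> \<alpha> a b q * gmetric S q (Z \<alpha> q) u)"
    if "u \<in> tspace (atlQ S) q" for u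
    unfolding n_def nabla_X_frame[OF q] by (rule metric_lincomb_left[OF frame_tspace[OF q] that])
  have "gmetric S q (Z (Inr k) q) (X d q) = 0" for k d
    using metric_X_frame_Inr[OF q] metric_sym[OF frame_tspace[OF q] X_tspace[OF q]] by simp
  then have X: "gmetric S q n (X d q) = (\<Sum>e\<in>UNIV. \<Gamma> (Inl e) a b q * H e d q)" for d
    unfolding exp[OF X_tspace[OF q]] sum_UNIV_Plus by (simp add: G_hh_def)
  have "(\<Sum>k\<in>UNIV. g_coeff S \<xi> c (Inr k) (Inr i) q * \<Gamma> (Inr k) a b q) = gmetric S q n (Z (Inr i) q)"
    unfolding exp[OF frame_tspace[OF q]] sum_UNIV_Plus
    by (simp add: metric_X_frame_Inr[OF q] g_coeff_def mult.commute)
  also have "\<dots> = gmetric S q n (V i q) +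
      (\<Sum>d\<in>UNIV. K d i q * (\<Sum>e\<in>UNIV. \<Gamma> (Inl e) a b q * H e d q))"
    unfolding metric_frame_Inr[OF q n] X ..
  also have "(\<Sum>d\<in>UNIV. K d i q * (\<Sum>e\<in>UNIV. \<Gamma> (Inl e) a b q * H e d q)) =
      (\<Sum>e\<in>UNIV. \<Gamma> (Inl e) a b q * (\<Sum>d\<in>UNIV. H e d q * K d i q))"
    unfolding sum_distrib_left by (subst sum.swap) (simp add: mult_ac)
  finally show ?thesis unfolding H_K[OF q] n_def by (simp add: sum_negf)
qed

text \<open>Invariance makes the \<open>V\<^sub>i\<close> Killing fields, so the second summand is skew in \<open>a\<close>, \<open>b\<close>.\<close>

lemma X_HV:
  assumes q: "q \<in> dom"
  obtains E where "\<And>a b. X a q (HV b i) = gmetric S q (nabla (X a) (X b) q) (V i q) + E a b"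
    and "\<And>a b. E a b + E b a = 0"
proof -
  define E where "E a b = gmetric S q (X b q) (nabla (X a) (V i) q)" for a b
  note Vf = vert_field_vector_field[of dom i]
  \<comment> \<open>Zero torsion and [X_a, V_i] = 0 exchange the two fields, so that E a b + E b a
    becomes the metric expansion of V_i(G_ab).\<close>
  have swap: "nabla (X a) (V i) q = nabla (V i) (X a) q" for a
    using nabla_rules(2)[OF X_vector_field Vf Vf q] bracket_V_X[OF q] by (simp add: fun_eq_iff)
  have "H a b (act S h q) = H a b q" for a b h
  proof -
    have "invariant_metric S" using system by (simp add: chaplygin_system_def)
    then show ?thesis
      unfolding G_hh_def X_act[OF q, symmetric] invariant_metric_def
      using X_tspace[OF q] by blast
  qed
  then have VH: "V i q (H a b) = 0" for a b
    by (simp add: vert_field_apply[OF H_smooth[OF q]] G.tvec_const[OF lie_tspace])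
  have "E a b + E b a = 0" for a b
  proof -
    have "V i q (H a b) = gmetric S q (nabla (V i) (X a) q) (X b q) + gmetric S q (X a q) (nabla (V i) (X b) q)"
      using nabla_rules(3)[OF Vf X_vector_field X_vector_field q] unfolding G_hh_def .
    moreover have "gmetric S q (nabla (V i) (X a) q) (X b q) = gmetric S q (X b q) (nabla (V i) (X a) q)"
      by (rule metric_sym[OF nabla_rules(1)[OF Vf X_vector_field X_vector_field q] X_tspace[OF q]])
    ultimately show ?thesis using VH by (simp add: E_def swap)
  qed
  moreover have "X a q (HV b i) = gmetric S q (nabla (X a) (X b) q) (V i q) + E a b" for a b
    using nabla_rules(3)[OF X_vector_field X_vector_field Vf q] unfolding G_hv_def E_def .
  ultimately show thesis using that by blast
qed

text \<open>The terms Gamma^d_ab G_di from the velocity derivative of theta cancel those in the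
  multiplier. What remains is g(nabla_{X_a} X_b, V_i) - X_a(G_bi), which is minus the skew
  \<open>E\<close>, contracted with the symmetric v^a v^b.\<close>

lemma Gamma_nh_multiplier:
  assumes q: "q \<in> dom"
  shows "Gamma_nh S \<xi> nabla c (theta (\<lambda>c a i q. - G_hv S \<xi> c a i q) c i) q v + multiplier S \<xi> nabla c i q v = 0"
proof -
  obtain E where E: "\<And>a b. X a q (HV b i) = gmetric S q (nabla (X a) (X b) q) (V i q) + E a b"
    "\<And>a b. E a b + E b a = 0" using X_HV[OF q, of i] by blast
  have s: "smooth_near (atlQ S) (\<lambda>p. - HV b i p * v $ b) q" for b
    by (intro Q.smooth_near_mult Q.smooth_near_minus HV_smooth[OF q] Q.smooth_near_const)
  have XT: "X a q (\<lambda>p. theta (\<lambda>c a i q. - G_hv S \<xi> c a i q) c i p v) = - (\<Sum>b\<in>UNIV. X a q (HV b i) * v $ b)" for a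
    unfolding theta_def Q.tvec_sum[OF X_tspace[OF q] s]
      Q.tvec_mult[OF X_tspace[OF q] Q.smooth_near_minus[OF HV_smooth[OF q]] Q.smooth_near_const]
      Q.tvec_const[OF X_tspace[OF q]] Q.tvec_minus[OF X_tspace[OF q] HV_smooth[OF q]]
    by (simp add: sum_negf)
  \<comment> \<open>theta is linear in v, so its derivative along the d-th velocity axis is its d-th
    coefficient.\<close>
  have DT: "frechet_derivative (theta (\<lambda>c a i q. - G_hv S \<xi> c a i q) c i q) (at v) (axis d 1) = - HV d i q" for d
  proof -
    have "bounded_linear (\<lambda>v :: real^'m. \<Sum>a\<in>UNIV. - HV a i q * v $ a)"
      by (intro bounded_linear_sum bounded_linear_const_mult bounded_linear_vec_nth)
    then have "((\<lambda>v :: real^'m. \<Sum>a\<in>UNIV. - HV a i q * v $ a) has_derivative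
        (\<lambda>v. \<Sum>a\<in>UNIV. - HV a i q * v $ a)) (at v)"
      by (rule bounded_linear_imp_has_derivative)
    from frechet_derivative_at[OF this, symmetric]
    have "frechet_derivative (theta (\<lambda>c a i q. - G_hv S \<xi> c a i q) c i q) (at v) =
        (\<lambda>v. \<Sum>a\<in>UNIV. - HV a i q * v $ a)" unfolding theta_def[abs_def] .
    then show ?thesis
      using sum_delta(1)[of "\<lambda>a. - HV a i q" d] by (simp add: axis_def delta_def)
  qed
  have G: "Gamma_nh S \<xi> nabla c (theta (\<lambda>c a i q. - G_hv S \<xi> c a i q) c i) q v =
      (\<Sum>a\<in>UNIV. \<Sum>b\<in>UNIV. ((\<Sum>d\<in>UNIV. \<Gamma> (Inl d) a b q * HV d i q) - X a q (HV b i)) * v $ a * v $ b)"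
  proof -
    have "(\<Sum>d\<in>UNIV. (\<Sum>a\<in>UNIV. \<Sum>b\<in>UNIV. \<Gamma> (Inl d) a b q * v $ a * v $ b) * HV d i q) =
        (\<Sum>a\<in>UNIV. \<Sum>d\<in>UNIV. \<Sum>b\<in>UNIV. \<Gamma> (Inl d) a b q * v $ a * v $ b * HV d i q)"
      unfolding sum_distrib_right by (rule sum.swap)
    also have "\<dots> = (\<Sum>a\<in>UNIV. \<Sum>b\<in>UNIV. \<Sum>d\<in>UNIV. \<Gamma> (Inl d) a b q * v $ a * v $ b * HV d i q)"
      by (intro sum.cong refl sum.swap)
    finally show ?thesis
      unfolding Gamma_nh_def frame_Inl XT DT
      by (simp add: sum_negf sum_subtractf sum_distrib_left sum_distrib_right algebra_simps)
  qed
  have "multiplier S \<xi> nabla c i q v =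
      (\<Sum>a\<in>UNIV. \<Sum>k\<in>UNIV. \<Sum>b\<in>UNIV. g_coeff S \<xi> c (Inr k) (Inr i) q * \<Gamma> (Inr k) a b q * v $ a * v $ b)"
    unfolding multiplier_def by (rule sum.swap)
  also have "\<dots> = (\<Sum>a\<in>UNIV. \<Sum>b\<in>UNIV. \<Sum>k\<in>UNIV. g_coeff S \<xi> c (Inr k) (Inr i) q * \<Gamma> (Inr k) a b q * v $ a * v $ b)"
    by (intro sum.cong refl sum.swap)
  also have "\<dots> = (\<Sum>a\<in>UNIV. \<Sum>b\<in>UNIV.
      (gmetric S q (nabla (X a) (X b) q) (V i q) - (\<Sum>d\<in>UNIV. \<Gamma> (Inl d) a b q * HV d i q)) * v $ a * v $ b)"
    unfolding multiplier_coeff[OF q, symmetric] by (simp add: sum_distrib_right)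
  finally have M: "multiplier S \<xi> nabla c i q v = (\<Sum>a\<in>UNIV. \<Sum>b\<in>UNIV.
      (gmetric S q (nabla (X a) (X b) q) (V i q) - (\<Sum>d\<in>UNIV. \<Gamma> (Inl d) a b q * HV d i q)) * v $ a * v $ b)" .
  have "Gamma_nh S \<xi> nabla c (theta (\<lambda>c a i q. - G_hv S \<xi> c a i q) c i) q v + multiplier S \<xi> nabla c i q v =
      (\<Sum>a\<in>UNIV. \<Sum>b\<in>UNIV. - (E a b * v $ a * v $ b))"
    unfolding G M sum.distrib[symmetric] E(1) by (intro sum.cong refl) (simp add: algebra_simps)
  then show ?thesis using skew_sum_zero[of E "\<lambda>a. v $ a", OF E(2)] by (simp add: sum_negf)
qed

section \<open>The two conditions at a fixed point and velocity\<close>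

context
  fixes \<phi> :: "'x \<Rightarrow> real" and q :: 'q
  assumes \<phi>: "smooth_fun (atlB S) UNIV \<phi>" "phi_simple S \<xi> \<phi>" and q: "q \<in> dom"
begin

abbreviation P :: "'m \<Rightarrow> real" where "P a \<equiv> X a q (\<phi> \<circ> proj S)"

lemma phi_smooth: "smooth_near (atlB S) \<phi> x"
  using \<phi>(1) by (auto simp: smooth_near_def)

text \<open>Applying the tensor identity to coordinate fields, and the resulting vector to the d-th
  coordinate function, isolates one component. X_a(F) is the partial derivative of \<phi> because
  X_a projects to the coordinate field.\<close>

lemma R_phi: "R (Inl d) (Inl a) (Inl b) q = - P a * delta b d + P b * delta a d"
proof -
  let ?x = "proj S q"
  have x: "?x \<in> fst c" using q by simp
  obtain T where T: "gyroscopic_tensor S \<xi> T"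
    "\<forall>x. \<forall>u\<in>tspace (atlB S) x. \<forall>w\<in>tspace (atlB S) x. T x u w = (\<lambda>f. - u \<phi> * w f + w \<phi> * u f)"
    using \<phi>(2) unfolding phi_simple_def by blast
  have P: "coord_field S c a ?x \<phi> = P a" for a
    using X_pullback[OF q phi_smooth, of a] by (simp add: o_def)
  have "lincomb (\<lambda>d. coord_field S c d ?x) (\<lambda>d. R (Inl d) (Inl a) (Inl b) q) =
      T ?x (coord_field S c a ?x) (coord_field S c b ?x)"
    using T(1) chart x unfolding gyroscopic_tensor_def by simp
  also have "\<dots> = (\<lambda>f. - P a * coord_field S c b ?x f + P b * coord_field S c a ?x f)"
    using T(2) coord_field_tspace[OF x] by (simp add: P)
  finally have "lincomb (\<lambda>d. coord_field S c d ?x) (\<lambda>d. R (Inl d) (Inl a) (Inl b) q) (\<lambda>y. snd c y $ d) =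
      - P a * delta b d + P b * delta a d"
    by (simp add: coord_field_coord[OF x])
  then show ?thesis by (simp add: lincomb_def coord_field_coord[OF x] sum_delta)
qed

context
  fixes v :: "real^'m"
begin

text \<open>With u = v^b X_b this is g(u, X_a), and \<open>HVv\<close> below is g(u, V_k); theta_k
  is then minus \<open>HVv k\<close>.\<close>

definition low :: "'m \<Rightarrow> real" where "low a = (\<Sum>b\<in>UNIV. H b a q * v $ b)"
definition HVv :: "'k \<Rightarrow> real" where "HVv k = (\<Sum>b\<in>UNIV. HV b k q * v $ b)"

lemma theta_HVv: "theta (\<lambda>c a i q. - G_hv S \<xi> c a i q) c k q v = - HVv k"
  by (simp add: theta_def HVv_def sum_negf)

text \<open>By \<open>H_K\<close>, contracting with G_ek converts the vertical components of
  [X_a, X_b] into its components along the distribution, and these are prescribed by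
  \<phi>-simplicity. Both conditions rest on this contraction.\<close>

lemma HVv_R: "(\<Sum>k\<in>UNIV. HVv k * R (Inr k) (Inl a) (Inl b) q) = P b * low a - P a * low b"
proof -
  have 1: "(\<Sum>k\<in>UNIV. HV e k q * R (Inr k) (Inl a) (Inl b) q) = P b * H e a q - P a * H e b q" for e
  proof -
    have HV: "HV e k q = - (\<Sum>d\<in>UNIV. H e d q * K d k q)" for k using H_K[OF q, of e k] by simp
    have "(\<Sum>k\<in>UNIV. HV e k q * R (Inr k) (Inl a) (Inl b) q) =
        (\<Sum>d\<in>UNIV. H e d q * R (Inl d) (Inl a) (Inl b) q)"
      unfolding bracket_X(2)[OF q] HV sum_negf[symmetric] sum_distrib_left sum_distrib_right
      by (subst sum.swap) (simp add: mult_ac)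
    also have "\<dots> = P b * (\<Sum>d\<in>UNIV. H e d q * delta a d) - P a * (\<Sum>d\<in>UNIV. H e d q * delta b d)"
      unfolding R_phi sum_distrib_left sum_subtractf[symmetric]
      by (intro sum.cong refl) (simp add: algebra_simps)
    finally show ?thesis unfolding sum_delta .
  qed
  have "(\<Sum>k\<in>UNIV. HVv k * R (Inr k) (Inl a) (Inl b) q) =
      (\<Sum>e\<in>UNIV. (\<Sum>k\<in>UNIV. HV e k q * R (Inr k) (Inl a) (Inl b) q) * v $ e)"
    unfolding HVv_def sum_distrib_right by (subst sum.swap) (simp add: mult_ac)
  also have "\<dots> = P b * low a - P a * low b"
    unfolding 1 low_def sum_distrib_left sum_subtractf[symmetric]
    by (intro sum.cong refl) (simp add: algebra_simps)
  finally show ?thesis .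
qed

text \<open>Summing out the deltas turns the terms with F into P_e g(u, X_a) - P_a g(u, X_e),
  contracted with v^a. By \<open>HVv_R\<close> the curvature term is the same sum with the opposite
  sign, which comes from theta.\<close>

lemma condition_A_at:
  "(\<Sum>a\<in>UNIV. \<Sum>b\<in>UNIV. \<Sum>d\<in>UNIV. g_coeff S \<xi> c (Inl b) (Inl d) q *
      (delta a d * Z (Inl e) q (\<phi> \<circ> proj S) - delta e d * Z (Inl a) q (\<phi> \<circ> proj S)) * v $ a * v $ b)
    + (\<Sum>k\<in>UNIV. \<Sum>a\<in>UNIV. theta (\<lambda>c a i q. - G_hv S \<xi> c a i q) c k q v * R (Inr k) (Inl a) (Inl e) q * v $ a) = 0"
proof -
  have d: "(\<Sum>d\<in>UNIV. g_coeff S \<xi> c (Inl b) (Inl d) q * (delta a d * P e - delta e d * P a) * v $ a * v $ b) =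
      (P e * H b a q - P a * H b e q) * v $ a * v $ b" for a b
  proof -
    have "(\<Sum>d\<in>UNIV. H b d q * (delta a d * P e - delta e d * P a)) =
        P e * (\<Sum>d\<in>UNIV. H b d q * delta a d) - P a * (\<Sum>d\<in>UNIV. H b d q * delta e d)"
      unfolding sum_distrib_left sum_subtractf[symmetric]
      by (intro sum.cong refl) (simp add: algebra_simps)
    then show ?thesis unfolding sum_distrib_right[symmetric] sum_delta by (simp add: g_coeff_def G_hh_def)
  qed
  have "(\<Sum>a\<in>UNIV. \<Sum>b\<in>UNIV. \<Sum>d\<in>UNIV. g_coeff S \<xi> c (Inl b) (Inl d) q *
      (delta a d * P e - delta e d * P a) * v $ a * v $ b) = (\<Sum>a\<in>UNIV. (P e * low a - P a * low e) * v $ a)"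
    unfolding d by (simp add: low_def sum_distrib_left sum_distrib_right sum_subtractf algebra_simps)
  moreover have "(\<Sum>k\<in>UNIV. \<Sum>a\<in>UNIV. theta (\<lambda>c a i q. - G_hv S \<xi> c a i q) c k q v *
      R (Inr k) (Inl a) (Inl e) q * v $ a) = - (\<Sum>a\<in>UNIV. (P e * low a - P a * low e) * v $ a)"
    unfolding theta_HVv HVv_R[symmetric] sum_distrib_right sum_negf[symmetric]
    by (subst sum.swap) simp
  ultimately show ?thesis by simp
qed

text \<open>The velocity u = v^a X_a is orthogonal to X_i = V_i + K^b_i X_b.\<close>

lemma K_low: "(\<Sum>b\<in>UNIV. K b i q * low b) = - HVv i"
proof -
  have "(\<Sum>b\<in>UNIV. K b i q * low b) = (\<Sum>a\<in>UNIV. (\<Sum>b\<in>UNIV. H a b q * K b i q) * v $ a)"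
    unfolding low_def sum_distrib_left sum_distrib_right by (subst sum.swap) (simp add: mult_ac)
  then show ?thesis unfolding H_K[OF q] HVv_def by (simp add: sum_negf)
qed

text \<open>\<open>Gamma_nh_multiplier\<close> disposes of the first two terms. Through
  \<open>R_mixed\<close> and \<open>HVv_R\<close>, R^k_ia contributes two more: the one with X_a(F)
  cancels the delta term, and the other becomes X_i(F) g(u, u), which is the last sum.\<close>

lemma condition_B_at:
  "Gamma_nh S \<xi> nabla c (theta (\<lambda>c a i q. - G_hv S \<xi> c a i q) c i) q v + multiplier S \<xi> nabla c i q v
    + (\<Sum>k\<in>UNIV. \<Sum>a\<in>UNIV. theta (\<lambda>c a i q. - G_hv S \<xi> c a i q) c k q v *
        (R (Inr k) (Inr i) (Inl a) q + delta k i * Z (Inl a) q (\<phi> \<circ> proj S)) * v $ a)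
    - (\<Sum>a\<in>UNIV. \<Sum>b\<in>UNIV. g_coeff S \<xi> c (Inl a) (Inl b) q * Z (Inr i) q (\<phi> \<circ> proj S) * v $ a * v $ b) = 0"
proof -
  define p where "p = (\<Sum>a\<in>UNIV. P a * v $ a)"
  define l where "l = (\<Sum>a\<in>UNIV. low a * v $ a)"
  define KP where "KP = (\<Sum>b\<in>UNIV. K b i q * P b)"
  \<comment> \<open>F is constant along the fibres, so V_i(F) = 0 and only the part K^b_i X_b of X_i
    acts on it.\<close>
  have ZF: "Z (Inr i) q (\<phi> \<circ> proj S) = KP"
    using V_pullback[OF phi_smooth, of i q] by (simp add: frame_Inr KP_def o_def)
  have R: "(\<Sum>k\<in>UNIV. HVv k * R (Inr k) (Inr i) (Inl a) q) = - P a * HVv i - KP * low a" for a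
  proof -
    have "(\<Sum>k\<in>UNIV. HVv k * R (Inr k) (Inr i) (Inl a) q) =
        (\<Sum>b\<in>UNIV. K b i q * (\<Sum>k\<in>UNIV. HVv k * R (Inr k) (Inl b) (Inl a) q))"
      unfolding R_mixed[OF q] sum_distrib_left by (subst sum.swap) (simp add: mult_ac)
    also have "\<dots> = P a * (\<Sum>b\<in>UNIV. K b i q * low b) - KP * low a"
      unfolding HVv_R KP_def sum_distrib_left sum_distrib_right sum_subtractf[symmetric]
      by (intro sum.cong refl) (simp add: algebra_simps)
    finally show ?thesis unfolding K_low by simp
  qed
  have "(\<Sum>k\<in>UNIV. \<Sum>a\<in>UNIV. - HVv k * (R (Inr k) (Inr i) (Inl a) q + delta k i * P a) * v $ a) =
      (\<Sum>a\<in>UNIV. - ((\<Sum>k\<in>UNIV. HVv k * R (Inr k) (Inr i) (Inl a) q) + (\<Sum>k\<in>UNIV. HVv k * delta k i) * P a) * v $ a)"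
    by (subst sum.swap)
      (simp add: sum_distrib_left sum_distrib_right distrib_left distrib_right sum.distrib sum_negf mult.assoc
        left_diff_distrib sum_subtractf)
  also have "\<dots> = (\<Sum>a\<in>UNIV. KP * low a * v $ a)"
    unfolding R sum_delta by (simp add: algebra_simps)
  also have "\<dots> = KP * l" by (simp add: l_def sum_distrib_left mult.assoc)
  finally have 1: "(\<Sum>k\<in>UNIV. \<Sum>a\<in>UNIV. - HVv k * (R (Inr k) (Inr i) (Inl a) q + delta k i * P a) * v $ a) = KP * l" .
  have "(\<Sum>a\<in>UNIV. \<Sum>b\<in>UNIV. H a b q * KP * v $ a * v $ b) = KP * l"
    unfolding l_def low_def by (subst sum.swap) (simp add: sum_distrib_left sum_distrib_right mult_ac)
  then show ?thesis
    unfolding Gamma_nh_multiplier[OF q] theta_HVv ZF frame_Inl 1 by (simp add: g_coeff_def G_hh_def)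
qed

end

end

end

theorem proposition3:
  fixes S :: "('q::{t2_space, second_countable_topology}, 'x::{t2_space, second_countable_topology},
      'g::{t2_space, second_countable_topology}, 'n::finite, 'm::finite, 'k::finite) chaplygin_data"
    and \<xi> :: "'k \<Rightarrow> 'g tvec"
    and nabla :: "('q \<Rightarrow> 'q tvec) \<Rightarrow> ('q \<Rightarrow> 'q tvec) \<Rightarrow> 'q \<Rightarrow> 'q tvec"
    and \<phi> :: "'x \<Rightarrow> real"
  assumes "chaplygin_system S"
    and "lie_algebra_basis S \<xi>"
    and "levi_civita (atlQ S) (gmetric S) nabla"
    and "smooth_fun (atlB S) UNIV \<phi>"
    and "phi_simple S \<xi> \<phi>"
  shows "projective_geodesic_extension S \<xi> nabla (\<lambda>c a i q. - G_hv S \<xi> c a i q) (\<phi> \<circ> proj S) \<and>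
    orthogonal_components S \<xi> (\<lambda>c a i q. - G_hv S \<xi> c a i q)"
proof -
  interpret chaplygin S \<xi> using assms(1,2) by unfold_locales
  \<comment> \<open>The conditions range over all charts of the quotient, while the locale fixes
    one; each chart provides an instance.\<close>
  have levi: "chaplygin_levi S \<xi> c nabla" if "c \<in> charts (atlB S)" for c
    using that assms(3) by unfold_locales
  have "condition_A S \<xi> (\<lambda>c a i q. - G_hv S \<xi> c a i q) (\<phi> \<circ> proj S)"
    unfolding condition_A_def
    using chaplygin_levi.condition_A_at[OF levi assms(4,5)] by simp
  moreover have "condition_B S \<xi> nabla (\<lambda>c a i q. - G_hv S \<xi> c a i q) (\<phi> \<circ> proj S)"
    unfolding condition_B_def
    using chaplygin_levi.condition_B_at[OF levi assms(4,5)] by simp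
  ultimately show ?thesis
    using orthogonal_components_hor_metric unfolding projective_geodesic_extension_def by blast
qed

end
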